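(* Let $G$ and $H$ be locally compact groups. Then $$\Lambda_{\mathrm{WH}}(G \times H) = \Lambda_{\mathrm{WH}}(G)\, \Lambda_{\mathrm{WH}}(H),$$ where the constants take values in $[0,\infty]$ (so if one of the two factors on the right is infinite, the statement is that $\Lambda_{\mathrm{WH}}(G\times H)=\infty$).
   Context: Herz--Schur multipliers. Let $G$ be a locally compact group with left Haar measure $\mu_G$. A continuous function $u\colon G\to\mathbb{C}$ is a Herz--Schur multiplier if the kernel $(s,t)\mapsto u(t^{-1}s)$ defines a bounded Schur multiplier on $\mathrm{B}(L^2(G))$. That is, writing $K_f$ for the Hilbert--Schmidt operator on $L^2(G)$ with kernel $f \in L^2(G\times G)$, the map sending $K_f$ to the operator with kernel $(s,t)\mapsto u(t^{-1}s)f(s,t)$ extends to a bounded operator from the compact operators on $L^2(G)$ into $\mathrm{B}(L^2(G))$, and hence to a unique weak* continuous bounded operator $M$ on $\mathrm{B}(L^2(G))$. The set of Herz--Schur multipliers is denoted $\mathrm{B}_2(G)$ and is normed by $\|u\|_{\mathrm{B}_2(G)}=\|M\|$. Equivalently (known characterization), a continuous $u$ belongs to $\mathrm{B}_2(G)$ if and only if $$\sup\big\{\|M_{[u(s_j^{-1}s_i)]_{i,j=1}^n}\|_{\mathrm{M}_n\to \mathrm{M}_n} : n\ge 1,\ s_1,\dots,s_n\in G\big\}<\infty,$$ and this supremum is then $\|u\|_{\mathrm{B}_2(G)}$. Here $\mathrm{M}_n$ is the algebra of complex $n\times n$ matrices with the operator norm and, for $\varphi \in \mathrm{M}_n$, $M_\varphi\colon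 \mathrm{M}_n\to \mathrm{M}_n$, $[a_{ij}]\mapsto[\varphi_{ij}a_{ij}]$. Weak Haagerup constant. $\mathrm{C}_0(G)$ is the space of continuous complex functions on $G$ vanishing at infinity. $\Lambda_{\mathrm{WH}}(G)$ is the infimum of all constants $C>0$ for which there exists a net $(u_\alpha)$ in $\mathrm{B}_2(G)\cap \mathrm{C}_0(G)$ with $\|u_\alpha\|_{\mathrm{B}_2(G)}\le C$ for all $\alpha$ and $u_\alpha\to 1$ uniformly on compact subsets of $G$; if there is no such $C$, $\Lambda_{\mathrm{WH}}(G)=\infty$. *)

theory Defs
  imports "HOL-Analysis.Analysis"
begin

text \<open>
  Locally compact groups are types of class \<open>topological_group_add\<close> and \<open>t2_space\<close> whose
  topology satisfies \<open>locally_compact_space\<close>. The class \<open>group_add\<close> does not assume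
  commutativity: the group law is merely written additively, so that the product
  \<open>t\<inverse>s\<close> reads \<open>- t + s\<close>. The product group \<open>G \<times> H\<close> is the product type.
\<close>

instance prod :: (topological_monoid_add, topological_monoid_add) topological_monoid_add
proof
  fix a b :: "'a \<times> 'b"
  have "((\<lambda>x. (fst (fst x) + fst (snd x), snd (fst x) + snd (snd x)))
      \<longlongrightarrow> (fst a + fst b, snd a + snd b)) (nhds a \<times>\<^sub>F nhds b)"
    by (intro tendsto_Pair tendsto_add tendsto_fst tendsto_snd filterlim_fst filterlim_snd)
  then show "((\<lambda>x. fst x + snd x) \<longlongrightarrow> a + b) (nhds a \<times>\<^sub>F nhds b)"
    by (simp add: plus_prod_def)
qed

instance prod :: (topological_group_add, topological_group_add) topological_group_add
proof
  fix a :: "'a \<times> 'b"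
  have "((\<lambda>x. (- fst x, - snd x)) \<longlongrightarrow> (- fst a, - snd a)) (nhds a)"
    by (intro tendsto_Pair tendsto_minus tendsto_fst tendsto_snd filterlim_ident)
  moreover have "(\<lambda>x. (- fst x, - snd x)) = (uminus :: 'a \<times> 'b \<Rightarrow> 'a \<times> 'b)"
    by (simp add: fun_eq_iff uminus_prod_def)
  ultimately show "(uminus \<longlongrightarrow> - a) (nhds a)"
    by (simp add: uminus_prod_def)
qed

text \<open>
  A left Haar measure: a nonzero left-invariant Radon measure on the Borel sets (finite on
  compact sets, outer regular on Borel sets, inner regular on open sets).
\<close>

definition left_haar_measure :: "'a::{topological_group_add, t2_space} measure \<Rightarrow> bool" where
  "left_haar_measure \<mu> \<longleftrightarrow>
     sets \<mu> = sets borel \<and>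
     (\<forall>K. compact K \<longrightarrow> emeasure \<mu> K < \<infinity>) \<and>
     (\<forall>A\<in>sets borel. emeasure \<mu> A = (INF U\<in>{U. open U \<and> A \<subseteq> U}. emeasure \<mu> U)) \<and>
     (\<forall>U. open U \<longrightarrow> emeasure \<mu> U = (SUP K\<in>{K. compact K \<and> K \<subseteq> U}. emeasure \<mu> K)) \<and>
     (\<forall>g. \<forall>A\<in>sets borel. emeasure \<mu> ((\<lambda>x. g + x) ` A) = emeasure \<mu> A) \<and>
     emeasure \<mu> UNIV \<noteq> 0"

text \<open>
  Elements of \<open>L\<^sup>2(G)\<close> are represented by functions, and \<open>L2_norm\<close> is a seminorm on them.
\<close>

definition L2_space :: "'a measure \<Rightarrow> ('a \<Rightarrow> complex) set" where
  "L2_space \<mu> = {\<xi>. \<xi> \<in> borel_measurable \<mu> \<and> integrable \<mu> (\<lambda>x. (cmod (\<xi> x))\<^sup>2)}"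

definition L2_norm :: "'a measure \<Rightarrow> ('a \<Rightarrow> complex) \<Rightarrow> real" where
  "L2_norm \<mu> \<xi> = sqrt (\<integral>x. (cmod (\<xi> x))\<^sup>2 \<partial>\<mu>)"

definition L2_op_norm :: "'a measure \<Rightarrow> (('a \<Rightarrow> complex) \<Rightarrow> ('a \<Rightarrow> complex)) \<Rightarrow> real" where
  "L2_op_norm \<mu> T = (SUP \<xi>\<in>{\<xi>\<in>L2_space \<mu>. L2_norm \<mu> \<xi> \<le> 1}. L2_norm \<mu> (T \<xi>))"

text \<open>
  Representatives of the elements of \<open>L\<^sup>2(G \<times> G)\<close>. Haar measure need not be \<open>\<sigma>\<close>-finite, and
  for a group that is not second countable the Borel sets of \<open>G \<times> G\<close> may form a larger
  \<open>\<sigma>\<close>-algebra than the product \<open>\<sigma>\<close>-algebra. However, since \<open>C\<^sub>c(G \<times> G)\<close> is dense, every class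
  in \<open>L\<^sup>2(G \<times> G)\<close> has a representative that vanishes outside \<open>S \<times> S\<close> for some \<open>\<sigma>\<close>-compact set
  \<open>S\<close> and is measurable for the product \<open>\<sigma>\<close>-algebra; for such functions the iterated
  integral below is the integral over \<open>G \<times> G\<close>.
\<close>

definition L2_kernels ::
    "'a::{topological_group_add, t2_space} measure \<Rightarrow> ('a \<times> 'a \<Rightarrow> complex) set" where
  "L2_kernels \<mu> = {f.
     f \<in> borel_measurable (\<mu> \<Otimes>\<^sub>M \<mu>) \<and>
     (\<exists>K :: nat \<Rightarrow> 'a set. (\<forall>n. compact (K n)) \<and>
        (\<forall>s t. f (s, t) \<noteq> 0 \<longrightarrow> s \<in> (\<Union>n. K n) \<and> t \<in> (\<Union>n. K n))) \<and>
     (\<integral>\<^sup>+ s. (\<integral>\<^sup>+ t. ennreal ((cmod (f (s, t)))\<^sup>2) \<partial>\<mu>) \<partial>\<mu>) < \<infinity>}"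

definition kernel_op ::
    "'a measure \<Rightarrow> ('a \<times> 'a \<Rightarrow> complex) \<Rightarrow> ('a \<Rightarrow> complex) \<Rightarrow> 'a \<Rightarrow> complex" where
  "kernel_op \<mu> f \<xi> = (\<lambda>s. \<integral>t. f (s, t) * \<xi> t \<partial>\<mu>)"

text \<open>
  \<open>schur_bound \<mu> \<phi> C\<close>: the map taking the Hilbert--Schmidt operator with kernel \<open>f\<close> to the
  operator with kernel \<open>\<phi> f\<close> is bounded by \<open>C\<close> for the operator norms. The Hilbert--Schmidt
  operators being norm dense in the compact operators, this says precisely that the map
  extends to an operator of norm at most \<open>C\<close> from the compact operators on \<open>L\<^sup>2(G)\<close> to
  \<open>B(L\<^sup>2(G))\<close>; the weak* continuous extension of the latter to \<open>B(L\<^sup>2(G))\<close> has the same norm.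
  Asking \<open>\<phi> f\<close> to be again a kernel in \<open>L\<^sup>2\<close> is no restriction, as a continuous \<open>u\<close> whose
  kernel is a bounded Schur multiplier is itself bounded; it excludes kernels for which
  \<open>kernel_op\<close> and \<open>L2_op_norm\<close> would return default values.
\<close>

definition schur_bound ::
    "'a::{topological_group_add, t2_space} measure \<Rightarrow> ('a \<times> 'a \<Rightarrow> complex) \<Rightarrow> real \<Rightarrow> bool" where
  "schur_bound \<mu> \<phi> C \<longleftrightarrow> 0 \<le> C \<and>
     (\<forall>f\<in>L2_kernels \<mu>. (\<lambda>p. \<phi> p * f p) \<in> L2_kernels \<mu> \<and>
        L2_op_norm \<mu> (kernel_op \<mu> (\<lambda>p. \<phi> p * f p)) \<le> C * L2_op_norm \<mu> (kernel_op \<mu> f))"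

definition herz_schur_kernel :: "('a::group_add \<Rightarrow> complex) \<Rightarrow> 'a \<times> 'a \<Rightarrow> complex" where
  "herz_schur_kernel u = (\<lambda>(s, t). u (- t + s))"

definition herz_schur_multipliers ::
    "'a::{topological_group_add, t2_space} measure \<Rightarrow> ('a \<Rightarrow> complex) set" where
  "herz_schur_multipliers \<mu> =
     {u. continuous_on UNIV u \<and> (\<exists>C. schur_bound \<mu> (herz_schur_kernel u) C)}"

definition herz_schur_norm ::
    "'a::{topological_group_add, t2_space} measure \<Rightarrow> ('a \<Rightarrow> complex) \<Rightarrow> real" where
  "herz_schur_norm \<mu> u = Inf {C. schur_bound \<mu> (herz_schur_kernel u) C}"

definition C0_functions :: "('a::topological_space \<Rightarrow> complex) set" where
  "C0_functions = {u. continuous_on UNIV u \<and>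
     (\<forall>\<epsilon>>0. \<exists>K. compact K \<and> (\<forall>x. x \<notin> K \<longrightarrow> cmod (u x) < \<epsilon>))}"

text \<open>
  A net \<open>(u\<^sub>\<alpha>)\<close> of functions is represented by the proper filter generated by its tails
  \<open>{u\<^sub>\<beta> | \<beta> \<ge> \<alpha>}\<close>; every proper filter on the function space arises in this way. The
  infimum is taken in \<open>[0,\<infinity>]\<close>, so that it is \<open>\<infinity>\<close> if there is no admissible \<open>C\<close>.
\<close>

definition weak_haagerup_const :: "'a::{topological_group_add, t2_space} measure \<Rightarrow> ennreal" where
  "weak_haagerup_const \<mu> = Inf {ennreal C | C. C > 0 \<and>
     (\<exists>F :: ('a \<Rightarrow> complex) filter. F \<noteq> bot \<and>
        (\<forall>\<^sub>F u in F. u \<in> herz_schur_multipliers \<mu> \<inter> C0_functions \<and> herz_schur_norm \<mu> u \<le> C) \<and>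
        (\<forall>K. compact K \<longrightarrow> uniform_limit K (\<lambda>u. u) (\<lambda>_. 1) F))}"

end

theory Submission
  imports Defs
begin

text \<open>
  Write \<open>\<parallel>u\<parallel>\<close> for the Herz-Schur norm of \<open>u\<close>, and \<open>W(G, C)\<close> for the property that the constant
  1 can be approximated uniformly on compact subsets of \<open>G\<close> by functions \<open>u\<close> in \<open>C\<^sub>0(G)\<close> with
  \<open>\<parallel>u\<parallel> \<le> C\<close> (\<open>haagerup_bound\<close>). The weak Haagerup constant is the infimum of the \<open>C\<close> with
  \<open>W(G, C)\<close>.

  All estimates rest on the description of Schur multipliers by finite matrices: a continuous
  kernel \<open>\<phi>\<close> is a Schur multiplier of norm at most \<open>C\<close> on \<open>L\<^sup>2(G)\<close> iff for all finite sets of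
  points the entrywise product with \<open>[\<phi>(s, t)]\<close> multiplies the norm of matrices by at most \<open>C\<close>
  (\<open>finite_schur_bound_imp_schur_bound\<close>, \<open>schur_bound_imp_finite_schur_bound\<close>). In both
  directions the kernel is replaced by one that is constant on the rectangles of a finite partition
  and close to \<open>\<phi>\<close>; for such a kernel the operator on \<open>L\<^sup>2(G)\<close> splits into finitely many blocks,
  each multiplied by a scalar, and \<open>kernel_pairing_step_approx\<close> controls the error by the
  Hilbert-Schmidt norm. What makes the block form equivalent to the scalar one is that a
  Schur multiplier has the same norm on matrices with operator entries: test vectors can be
  normalised in every block separately, which leaves a scalar matrix (\<open>finite_schur_bound_weighted\<close>).

  The inequality \<open>\<le>\<close> for the constants is then immediate, because
  \<open>(x, y) \<mapsto> u x * v y\<close> has norm at most \<open>\<parallel>u\<parallel> \<parallel>v\<parallel>\<close> and lies in \<open>C\<^sub>0\<close>.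

  For \<open>\<ge>\<close>, suppose that \<open>W(G, a)\<close> and \<open>W(H, b)\<close> fail but \<open>W(G \<times> H, E)\<close> holds. By the Hahn-Banach
  theorem there is a linear functional \<open>\<Phi>\<close> on bounded continuous functions on \<open>G\<close>, bounded by a
  multiple of the supremum over some compact set, with \<open>\<Phi>(1) = 1\<close> and \<open>\<bar>\<Phi>(u)\<bar> \<le> \<parallel>u\<parallel> / a\<close> on the
  multipliers in \<open>C\<^sub>0(G)\<close>; let \<open>\<Psi>\<close> be such a functional for \<open>H\<close> and \<open>b\<close>
  (\<open>separating_functional\<close>). If \<open>w\<close> on \<open>G \<times> H\<close> is in \<open>C\<^sub>0\<close> with \<open>\<parallel>w\<parallel> \<le> E\<close>, then
  \<open>u(x) = \<Psi>(w(x, \<cdot>))\<close> is in \<open>C\<^sub>0(G)\<close>, since \<open>\<Psi>\<close> only sees a compact set, and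
  \<open>\<parallel>u\<parallel> \<le> E / b\<close>: pairing \<open>u\<close> with matrices commutes with \<open>\<Psi>\<close>, and slicing \<open>w\<close> by a functional of
  finite support yields a function on \<open>H\<close> whose norm is controlled by the norm of a Kronecker product
  (\<open>herz_schur_bound_slices\<close>, \<open>slice_map\<close>). Hence \<open>\<bar>\<Phi>(u)\<bar> \<le> E / (a b)\<close>. Letting \<open>w\<close> tend to 1 uniformly on
  a product of compact sets, \<open>\<Phi>(u)\<close> tends to 1, so that \<open>a b \<le> E\<close>.
\<close>

section \<open>Schur multipliers of finite matrices\<close>

abbreviation vec_norm :: "'i set \<Rightarrow> ('i \<Rightarrow> complex) \<Rightarrow> real" where
  "vec_norm I x \<equiv> sqrt (\<Sum>i\<in>I. (cmod (x i))\<^sup>2)"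

text \<open>
  The operator norm of the matrix is at most \<open>M\<close>. The bilinear form is equivalent to the sesquilinear
  one, as conjugation preserves the norm of the test vectors. Arbitrary index types permit repeated
  points and Kronecker products.
\<close>

definition mat_bound :: "'i set \<Rightarrow> 'j set \<Rightarrow> ('i \<Rightarrow> 'j \<Rightarrow> complex) \<Rightarrow> real \<Rightarrow> bool" where
  "mat_bound I J a M \<longleftrightarrow> 0 \<le> M \<and>
     (\<forall>x y. cmod (\<Sum>i\<in>I. \<Sum>j\<in>J. a i j * x i * y j)
        \<le> M * vec_norm I x * vec_norm J y)"

text \<open>
  The matrices are indexed by distinct points here, which is the form that can be tested on \<open>L\<^sup>2(G)\<close>
  by functions with disjoint supports.
\<close>

definition finite_schur_bound :: "('a \<Rightarrow> 'a \<Rightarrow> complex) \<Rightarrow> real \<Rightarrow> bool" where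
  "finite_schur_bound k C \<longleftrightarrow> 0 \<le> C \<and>
     (\<forall>A a M. finite A \<longrightarrow> mat_bound A A a M \<longrightarrow> mat_bound A A (\<lambda>s t. k s t * a s t) (C * M))"

lemma mat_boundD:
  assumes "mat_bound I J a M"
  shows "cmod (\<Sum>i\<in>I. \<Sum>j\<in>J. a i j * x i * y j)
        \<le> M * vec_norm I x * vec_norm J y"
  using assms unfolding mat_bound_def by blast

lemma mat_bound_nonneg: "mat_bound I J a M \<Longrightarrow> 0 \<le> M"
  unfolding mat_bound_def by blast

lemma finite_schur_bound_nonneg: "finite_schur_bound k C \<Longrightarrow> 0 \<le> C"
  unfolding finite_schur_bound_def by blast

lemma finite_schur_boundD:
  assumes "finite_schur_bound k C" "finite A" "mat_bound A A a M"
  shows "mat_bound A A (\<lambda>s t. k s t * a s t) (C * M)"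
  using assms unfolding finite_schur_bound_def by blast

text \<open>
  A Schur multiplier keeps its norm when the entries of the matrix are operators between Hilbert
  spaces: for test vectors with components \<open>\<xi>\<^sub>t\<close> and \<open>\<eta>\<^sub>s\<close>, the numbers \<open>b s t = \<langle>a\<^sub>s\<^sub>t \<xi>\<^sub>t, \<eta>\<^sub>s\<rangle>\<close>
  satisfy the hypothesis with the weights \<open>X s = \<parallel>\<eta>\<^sub>s\<parallel>\<close> and \<open>Y t = \<parallel>\<xi>\<^sub>t\<parallel>\<close>. Normalising the components
  reduces the claim to the scalar matrix \<open>b s t / (X s * Y t)\<close>.
\<close>

lemma finite_schur_bound_weighted:
  assumes k: "finite_schur_bound k C" and A: "finite A" and M: "0 \<le> M"
    and X: "\<And>s. s \<in> A \<Longrightarrow> 0 \<le> X s" and Y: "\<And>s. s \<in> A \<Longrightarrow> 0 \<le> Y s"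
    and b: "\<And>\<alpha> \<beta> :: 'a \<Rightarrow> complex. cmod (\<Sum>s\<in>A. \<Sum>t\<in>A. b s t * \<alpha> s * \<beta> t)
        \<le> M * sqrt (\<Sum>s\<in>A. (cmod (\<alpha> s))\<^sup>2 * (X s)\<^sup>2) * sqrt (\<Sum>t\<in>A. (cmod (\<beta> t))\<^sup>2 * (Y t)\<^sup>2)"
  shows "cmod (\<Sum>s\<in>A. \<Sum>t\<in>A. k s t * b s t)
        \<le> C * M * sqrt (\<Sum>s\<in>A. (X s)\<^sup>2) * sqrt (\<Sum>t\<in>A. (Y t)\<^sup>2)"
proof -
  \<comment> \<open>An entry vanishes where one of its weights does, so the division by 0 in \<open>a\<close> is harmless.\<close>
  have b_entry: "cmod (b s t) \<le> M * X s * Y t" if "s \<in> A" "t \<in> A" for s t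
  proof -
    have 1: "(\<Sum>s'\<in>A. \<Sum>t'\<in>A. b s' t' * (if s' = s then 1 else 0) * (if t' = t then 1 else 0)) = b s t"
      using that A by (simp add: if_distrib[of "\<lambda>c. _ * c"] cong: if_cong)
    have 2: "(\<Sum>s'\<in>A. (cmod (if s' = s then 1 else 0))\<^sup>2 * (Z s')\<^sup>2) = (Z s)\<^sup>2" if "s \<in> A"
      for s and Z :: "'a \<Rightarrow> real"
    proof -
      have "(\<Sum>s'\<in>A. (cmod (if s' = s then 1 else 0))\<^sup>2 * (Z s')\<^sup>2) = (\<Sum>s'\<in>A. if s' = s then (Z s)\<^sup>2 else 0)"
        by (intro sum.cong) auto
      then show ?thesis using that A by simp
    qed
    show ?thesis
      using b[of "\<lambda>s'. if s' = s then 1 else 0" "\<lambda>t'. if t' = t then 1 else 0"]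
      unfolding 1 2[OF that(1)] 2[OF that(2)] using X[OF that(1)] Y[OF that(2)] by simp
  qed
  define a where "a s t = b s t / complex_of_real (X s * Y t)" for s t
  have ab: "a s t * complex_of_real (X s) * complex_of_real (Y t) = b s t" if "s \<in> A" "t \<in> A" for s t
    using b_entry[OF that] by (cases "X s = 0 \<or> Y t = 0") (auto simp: a_def)
  have "mat_bound A A a M"
    unfolding mat_bound_def
  proof (intro conjI allI M)
    fix x y :: "'a \<Rightarrow> complex"
    let ?\<alpha> = "\<lambda>s. x s / complex_of_real (X s)" and ?\<beta> = "\<lambda>t. y t / complex_of_real (Y t)"
    have w: "(\<Sum>s\<in>A. (cmod (x s / complex_of_real (X s)))\<^sup>2 * (X s)\<^sup>2) \<le> (\<Sum>s\<in>A. (cmod (x s))\<^sup>2)" for x X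
      by (intro sum_mono) (simp add: norm_divide power_divide)
    have "(\<Sum>i\<in>A. \<Sum>j\<in>A. a i j * x i * y j) = (\<Sum>i\<in>A. \<Sum>j\<in>A. b i j * ?\<alpha> i * ?\<beta> j)"
      by (intro sum.cong refl) (simp add: a_def)
    also have "cmod \<dots> \<le> M * sqrt (\<Sum>s\<in>A. (cmod (?\<alpha> s))\<^sup>2 * (X s)\<^sup>2) * sqrt (\<Sum>t\<in>A. (cmod (?\<beta> t))\<^sup>2 * (Y t)\<^sup>2)"
      by (rule b)
    also have "\<dots> \<le> M * vec_norm A x * vec_norm A y"
      by (intro mult_mono real_sqrt_le_mono w mult_nonneg_nonneg M real_sqrt_ge_zero sum_nonneg) auto
    finally show "cmod (\<Sum>i\<in>A. \<Sum>j\<in>A. a i j * x i * y j)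
        \<le> M * vec_norm A x * vec_norm A y" .
  qed
  then have "mat_bound A A (\<lambda>s t. k s t * a s t) (C * M)"
    using k A unfolding finite_schur_bound_def by blast
  from mat_boundD[OF this, of "\<lambda>s. complex_of_real (X s)" "\<lambda>t. complex_of_real (Y t)"]
  have "cmod (\<Sum>s\<in>A. \<Sum>t\<in>A. k s t * a s t * complex_of_real (X s) * complex_of_real (Y t))
        \<le> C * M * sqrt (\<Sum>s\<in>A. (X s)\<^sup>2) * sqrt (\<Sum>t\<in>A. (Y t)\<^sup>2)"
    by simp
  moreover have "(\<Sum>s\<in>A. \<Sum>t\<in>A. k s t * a s t * complex_of_real (X s) * complex_of_real (Y t))
      = (\<Sum>s\<in>A. \<Sum>t\<in>A. k s t * b s t)"
    by (intro sum.cong refl) (simp add: ab[symmetric] mult.assoc)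
  ultimately show ?thesis by simp
qed

text \<open>
  Points may be repeated: collecting the indices that belong to the same point turns the matrix into
  a block matrix with one block for every pair of points, to which the weighted form applies.
\<close>

lemma finite_schur_bound_indexed:
  fixes a :: "'i \<Rightarrow> 'j \<Rightarrow> complex" and k :: "'a \<Rightarrow> 'a \<Rightarrow> complex"
  assumes k: "finite_schur_bound k C" and I: "finite I" and J: "finite J" and a: "mat_bound I J a M"
  shows "mat_bound I J (\<lambda>i j. k (p i) (q j) * a i j) (C * M)"
  unfolding mat_bound_def
proof (intro conjI allI)
  show "0 \<le> C * M"
    using finite_schur_bound_nonneg[OF k] mat_bound_nonneg[OF a] by simp
  fix x :: "'i \<Rightarrow> complex" and y :: "'j \<Rightarrow> complex"
  define A where "A = p ` I \<union> q ` J"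
  define P where "P s = {i\<in>I. p i = s}" for s
  define Q where "Q t = {j\<in>J. q j = t}" for t
  define X where "X s = sqrt (\<Sum>i\<in>P s. (cmod (x i))\<^sup>2)" for s
  define Y where "Y t = sqrt (\<Sum>j\<in>Q t. (cmod (y j))\<^sup>2)" for t
  \<comment> \<open>The blocks, paired with the components of the test vectors.\<close>
  define b where "b s t = (\<Sum>i\<in>P s. \<Sum>j\<in>Q t. a i j * x i * y j)" for s t
  have A: "finite A" using I J by (simp add: A_def)
  have grI: "(\<Sum>s\<in>A. \<Sum>i\<in>P s. g i) = (\<Sum>i\<in>I. g i)" for g :: "'i \<Rightarrow> 'c::comm_monoid_add"
    unfolding P_def by (rule sum.group) (use I A in \<open>auto simp: A_def\<close>)
  have grJ: "(\<Sum>s\<in>A. \<Sum>i\<in>Q s. g i) = (\<Sum>i\<in>J. g i)" for g :: "'j \<Rightarrow> 'c::comm_monoid_add"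
    unfolding Q_def by (rule sum.group) (use J A in \<open>auto simp: A_def\<close>)
  have grp: "(\<Sum>s\<in>A. \<Sum>t\<in>A. c s t * b s t) = (\<Sum>i\<in>I. \<Sum>j\<in>J. c (p i) (q j) * (a i j * x i * y j))"
    for c :: "'a \<Rightarrow> 'a \<Rightarrow> complex"
  proof -
    have "(\<Sum>s\<in>A. \<Sum>t\<in>A. c s t * b s t)
        = (\<Sum>s\<in>A. \<Sum>t\<in>A. \<Sum>i\<in>P s. \<Sum>j\<in>Q t. c (p i) (q j) * (a i j * x i * y j))"
      by (intro sum.cong refl) (auto simp: b_def sum_distrib_left P_def Q_def intro!: sum.cong)
    also have "\<dots> = (\<Sum>s\<in>A. \<Sum>i\<in>P s. \<Sum>t\<in>A. \<Sum>j\<in>Q t. c (p i) (q j) * (a i j * x i * y j))"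
      by (intro sum.cong refl sum.swap)
    also have "\<dots> = (\<Sum>i\<in>I. \<Sum>j\<in>J. c (p i) (q j) * (a i j * x i * y j))"
      by (simp only: grI grJ)
    finally show ?thesis .
  qed
  have X2: "(X s)\<^sup>2 = (\<Sum>i\<in>P s. (cmod (x i))\<^sup>2)" for s by (simp add: X_def sum_nonneg)
  have Y2: "(Y s)\<^sup>2 = (\<Sum>i\<in>Q s. (cmod (y i))\<^sup>2)" for s by (simp add: Y_def sum_nonneg)
  have wX: "(\<Sum>s\<in>A. (cmod (\<alpha> s))\<^sup>2 * (X s)\<^sup>2) = (\<Sum>i\<in>I. (cmod (\<alpha> (p i) * x i))\<^sup>2)" for \<alpha> :: "'a \<Rightarrow> complex"
  proof -
    have "(\<Sum>s\<in>A. (cmod (\<alpha> s))\<^sup>2 * (X s)\<^sup>2) = (\<Sum>s\<in>A. \<Sum>i\<in>P s. (cmod (\<alpha> (p i) * x i))\<^sup>2)"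
      by (intro sum.cong refl) (auto simp: X2 sum_distrib_left P_def norm_mult power_mult_distrib intro!: sum.cong)
    then show ?thesis by (simp only: grI)
  qed
  have wY: "(\<Sum>s\<in>A. (cmod (\<beta> s))\<^sup>2 * (Y s)\<^sup>2) = (\<Sum>i\<in>J. (cmod (\<beta> (q i) * y i))\<^sup>2)" for \<beta> :: "'a \<Rightarrow> complex"
  proof -
    have "(\<Sum>s\<in>A. (cmod (\<beta> s))\<^sup>2 * (Y s)\<^sup>2) = (\<Sum>s\<in>A. \<Sum>i\<in>Q s. (cmod (\<beta> (q i) * y i))\<^sup>2)"
      by (intro sum.cong refl) (auto simp: Y2 sum_distrib_left Q_def norm_mult power_mult_distrib intro!: sum.cong)
    then show ?thesis by (simp only: grJ)
  qed
  have "cmod (\<Sum>s\<in>A. \<Sum>t\<in>A. k s t * b s t)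
        \<le> C * M * sqrt (\<Sum>s\<in>A. (X s)\<^sup>2) * sqrt (\<Sum>t\<in>A. (Y t)\<^sup>2)"
  proof (rule finite_schur_bound_weighted[OF k A mat_bound_nonneg[OF a]])
    fix \<alpha> \<beta> :: "'a \<Rightarrow> complex"
    have "(\<Sum>s\<in>A. \<Sum>t\<in>A. b s t * \<alpha> s * \<beta> t) = (\<Sum>s\<in>A. \<Sum>t\<in>A. (\<alpha> s * \<beta> t) * b s t)"
      by (simp add: mult_ac)
    also have "\<dots> = (\<Sum>i\<in>I. \<Sum>j\<in>J. a i j * (\<alpha> (p i) * x i) * (\<beta> (q j) * y j))"
      by (subst grp) (simp add: mult_ac)
    also have "cmod \<dots> \<le> M * sqrt (\<Sum>i\<in>I. (cmod (\<alpha> (p i) * x i))\<^sup>2) * sqrt (\<Sum>i\<in>J. (cmod (\<beta> (q i) * y i))\<^sup>2)"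
      by (rule mat_boundD[OF a])
    finally show "cmod (\<Sum>s\<in>A. \<Sum>t\<in>A. b s t * \<alpha> s * \<beta> t)
        \<le> M * sqrt (\<Sum>s\<in>A. (cmod (\<alpha> s))\<^sup>2 * (X s)\<^sup>2) * sqrt (\<Sum>t\<in>A. (cmod (\<beta> t))\<^sup>2 * (Y t)\<^sup>2)"
      by (simp only: wX wY)
  qed (simp_all add: X_def Y_def sum_nonneg)
  moreover have "(\<Sum>s\<in>A. (X s)\<^sup>2) = (\<Sum>i\<in>I. (cmod (x i))\<^sup>2)" "(\<Sum>s\<in>A. (Y s)\<^sup>2) = (\<Sum>j\<in>J. (cmod (y j))\<^sup>2)"
    by (simp_all only: X2 Y2 grI grJ)
  ultimately show "cmod (\<Sum>i\<in>I. \<Sum>j\<in>J. k (p i) (q j) * a i j * x i * y j)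
        \<le> C * M * vec_norm I x * vec_norm J y"
    by (simp add: grp mult.assoc)
qed

lemma finite_schur_bound_comp:
  assumes "finite_schur_bound k C"
  shows "finite_schur_bound (\<lambda>s t. k (p s) (p t)) C"
  using finite_schur_bound_indexed[OF assms] finite_schur_bound_nonneg[OF assms]
  unfolding finite_schur_bound_def by blast

lemma finite_schur_bound_mult:
  assumes "finite_schur_bound k C" "finite_schur_bound l D"
  shows "finite_schur_bound (\<lambda>s t. k s t * l s t) (C * D)"
  using assms unfolding finite_schur_bound_def by (auto simp: mult.assoc)

lemma mat_bound_add:
  assumes "mat_bound I J a M" "mat_bound I J b N"
  shows "mat_bound I J (\<lambda>i j. a i j + b i j) (M + N)"
  unfolding mat_bound_def
proof (intro conjI allI)
  show "0 \<le> M + N" using assms by (auto simp: mat_bound_def)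
  fix x :: "'a \<Rightarrow> complex" and y :: "'b \<Rightarrow> complex"
  show "cmod (\<Sum>i\<in>I. \<Sum>j\<in>J. (a i j + b i j) * x i * y j)
    \<le> (M + N) * vec_norm I x * vec_norm J y"
    using norm_triangle_mono[OF mat_boundD[OF assms(1), of x y] mat_boundD[OF assms(2), of x y]]
    by (simp add: ring_distribs sum.distrib)
qed

lemma mat_bound_cmult:
  assumes "mat_bound I J a M"
  shows "mat_bound I J (\<lambda>i j. c * a i j) (cmod c * M)"
  unfolding mat_bound_def
proof (intro conjI allI)
  show "0 \<le> cmod c * M" using assms by (auto simp: mat_bound_def)
  fix x :: "'a \<Rightarrow> complex" and y :: "'b \<Rightarrow> complex"
  have "(\<Sum>i\<in>I. \<Sum>j\<in>J. c * a i j * x i * y j) = c * (\<Sum>i\<in>I. \<Sum>j\<in>J. a i j * x i * y j)"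
    by (simp add: sum_distrib_left mult.assoc)
  then show "cmod (\<Sum>i\<in>I. \<Sum>j\<in>J. c * a i j * x i * y j)
    \<le> cmod c * M * vec_norm I x * vec_norm J y"
    using mult_left_mono[OF mat_boundD[OF assms, of x y], of "cmod c"]
    by (simp add: norm_mult mult.assoc)
qed

lemma finite_schur_bound_add:
  assumes "finite_schur_bound k C" "finite_schur_bound l D"
  shows "finite_schur_bound (\<lambda>s t. k s t + l s t) (C + D)"
  using assms unfolding finite_schur_bound_def
  by (auto simp: ring_distribs intro!: mat_bound_add)

lemma finite_schur_bound_cmult:
  assumes "finite_schur_bound k C"
  shows "finite_schur_bound (\<lambda>s t. c * k s t) (cmod c * C)"
  using assms unfolding finite_schur_bound_def
  by (auto simp: mult.assoc intro!: mat_bound_cmult)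

lemma mat_bound_mono:
  assumes "mat_bound I J a M" "M \<le> N"
  shows "mat_bound I J a N"
  unfolding mat_bound_def
proof (intro conjI allI)
  show "0 \<le> N" using assms by (auto simp: mat_bound_def)
  fix x :: "'a \<Rightarrow> complex" and y :: "'b \<Rightarrow> complex"
  show "cmod (\<Sum>i\<in>I. \<Sum>j\<in>J. a i j * x i * y j)
    \<le> N * vec_norm I x * vec_norm J y"
    by (rule order_trans[OF mat_boundD[OF assms(1)]])
      (intro mult_right_mono assms(2) real_sqrt_ge_zero sum_nonneg zero_le_power2)
qed

lemma finite_schur_bound_mono:
  assumes "finite_schur_bound k C" "C \<le> D"
  shows "finite_schur_bound k D"
  using assms unfolding finite_schur_bound_def
  by (meson mat_bound_mono mat_bound_nonneg mult_right_mono order_trans)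

lemma finite_schur_bound_zero: "finite_schur_bound (\<lambda>s t. 0) 0"
  by (auto simp: finite_schur_bound_def mat_bound_def)

lemma finite_schur_bound_entry:
  assumes "finite_schur_bound k C"
  shows "cmod (k s t) \<le> C"
proof -
  have "mat_bound {()} {()} (\<lambda>_ _. 1) 1"
    by (simp add: mat_bound_def norm_mult)
  from mat_boundD[OF finite_schur_bound_indexed[OF assms _ _ this, of "\<lambda>_. s" "\<lambda>_. t"], of "\<lambda>_. 1" "\<lambda>_. 1"]
  show ?thesis by simp
qed

lemma mat_bound_apply:
  assumes b: "mat_bound K L b N"
  shows "sqrt (\<Sum>k\<in>K. (cmod (\<Sum>l\<in>L. b k l * y l))\<^sup>2) \<le> N * vec_norm L y"
proof -
  define z where "z k = (\<Sum>l\<in>L. b k l * y l)" for k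
  define Z where "Z = (\<Sum>k\<in>K. (cmod (z k))\<^sup>2)"
  have Z0: "0 \<le> Z" by (simp add: Z_def sum_nonneg)
  have "complex_of_real Z = (\<Sum>k\<in>K. z k * cnj (z k))"
    by (simp add: Z_def complex_norm_square del: of_real_power)
  also have "\<dots> = (\<Sum>k\<in>K. \<Sum>l\<in>L. b k l * cnj (z k) * y l)"
    unfolding z_def sum_distrib_right by (simp add: mult_ac)
  finally have eq: "complex_of_real Z = \<dots>" .
  have "Z = cmod (complex_of_real Z)" using Z0 by simp
  also have "\<dots> \<le> N * sqrt (\<Sum>k\<in>K. (cmod (cnj (z k)))\<^sup>2) * vec_norm L y"
    unfolding eq by (rule mat_boundD[OF b])
  finally have "sqrt Z * sqrt Z \<le> sqrt Z * (N * vec_norm L y)"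
    using Z0 by (simp add: Z_def[symmetric] mult_ac)
  then have "sqrt Z \<le> N * vec_norm L y"
    using Z0 mat_bound_nonneg[OF b]
    by (cases "Z = 0") (simp_all add: sum_nonneg mult_le_cancel_left_pos del: real_sqrt_mult_self)
  then show ?thesis by (simp add: Z_def z_def)
qed

text \<open>
  \<open>a \<otimes> b = (a \<otimes> 1)(1 \<otimes> b)\<close>: the vector \<open>z\<close> is the image of \<open>y\<close> under \<open>1 \<otimes> b\<close>, and \<open>a\<close> acts for each
  value of the second index separately.
\<close>

lemma mat_bound_kronecker:
  fixes a :: "'i \<Rightarrow> 'j \<Rightarrow> complex" and b :: "'k \<Rightarrow> 'l \<Rightarrow> complex"
  assumes a: "mat_bound I J a M" and b: "mat_bound K L b N"
  shows "mat_bound (I \<times> K) (J \<times> L) (\<lambda>p q. a (fst p) (fst q) * b (snd p) (snd q)) (M * N)"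
  unfolding mat_bound_def
proof (intro conjI allI)
  have M: "0 \<le> M" and N: "0 \<le> N" using a b by (auto simp: mat_bound_def)
  then show "0 \<le> M * N" by simp
  fix x :: "'i \<times> 'k \<Rightarrow> complex" and y :: "'j \<times> 'l \<Rightarrow> complex"
  have Sigma_sum: "(\<Sum>p\<in>A \<times> B. g p) = (\<Sum>i\<in>A. \<Sum>j\<in>B. g (i, j))"
    for A :: "'s set" and B :: "'t set" and g :: "'s \<times> 't \<Rightarrow> complex"
    by (simp add: sum.cartesian_product)
  define z where "z j k = (\<Sum>l\<in>L. b k l * y (j, l))" for j k
  define X where "X k = sqrt (\<Sum>i\<in>I. (cmod (x (i, k)))\<^sup>2)" for k
  define Z where "Z k = sqrt (\<Sum>j\<in>J. (cmod (z j k))\<^sup>2)" for k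
  have "(\<Sum>p\<in>I \<times> K. \<Sum>q\<in>J \<times> L. a (fst p) (fst q) * b (snd p) (snd q) * x p * y q)
      = (\<Sum>i\<in>I. \<Sum>k\<in>K. \<Sum>j\<in>J. \<Sum>l\<in>L. a i j * b k l * x (i, k) * y (j, l))"
    by (simp add: Sigma_sum)
  also have "\<dots> = (\<Sum>k\<in>K. \<Sum>i\<in>I. \<Sum>j\<in>J. a i j * x (i, k) * z j k)"
    by (subst sum.swap) (simp add: z_def sum_distrib_left mult_ac)
  also have "cmod \<dots> \<le> (\<Sum>k\<in>K. M * X k * Z k)"
    unfolding X_def Z_def by (intro sum_norm_le mat_boundD[OF a])
  also have "\<dots> = M * (\<Sum>k\<in>K. \<bar>X k\<bar> * \<bar>Z k\<bar>)"
    by (simp add: sum_distrib_left X_def Z_def sum_nonneg mult_ac)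
  also have "\<dots> \<le> M * (L2_set X K * L2_set Z K)"
    by (intro mult_left_mono L2_set_mult_ineq M)
  also have "L2_set X K = sqrt (\<Sum>p\<in>I \<times> K. (cmod (x p))\<^sup>2)"
  proof -
    have "(\<Sum>p\<in>I \<times> K. (cmod (x p))\<^sup>2) = (\<Sum>i\<in>I. \<Sum>k\<in>K. (cmod (x (i, k)))\<^sup>2)"
      by (simp add: sum.cartesian_product)
    also have "\<dots> = (\<Sum>k\<in>K. (X k)\<^sup>2)"
      by (subst sum.swap) (simp add: X_def sum_nonneg)
    finally show ?thesis by (simp add: L2_set_def)
  qed
  also have "M * (sqrt (\<Sum>p\<in>I \<times> K. (cmod (x p))\<^sup>2) * L2_set Z K)
      \<le> M * (sqrt (\<Sum>p\<in>I \<times> K. (cmod (x p))\<^sup>2) * (N * sqrt (\<Sum>q\<in>J \<times> L. (cmod (y q))\<^sup>2)))"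
  proof (intro mult_left_mono M real_sqrt_ge_zero sum_nonneg)
    have "(\<Sum>k\<in>K. (cmod (z j k))\<^sup>2) \<le> N\<^sup>2 * (\<Sum>l\<in>L. (cmod (y (j, l)))\<^sup>2)" for j
    proof -
      have "(sqrt (\<Sum>k\<in>K. (cmod (z j k))\<^sup>2))\<^sup>2 \<le> (N * sqrt (\<Sum>l\<in>L. (cmod (y (j, l)))\<^sup>2))\<^sup>2"
        unfolding z_def by (intro power_mono mat_bound_apply[OF b]) (simp add: sum_nonneg)
      then show ?thesis by (simp add: sum_nonneg power_mult_distrib)
    qed
    then have "(\<Sum>j\<in>J. \<Sum>k\<in>K. (cmod (z j k))\<^sup>2) \<le> (\<Sum>j\<in>J. N\<^sup>2 * (\<Sum>l\<in>L. (cmod (y (j, l)))\<^sup>2))"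
      by (intro sum_mono)
    also have "\<dots> = N\<^sup>2 * (\<Sum>q\<in>J \<times> L. (cmod (y q))\<^sup>2)"
      by (simp add: sum_distrib_left[symmetric] sum.cartesian_product split_beta)
    finally have "sqrt (\<Sum>j\<in>J. \<Sum>k\<in>K. (cmod (z j k))\<^sup>2) \<le> sqrt (N\<^sup>2 * (\<Sum>q\<in>J \<times> L. (cmod (y q))\<^sup>2))"
      by (rule real_sqrt_le_mono)
    moreover have "L2_set Z K = sqrt (\<Sum>j\<in>J. \<Sum>k\<in>K. (cmod (z j k))\<^sup>2)"
      unfolding L2_set_def Z_def by (simp add: sum_nonneg sum.swap[of _ K J])
    ultimately show "L2_set Z K \<le> N * sqrt (\<Sum>q\<in>J \<times> L. (cmod (y q))\<^sup>2)"
      using N by (simp add: real_sqrt_mult)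
  qed simp
  finally show "cmod (\<Sum>p\<in>I \<times> K. \<Sum>q\<in>J \<times> L. a (fst p) (fst q) * b (snd p) (snd q) * x p * y q)
      \<le> M * N * sqrt (\<Sum>p\<in>I \<times> K. (cmod (x p))\<^sup>2) * sqrt (\<Sum>q\<in>J \<times> L. (cmod (y q))\<^sup>2)"
    by (simp add: mult_ac)
qed

section \<open>A Hahn-Banach theorem for sublinear functionals\<close>

text \<open>
  The inequality in the second condition passes to infima without any case distinction on \<open>c\<close>, and it
  implies equality (\<open>sublinear_scale\<close>).
\<close>

definition sublinear :: "('v::real_vector \<Rightarrow> real) \<Rightarrow> bool" where
  "sublinear q \<longleftrightarrow> (\<forall>x y. q (x + y) \<le> q x + q y) \<and> (\<forall>c x. 0 \<le> c \<longrightarrow> q (c *\<^sub>R x) \<le> c * q x)"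

lemma sublinear_add: "sublinear q \<Longrightarrow> q (x + y) \<le> q x + q y"
  and sublinear_scale_le: "sublinear q \<Longrightarrow> 0 \<le> c \<Longrightarrow> q (c *\<^sub>R x) \<le> c * q x"
  by (auto simp: sublinear_def)

lemma sublinear_zero: "sublinear q \<Longrightarrow> q 0 = 0"
  using sublinear_add[of q 0 0] sublinear_scale_le[of q 0 0] by simp

lemma sublinear_scale:
  assumes "sublinear q" "0 \<le> c"
  shows "q (c *\<^sub>R x) = c * q x"
proof (cases "c = 0")
  case False
  then have "0 < c" using assms by simp
  moreover have "q x \<le> (1 / c) * q (c *\<^sub>R x)"
    using sublinear_scale_le[OF assms(1), of "1 / c" "c *\<^sub>R x"] \<open>0 < c\<close> by simp
  ultimately show ?thesis
    using sublinear_scale_le[OF assms, of x] by (simp add: field_simps)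
qed (use assms in \<open>simp add: sublinear_zero\<close>)

lemma sublinear_minus: "sublinear q \<Longrightarrow> - q (- x) \<le> q x"
  using sublinear_add[of q x "- x"] by (simp add: sublinear_zero)

text \<open>
  The sublinear functional \<open>x \<mapsto> inf {q (x + t y) - t q y | t \<ge> 0}\<close> lowers \<open>q\<close> in the direction \<open>- y\<close> as far
  as sublinearity permits. It has two uses: a minimal sublinear functional cannot be lowered, so it is
  odd and hence linear; and lowering the given functional once beforehand prescribes the value of its
  linear minorants at \<open>y\<close>.
\<close>

lemma sublinear_tilt:
  assumes q: "sublinear q"
  obtains r where "sublinear r" "r \<le> q" "r (- y) \<le> - q y"
proof
  define r where "r x = (INF t\<in>{0..}. q (x + t *\<^sub>R y) - t * q y)" for x
  have bdd: "bdd_below ((\<lambda>t. q (x + t *\<^sub>R y) - t * q y) ` {0..})" for x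
  proof (rule bdd_belowI2[where m = "- q (- x)"])
    fix t :: real assume "t \<in> {0..}"
    then show "- q (- x) \<le> q (x + t *\<^sub>R y) - t * q y"
      using sublinear_add[OF q, of "x + t *\<^sub>R y" "- x"] sublinear_scale[OF q, of t y] by simp
  qed
  have r_le: "r x \<le> q (x + t *\<^sub>R y) - t * q y" if "0 \<le> t" for x t
    unfolding r_def by (rule cINF_lower[OF bdd]) (use that in auto)
  show "r \<le> q"
    using r_le[of 0] by (auto simp: le_fun_def)
  show "r (- y) \<le> - q y"
    using r_le[of 1 "- y"] by (simp add: sublinear_zero[OF q])
  have r_ge: "m \<le> r x" if "\<And>t. 0 \<le> t \<Longrightarrow> m \<le> q (x + t *\<^sub>R y) - t * q y" for m x
    unfolding r_def by (rule cINF_greatest) (use that in auto)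
  have add: "r (x + x') \<le> r x + r x'" for x x'
  proof -
    have "r (x + x') - r x' \<le> q (x + t *\<^sub>R y) - t * q y" if t: "0 \<le> t" for t
    proof -
      have "r (x + x') - (q (x + t *\<^sub>R y) - t * q y) \<le> q (x' + t' *\<^sub>R y) - t' * q y" if "0 \<le> t'" for t'
      proof -
        have "r (x + x') \<le> q ((x + t *\<^sub>R y) + (x' + t' *\<^sub>R y)) - (t + t') * q y"
          using r_le[of "t + t'" "x + x'"] t that by (simp add: algebra_simps)
        then show ?thesis
          using sublinear_add[OF q, of "x + t *\<^sub>R y" "x' + t' *\<^sub>R y"] by (simp add: algebra_simps)
      qed
      from r_ge[OF this] show ?thesis by simp
    qed
    from r_ge[OF this] show ?thesis by simp
  qed
  have scale: "r (c *\<^sub>R x) \<le> c * r x" if c: "0 \<le> c" for c x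
  proof (cases "c = 0")
    case True
    then show ?thesis using r_le[of 0 0] by (simp add: sublinear_zero[OF q])
  next
    case False
    then have c: "0 < c" using c by simp
    have "r (c *\<^sub>R x) / c \<le> q (x + t *\<^sub>R y) - t * q y" if "0 \<le> t" for t
    proof -
      have "r (c *\<^sub>R x) \<le> q (c *\<^sub>R (x + t *\<^sub>R y)) - c * t * q y"
        using r_le[of "c * t" "c *\<^sub>R x"] c that by (simp add: scaleR_add_right)
      then show ?thesis
        using c sublinear_scale[OF q, of c "x + t *\<^sub>R y"] by (simp add: field_simps)
    qed
    from r_ge[OF this] show ?thesis using c by (simp add: field_simps)
  qed
  show "sublinear r"
    using add scale by (auto simp: sublinear_def)
qed

text \<open>
  Minimal sublinear functionals are linear, and Zorn's lemma applied to pointwise infima of chains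
  provides one below the functional tilted at \<open>y\<close>.
\<close>

theorem hahn_banach_sublinear:
  fixes p :: "'v::real_vector \<Rightarrow> real"
  assumes p: "sublinear p"
  obtains f where "linear f" "f \<le> p" "p y \<le> f y"
proof -
  obtain p' where p': "sublinear p'" "p' \<le> p" "p' (- y) \<le> - p y"
    using sublinear_tilt[OF p] by blast
  define S where "S = {q. sublinear q \<and> q \<le> p'}"
  have "\<exists>m\<in>S. \<forall>q\<in>S. q \<le> m \<longrightarrow> q = m"
  proof (rule predicate_Zorn)
    show "partial_order_on S (relation_of (\<lambda>q r. r \<le> q) S)"
      by (rule partial_order_on_relation_ofI) auto
    fix C assume "C \<in> Chains (relation_of (\<lambda>q r. r \<le> q) S)"
    then have CS: "\<And>q. q \<in> C \<Longrightarrow> q \<in> S" and total: "\<And>q r. q \<in> C \<Longrightarrow> r \<in> C \<Longrightarrow> q \<le> r \<or> r \<le> q"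
      by (auto simp: Chains_def relation_of_def)
    show "\<exists>u\<in>S. \<forall>q\<in>C. u \<le> q"
    proof (cases "C = {}")
      case True
      then show ?thesis using p' by (auto simp: S_def)
    next
      case False
      define u where "u x = (INF q\<in>C. q x)" for x
      have bdd: "bdd_below ((\<lambda>q. q x) ` C)" for x
      proof (rule bdd_belowI2[where m = "- p' (- x)"])
        fix q assume "q \<in> C"
        then have "sublinear q" "q (- x) \<le> p' (- x)" using CS by (auto simp: S_def le_fun_def)
        then show "- p' (- x) \<le> q x" using sublinear_minus[of q x] by simp
      qed
      have u_le: "u x \<le> q x" if "q \<in> C" for q x
        unfolding u_def by (rule cINF_lower[OF bdd that])
      have u_ge: "m \<le> u x" if "\<And>q. q \<in> C \<Longrightarrow> m \<le> q x" for m x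
        unfolding u_def by (rule cINF_greatest[OF False that])
      have "u (x + x') \<le> u x + u x'" for x x'
      proof -
        have "u (x + x') - u x' \<le> q x" if q: "q \<in> C" for q
        proof -
          have "u (x + x') - q x \<le> r x'" if r: "r \<in> C" for r
          proof -
            obtain s where "s \<in> C" "s \<le> q" "s \<le> r" using total[OF q r] q r by blast
            then show ?thesis
              using u_le[of s "x + x'"] CS[of s] sublinear_add[of s x x']
              by (auto simp: S_def le_fun_def intro: order_trans) (smt (verit))
          qed
          then have "u (x + x') - q x \<le> u x'" by (rule u_ge)
          then show ?thesis by simp
        qed
        then have "u (x + x') - u x' \<le> u x" by (rule u_ge)
        then show ?thesis by simp
      qed
      moreover have "u (c *\<^sub>R x) \<le> c * u x" if c: "0 \<le> c" for c x
      proof (cases "c = 0")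
        case True
        obtain q where "q \<in> C" using False by blast
        then show ?thesis using True u_le[of q 0] CS[of q] by (auto simp: S_def sublinear_zero)
      next
        case False
        then have c: "0 < c" using c by simp
        have "u (c *\<^sub>R x) / c \<le> q x" if "q \<in> C" for q
          using u_le[OF that, of "c *\<^sub>R x"] CS[OF that] c sublinear_scale[of q c x]
          by (auto simp: S_def field_simps)
        then have "u (c *\<^sub>R x) / c \<le> u x" by (rule u_ge)
        then show ?thesis using c by (simp add: field_simps)
      qed
      moreover have "u \<le> p'"
        using False u_le CS by (fastforce simp: S_def le_fun_def intro: order_trans)
      ultimately have "u \<in> S" by (simp add: S_def sublinear_def)
      then show ?thesis using u_le by (auto simp: le_fun_def)
    qed
  qed
  then obtain f where f: "sublinear f" "f \<le> p'" and min: "\<And>q. sublinear q \<Longrightarrow> q \<le> f \<Longrightarrow> q = f"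
    unfolding S_def by (metis (mono_tags, lifting) mem_Collect_eq order_trans)
  have neg: "f (- x) = - f x" for x
  proof -
    obtain r where "sublinear r" "r \<le> f" "r (- x) \<le> - f x"
      using sublinear_tilt[OF f(1)] by blast
    then show ?thesis using min[of r] sublinear_minus[OF f(1), of x] by simp
  qed
  have "linear f"
  proof (rule linearI)
    fix x x' show "f (x + x') = f x + f x'"
      using sublinear_add[OF f(1), of x x'] sublinear_add[OF f(1), of "x + x'" "- x'"] by (simp add: neg)
  next
    fix c x show "f (c *\<^sub>R x) = c *\<^sub>R f x"
    proof (cases "0 \<le> c")
      case False
      then have "f (- ((- c) *\<^sub>R x)) = - (- c * f x)"
        unfolding neg by (subst sublinear_scale[OF f(1)]) auto
      then show ?thesis by simp
    qed (simp add: sublinear_scale[OF f(1)])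
  qed
  moreover have "f \<le> p" using f p' by simp
  moreover have "p y \<le> f y"
    using p'(3) f(2) neg[of y] by (auto simp: le_fun_def) (smt (verit))
  ultimately show ?thesis by (rule that)
qed

section \<open>Herz-Schur multipliers vanishing at infinity, and approximation of the constant 1\<close>

text \<open>
  \<open>u\<close> is a Herz-Schur multiplier of norm at most \<open>C\<close>, by the finite characterisation. For continuous
  functions this agrees with the condition on \<open>L\<^sup>2(G)\<close> (\<open>schur_bound_herz_schur\<close>).
\<close>

definition herz_schur_bound :: "('a::group_add \<Rightarrow> complex) \<Rightarrow> real \<Rightarrow> bool" where
  "herz_schur_bound u C \<longleftrightarrow> finite_schur_bound (\<lambda>s t. u (- t + s)) C"

lemma herz_schur_bound_le: "herz_schur_bound u C \<Longrightarrow> cmod (u x) \<le> C"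
  using finite_schur_bound_entry[of "\<lambda>s t. u (- t + s)" C x 0] by (simp add: herz_schur_bound_def)

lemma herz_schur_bound_add:
  "herz_schur_bound u C \<Longrightarrow> herz_schur_bound v D \<Longrightarrow> herz_schur_bound (\<lambda>x. u x + v x) (C + D)"
  unfolding herz_schur_bound_def by (rule finite_schur_bound_add)

lemma herz_schur_bound_cmult:
  "herz_schur_bound u C \<Longrightarrow> herz_schur_bound (\<lambda>x. c * u x) (cmod c * C)"
  unfolding herz_schur_bound_def by (rule finite_schur_bound_cmult)

lemma herz_schur_bound_mono: "herz_schur_bound u C \<Longrightarrow> C \<le> D \<Longrightarrow> herz_schur_bound u D"
  unfolding herz_schur_bound_def by (rule finite_schur_bound_mono)

lemma herz_schur_bound_zero: "herz_schur_bound (\<lambda>x. 0) 0"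
  unfolding herz_schur_bound_def by (rule finite_schur_bound_zero)

lemma herz_schur_bound_nonneg: "herz_schur_bound u C \<Longrightarrow> 0 \<le> C"
  unfolding herz_schur_bound_def by (rule finite_schur_bound_nonneg)

lemma C0_functionsE:
  assumes "u \<in> C0_functions" "0 < \<epsilon>"
  obtains K where "compact K" "\<forall>x. x \<notin> K \<longrightarrow> cmod (u x) < \<epsilon>"
  using assms unfolding C0_functions_def by blast

lemma C0_continuous: "u \<in> C0_functions \<Longrightarrow> continuous_on UNIV u"
  unfolding C0_functions_def by blast

lemma C0_add:
  fixes u v :: "'a::topological_space \<Rightarrow> complex"
  assumes "u \<in> C0_functions" "v \<in> C0_functions"
  shows "(\<lambda>x. u x + v x) \<in> C0_functions"
  unfolding C0_functions_def
proof (intro CollectI conjI allI impI)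
  show "continuous_on UNIV (\<lambda>x. u x + v x)"
    using assms by (intro continuous_on_add C0_continuous)
  fix \<epsilon> :: real assume "0 < \<epsilon>"
  then have "0 < \<epsilon> / 2" by simp
  obtain K where K: "compact K" "\<forall>x. x \<notin> K \<longrightarrow> cmod (u x) < \<epsilon> / 2"
    by (rule C0_functionsE[OF assms(1) \<open>0 < \<epsilon> / 2\<close>])
  obtain L where L: "compact L" "\<forall>x. x \<notin> L \<longrightarrow> cmod (v x) < \<epsilon> / 2"
    by (rule C0_functionsE[OF assms(2) \<open>0 < \<epsilon> / 2\<close>])
  have "cmod (u x + v x) < \<epsilon>" if "x \<notin> K \<union> L" for x
    using norm_add_less[of "u x" "\<epsilon> / 2" "v x" "\<epsilon> / 2"] K(2)[rule_format, of x] L(2)[rule_format, of x] that by simp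
  then show "\<exists>K. compact K \<and> (\<forall>x. x \<notin> K \<longrightarrow> cmod (u x + v x) < \<epsilon>)"
    using compact_Un[OF K(1) L(1)] by blast
qed

lemma C0_zero: "(\<lambda>x. 0) \<in> C0_functions"
  unfolding C0_functions_def by (auto intro: exI[of _ "{}"])

lemma C0_cmult:
  fixes u :: "'a::topological_space \<Rightarrow> complex"
  assumes "u \<in> C0_functions"
  shows "(\<lambda>x. c * u x) \<in> C0_functions"
  unfolding C0_functions_def
proof (intro CollectI conjI allI impI)
  show "continuous_on UNIV (\<lambda>x. c * u x)"
    using assms by (intro continuous_on_mult_left C0_continuous)
  fix \<epsilon> :: real assume "0 < \<epsilon>"
  then have e: "0 < \<epsilon> / (cmod c + 1)" by (simp add: add_nonneg_pos)
  obtain K where K: "compact K" "\<forall>x. x \<notin> K \<longrightarrow> cmod (u x) < \<epsilon> / (cmod c + 1)"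
    by (rule C0_functionsE[OF assms(1) e])
  have "cmod (c * u x) < \<epsilon>" if "x \<notin> K" for x
  proof -
    have "cmod (c * u x) \<le> (cmod c + 1) * cmod (u x)"
      by (simp add: norm_mult distrib_right)
    also have "\<dots> < \<epsilon>"
      using K(2)[rule_format, OF that] norm_ge_zero[of c] by (simp add: pos_less_divide_eq mult.commute add_nonneg_pos)
    finally show ?thesis .
  qed
  then show "\<exists>K. compact K \<and> (\<forall>x. x \<notin> K \<longrightarrow> cmod (c * u x) < \<epsilon>)"
    using K(1) by blast
qed

lemma C0_sum:
  "(\<And>i. i \<in> I \<Longrightarrow> u i \<in> C0_functions) \<Longrightarrow> (\<lambda>x. \<Sum>i\<in>I. u i x) \<in> C0_functions"
  by (induction I rule: infinite_finite_induct) (simp_all add: C0_zero C0_add)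

text \<open>
  An embedding with a continuous left inverse is closed, so the preimage of a compact set lies in the
  compact set \<open>r ` K\<close>. It is applied to the inclusions of the factors, and of slices, in a product.
\<close>

lemma C0_comp_embedding:
  fixes w :: "'b::t2_space \<Rightarrow> complex" and p :: "'a::topological_space \<Rightarrow> 'b" and r :: "'b \<Rightarrow> 'a"
  assumes w: "w \<in> C0_functions" and p: "continuous_on UNIV p" and r: "continuous_on UNIV r"
    and rp: "\<And>x. r (p x) = x"
  shows "(\<lambda>x. w (p x)) \<in> C0_functions"
  unfolding C0_functions_def
proof (intro CollectI conjI allI impI)
  show "continuous_on UNIV (\<lambda>x. w (p x))"
    by (rule continuous_on_compose2[OF C0_continuous[OF w] p]) simp
  fix \<epsilon> :: real assume "0 < \<epsilon>"
  then obtain K where K: "compact K" "\<forall>x. x \<notin> K \<longrightarrow> cmod (w x) < \<epsilon>"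
    by (rule C0_functionsE[OF w])
  have "compact (r ` K)"
    using K(1) r by (meson compact_continuous_image continuous_on_subset subset_UNIV)
  moreover have "cmod (w (p x)) < \<epsilon>" if "x \<notin> r ` K" for x
    using K(2)[rule_format, of "p x"] that rp[of x] by (metis imageI)
  ultimately show "\<exists>K. compact K \<and> (\<forall>x. x \<notin> K \<longrightarrow> cmod (w (p x)) < \<epsilon>)" by blast
qed

text \<open>
  The admissibility of the constant \<open>C\<close>, with the net replaced by the choice of an approximant for
  each compact set and each precision.
\<close>

definition haagerup_bound :: "'a::{topological_group_add, t2_space} itself \<Rightarrow> real \<Rightarrow> bool" where
  "haagerup_bound _ C \<longleftrightarrow> (\<forall>K \<epsilon>. compact K \<longrightarrow> 0 < \<epsilon> \<longrightarrow>
     (\<exists>u :: 'a \<Rightarrow> complex. u \<in> C0_functions \<and> herz_schur_bound u C \<and> (\<forall>x\<in>K. cmod (u x - 1) < \<epsilon>)))"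

lemma haagerup_boundE:
  fixes K :: "'a::{topological_group_add, t2_space} set"
  assumes "haagerup_bound TYPE('a) C" "compact K" "0 < \<epsilon>"
  obtains u :: "'a \<Rightarrow> complex" where "u \<in> C0_functions" "herz_schur_bound u C" "\<forall>x\<in>K. cmod (u x - 1) < \<epsilon>"
  using assms unfolding haagerup_bound_def by blast

lemma haagerup_bound_prod:
  assumes G: "haagerup_bound TYPE('g::{topological_group_add, t2_space}) C"
    and H: "haagerup_bound TYPE('h::{topological_group_add, t2_space}) D"
  shows "haagerup_bound TYPE('g \<times> 'h) (C * D)"
  unfolding haagerup_bound_def
proof (intro allI impI)
  fix K :: "('g \<times> 'h) set" and \<epsilon> :: real
  assume K: "compact K" and \<epsilon>: "0 < \<epsilon>"
  have "0 \<le> D"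
    by (rule haagerup_boundE[OF H compact_empty zero_less_one]) (rule herz_schur_bound_nonneg)
  define \<delta> where "\<delta> = \<epsilon> / (D + 1)"
  have \<delta>: "0 < \<delta>" "\<delta> * (D + 1) = \<epsilon>" using \<epsilon> \<open>0 \<le> D\<close> by (auto simp: \<delta>_def)
  have K': "compact (fst ` K)" "compact (snd ` K)"
    using K by (auto intro!: compact_continuous_image continuous_intros)
  obtain u :: "'g \<Rightarrow> complex" where u: "u \<in> C0_functions" "herz_schur_bound u C"
    "\<forall>x\<in>fst ` K. cmod (u x - 1) < \<delta>"
    by (rule haagerup_boundE[OF G K'(1) \<delta>(1)])
  obtain v :: "'h \<Rightarrow> complex" where v: "v \<in> C0_functions" "herz_schur_bound v D"
    "\<forall>x\<in>snd ` K. cmod (v x - 1) < \<delta>"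
    by (rule haagerup_boundE[OF H K'(2) \<delta>(1)])
  define w where "w z = u (fst z) * v (snd z)" for z
  have "w \<in> C0_functions"
    unfolding C0_functions_def
  proof (intro CollectI conjI allI impI)
    show "continuous_on UNIV w"
      unfolding w_def
      by (rule continuous_on_mult[OF
            continuous_on_compose2[OF C0_continuous[OF u(1)] continuous_on_fst[OF continuous_on_id]]
            continuous_on_compose2[OF C0_continuous[OF v(1)] continuous_on_snd[OF continuous_on_id]]]) simp_all
    fix \<eta> :: real assume \<eta>: "0 < \<eta>"
    have C: "0 \<le> C" using u(2) by (rule herz_schur_bound_nonneg)
    obtain L where L: "compact L" "\<forall>x. x \<notin> L \<longrightarrow> cmod (u x) < \<eta> / (D + 1)"
      using C0_functionsE[OF u(1), of "\<eta> / (D + 1)"] \<eta> \<open>0 \<le> D\<close> by auto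
    obtain M where M: "compact M" "\<forall>x. x \<notin> M \<longrightarrow> cmod (v x) < \<eta> / (C + 1)"
      using C0_functionsE[OF v(1), of "\<eta> / (C + 1)"] \<eta> C by auto
    have "cmod (w z) < \<eta>" if "z \<notin> L \<times> M" for z
    proof (cases "fst z \<in> L")
      case False
      have "cmod (w z) \<le> cmod (u (fst z)) * (D + 1)"
        using herz_schur_bound_le[OF v(2), of "snd z"] by (simp add: w_def norm_mult mult_left_mono)
      also have "\<dots> < \<eta>" using L(2)[rule_format, OF False] \<open>0 \<le> D\<close> by (simp add: field_simps)
      finally show ?thesis .
    next
      case True
      then have "snd z \<notin> M" using that by (auto simp: mem_Times_iff)
      have "cmod (w z) \<le> (C + 1) * cmod (v (snd z))"
        using herz_schur_bound_le[OF u(2), of "fst z"] by (simp add: w_def norm_mult mult_right_mono)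
      also have "\<dots> < \<eta>" using M(2)[rule_format, OF \<open>snd z \<notin> M\<close>] C by (simp add: field_simps)
      finally show ?thesis .
    qed
    then show "\<exists>K. compact K \<and> (\<forall>z. z \<notin> K \<longrightarrow> cmod (w z) < \<eta>)"
      using compact_Times[OF L(1) M(1)] by blast
  qed
  moreover have "herz_schur_bound w (C * D)"
    using finite_schur_bound_mult[OF finite_schur_bound_comp[OF u(2)[unfolded herz_schur_bound_def], of fst]
        finite_schur_bound_comp[OF v(2)[unfolded herz_schur_bound_def], of snd]]
    by (simp add: herz_schur_bound_def w_def)
  moreover have "cmod (w z - 1) < \<epsilon>" if "z \<in> K" for z
  proof -
    have "w z - 1 = (u (fst z) - 1) * v (snd z) + (v (snd z) - 1)"
      by (simp add: w_def algebra_simps)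
    then have "cmod (w z - 1) \<le> cmod (u (fst z) - 1) * cmod (v (snd z)) + cmod (v (snd z) - 1)"
      using norm_triangle_ineq by (metis norm_mult)
    also have "\<dots> < \<delta> * D + \<delta>"
      using bspec[OF u(3), of "fst z"] bspec[OF v(3), of "snd z"] that herz_schur_bound_le[OF v(2), of "snd z"] \<delta>(1)
      by (intro add_le_less_mono mult_mono) auto
    finally show ?thesis using \<delta>(2) by (simp add: algebra_simps)
  qed
  ultimately show "\<exists>w :: 'g \<times> 'h \<Rightarrow> complex. w \<in> C0_functions \<and> herz_schur_bound w (C * D) \<and> (\<forall>x\<in>K. cmod (w x - 1) < \<epsilon>)"
    by blast
qed

text \<open>
  Restriction to a closed subgroup \<open>p(G)\<close> keeps the matrices of a kernel, since they are a part of
  those of the larger group.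
\<close>

lemma haagerup_bound_retract:
  fixes p :: "'a::{topological_group_add, t2_space} \<Rightarrow> 'b::{topological_group_add, t2_space}" and r :: "'b \<Rightarrow> 'a"
  assumes B: "haagerup_bound TYPE('b) C"
    and hom: "\<And>s t. p (- t + s) = - p t + p s"
    and p: "continuous_on UNIV p" and r: "continuous_on UNIV r" and rp: "\<And>x. r (p x) = x"
  shows "haagerup_bound TYPE('a) C"
  unfolding haagerup_bound_def
proof (intro allI impI)
  fix K :: "'a set" and \<epsilon> :: real assume K: "compact K" and \<epsilon>: "0 < \<epsilon>"
  have pK: "compact (p ` K)"
    using K p by (meson compact_continuous_image continuous_on_subset subset_UNIV)
  obtain w :: "'b \<Rightarrow> complex" where w: "w \<in> C0_functions" "herz_schur_bound w C"
    "\<forall>x\<in>p ` K. cmod (w x - 1) < \<epsilon>"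
    by (rule haagerup_boundE[OF B pK \<epsilon>])
  have "herz_schur_bound (\<lambda>x. w (p x)) C"
    using finite_schur_bound_comp[OF w(2)[unfolded herz_schur_bound_def], of p]
    by (simp add: herz_schur_bound_def hom)
  then show "\<exists>u :: 'a \<Rightarrow> complex. u \<in> C0_functions \<and> herz_schur_bound u C \<and> (\<forall>x\<in>K. cmod (u x - 1) < \<epsilon>)"
    using C0_comp_embedding[OF w(1) p r rp] w(3) by blast
qed

lemma haagerup_bound_factors:
  assumes "haagerup_bound TYPE('g::{topological_group_add, t2_space} \<times> 'h::{topological_group_add, t2_space}) C"
  shows "haagerup_bound TYPE('g) C" "haagerup_bound TYPE('h) C"
proof -
  show "haagerup_bound TYPE('g) C"
    by (rule haagerup_bound_retract[OF assms, where p = "\<lambda>x. (x, 0)" and r = fst])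
      (simp_all add: continuous_on_Pair continuous_on_fst)
  show "haagerup_bound TYPE('h) C"
    by (rule haagerup_bound_retract[OF assms, where p = "\<lambda>x. (0, x)" and r = snd])
      (simp_all add: continuous_on_Pair continuous_on_snd)
qed

section \<open>Functionals separating the constant 1 from bounded multipliers\<close>

lemma bcontfun_cmult:
  fixes f :: "'a::topological_space \<Rightarrow> complex"
  assumes "f \<in> bcontfun"
  shows "(\<lambda>x. c * f x) \<in> bcontfun"
proof -
  obtain b where b: "\<And>x. cmod (f x) \<le> b"
    using assms by (auto simp: bcontfun_def bounded_iff)
  show ?thesis
  proof (rule bcontfun_normI)
    show "continuous_on UNIV (\<lambda>x. c * f x)"
      using assms by (intro continuous_on_mult_left) (simp add: bcontfun_def)
    show "cmod (c * f x) \<le> cmod c * b" for x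
      using b[of x] by (simp add: norm_mult mult_left_mono)
  qed
qed

text \<open>
  The properties of the separating functional on bounded continuous functions: complex linear,
  normalised at 1, bounded by \<open>B\<close> for the supremum over \<open>K\<close>, and of norm at most \<open>1 / a\<close> for the
  Herz-Schur norm on \<open>C\<^sub>0\<close>.
\<close>

definition normalized_functional :: "'a::{topological_group_add, t2_space} set \<Rightarrow> real \<Rightarrow> real \<Rightarrow>
    (('a \<Rightarrow> complex) \<Rightarrow> complex) \<Rightarrow> bool" where
  "normalized_functional K B a \<Phi> \<longleftrightarrow>
     (\<forall>f\<in>bcontfun. \<forall>g\<in>bcontfun. \<Phi> (\<lambda>x. f x + g x) = \<Phi> f + \<Phi> g) \<and>
     (\<forall>c. \<forall>f\<in>bcontfun. \<Phi> (\<lambda>x. c * f x) = c * \<Phi> f) \<and>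
     \<Phi> (\<lambda>x. 1) = 1 \<and>
     (\<forall>f\<in>bcontfun. \<forall>\<delta>\<ge>0. (\<forall>x\<in>K. cmod (f x) \<le> \<delta>) \<longrightarrow> cmod (\<Phi> f) \<le> B * \<delta>) \<and>
     (\<forall>u\<in>C0_functions. \<forall>C. herz_schur_bound u C \<longrightarrow> a * cmod (\<Phi> u) \<le> C)"

lemma normalized_functionalD:
  assumes "normalized_functional K B a \<Phi>"
  shows normalized_functional_add:
      "f \<in> bcontfun \<Longrightarrow> g \<in> bcontfun \<Longrightarrow> \<Phi> (\<lambda>x. f x + g x) = \<Phi> f + \<Phi> g"
    and normalized_functional_cmult: "f \<in> bcontfun \<Longrightarrow> \<Phi> (\<lambda>x. c * f x) = c * \<Phi> f"
    and normalized_functional_one: "\<Phi> (\<lambda>x. 1) = 1"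
    and normalized_functional_sup:
      "f \<in> bcontfun \<Longrightarrow> (\<And>x. x \<in> K \<Longrightarrow> cmod (f x) \<le> \<delta>) \<Longrightarrow> 0 \<le> \<delta> \<Longrightarrow> cmod (\<Phi> f) \<le> B * \<delta>"
    and normalized_functional_herz_schur:
      "u \<in> C0_functions \<Longrightarrow> herz_schur_bound u C \<Longrightarrow> a * cmod (\<Phi> u) \<le> C"
  using assms unfolding normalized_functional_def by blast+

lemma normalized_functional_diff:
  assumes \<Phi>: "normalized_functional K B a \<Phi>" and f: "f \<in> bcontfun" and g: "g \<in> bcontfun"
  shows "\<Phi> (\<lambda>x. f x - g x) = \<Phi> f - \<Phi> g"
  using normalized_functional_add[OF \<Phi> f bcontfun_cmult[OF g, of "- 1"]]
    normalized_functional_cmult[OF \<Phi> g, of "- 1"] by simp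

text \<open>
  Let \<open>p\<close> be the gauge of the convex balanced set of sums \<open>u + n\<close> with \<open>u\<close> in \<open>C\<^sub>0\<close> of Herz-Schur norm at
  most \<open>a\<close> and \<open>\<bar>n\<bar> \<le> \<epsilon>\<close> on \<open>K\<close>. The hypothesis implies that \<open>p 1 \<ge> 1\<close>. A real linear functional dominated by
  \<open>p\<close> with a value of at least 1 at 1 has a complexification that is again dominated by \<open>p\<close>, and
  dividing by its value at 1, of modulus at least 1, preserves the bound.
\<close>

lemma separating_functional:
  fixes K :: "'a::{topological_group_add, t2_space} set"
  assumes a: "0 < a" and \<epsilon>: "0 < \<epsilon>"
    and sep: "\<And>u. u \<in> C0_functions \<Longrightarrow> herz_schur_bound u a \<Longrightarrow> \<exists>x\<in>K. \<epsilon> \<le> cmod (u x - 1)"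
  obtains \<Phi> B where "0 < B" "normalized_functional K B a \<Phi>"
proof -
  \<comment> \<open>\<open>rel f r\<close> exhibits \<open>f\<close> as an element of \<open>r\<close> times the convex set of the gauge.\<close>
  define rel where "rel f r \<longleftrightarrow> (\<exists>l m u. 0 \<le> l \<and> 0 \<le> m \<and> r = l + m \<and> u \<in> C0_functions \<and> herz_schur_bound u (a * l)
      \<and> (\<forall>x\<in>K. cmod (f x - u x) \<le> \<epsilon> * m))" for f :: "'a \<Rightarrow> complex" and r
  have relI: "rel f (l + m)" if "0 \<le> l" "0 \<le> m" "u \<in> C0_functions" "herz_schur_bound u (a * l)"
      "\<And>x. x \<in> K \<Longrightarrow> cmod (f x - u x) \<le> \<epsilon> * m" for f l m u
    using that unfolding rel_def by blast
  have rel_nonneg: "0 \<le> r" if "rel f r" for f r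
    using that by (auto simp: rel_def)
  have rel_add: "rel (\<lambda>x. f x + g x) (r + s)" if fr: "rel f r" and gs: "rel g s" for f g r s
  proof -
    obtain l m u where u: "0 \<le> l" "0 \<le> m" "r = l + m" "u \<in> C0_functions" "herz_schur_bound u (a * l)"
      "\<And>x. x \<in> K \<Longrightarrow> cmod (f x - u x) \<le> \<epsilon> * m" using fr unfolding rel_def by blast
    obtain l' m' v where v: "0 \<le> l'" "0 \<le> m'" "s = l' + m'" "v \<in> C0_functions" "herz_schur_bound v (a * l')"
      "\<And>x. x \<in> K \<Longrightarrow> cmod (g x - v x) \<le> \<epsilon> * m'" using gs unfolding rel_def by blast
    have "rel (\<lambda>x. f x + g x) ((l + l') + (m + m'))"
    proof (rule relI)
      show "(\<lambda>x. u x + v x) \<in> C0_functions" by (rule C0_add[OF u(4) v(4)])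
      show "herz_schur_bound (\<lambda>x. u x + v x) (a * (l + l'))"
        using herz_schur_bound_add[OF u(5) v(5)] by (simp add: algebra_simps)
      fix x assume x: "x \<in> K"
      show "cmod (f x + g x - (u x + v x)) \<le> \<epsilon> * (m + m')"
        using norm_triangle_mono[OF u(6)[OF x] v(6)[OF x]] by (simp add: algebra_simps)
    qed (use u v in auto)
    then show ?thesis using u(3) v(3) by (simp add: algebra_simps)
  qed
  have rel_cmult: "rel (\<lambda>x. c * f x) (cmod c * r)" if fr: "rel f r" for c f r
  proof -
    obtain l m u where u: "0 \<le> l" "0 \<le> m" "r = l + m" "u \<in> C0_functions" "herz_schur_bound u (a * l)"
      "\<And>x. x \<in> K \<Longrightarrow> cmod (f x - u x) \<le> \<epsilon> * m" using fr unfolding rel_def by blast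
    have "rel (\<lambda>x. c * f x) (cmod c * l + cmod c * m)"
    proof (rule relI)
      show "(\<lambda>x. c * u x) \<in> C0_functions" by (rule C0_cmult[OF u(4)])
      show "herz_schur_bound (\<lambda>x. c * u x) (a * (cmod c * l))"
        using herz_schur_bound_cmult[OF u(5), of c] by (simp add: mult_ac)
      fix x assume x: "x \<in> K"
      have "cmod (c * f x - c * u x) = cmod c * cmod (f x - u x)"
        by (simp add: right_diff_distrib[symmetric] norm_mult)
      also have "\<dots> \<le> cmod c * (\<epsilon> * m)" by (intro mult_left_mono u(6)[OF x]) simp
      finally show "cmod (c * f x - c * u x) \<le> \<epsilon> * (cmod c * m)" by (simp add: mult_ac)
    qed (use u in auto)
    then show ?thesis using u(3) by (simp add: algebra_simps)
  qed
  have rel_sup: "rel f (\<delta> / \<epsilon>)" if "0 \<le> \<delta>" "\<And>x. x \<in> K \<Longrightarrow> cmod (f x) \<le> \<delta>" for f \<delta>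
    using relI[of 0 "\<delta> / \<epsilon>" "\<lambda>x. 0" f] that \<epsilon> C0_zero herz_schur_bound_zero by simp
  have rel_hs: "rel u (C / a)" if "u \<in> C0_functions" "herz_schur_bound u C" for u C
    using relI[of "C / a" 0 u u] that a herz_schur_bound_nonneg[OF that(2)] by simp
  have rel_one: "1 \<le> r" if one: "rel (\<lambda>x. 1) r" for r
  proof (rule ccontr)
    assume "\<not> 1 \<le> r"
    obtain l m u where u: "0 \<le> l" "0 \<le> m" "r = l + m" "u \<in> C0_functions" "herz_schur_bound u (a * l)"
      "\<And>x. x \<in> K \<Longrightarrow> cmod (1 - u x) \<le> \<epsilon> * m" using one unfolding rel_def by blast
    have "l \<le> 1" "m < 1" using u(1-3) \<open>\<not> 1 \<le> r\<close> by auto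
    then have "herz_schur_bound u a"
      using a by (intro herz_schur_bound_mono[OF u(5)]) simp
    from sep[OF u(4) this] obtain x where "x \<in> K" "\<epsilon> \<le> cmod (u x - 1)" by blast
    with u(6)[of x] have "\<epsilon> \<le> \<epsilon> * m" by (simp add: norm_minus_commute)
    then show False using \<open>m < 1\<close> \<epsilon> by simp
  qed
  define p where "p g = Inf {r. rel (apply_bcontfun g) r}" for g :: "'a \<Rightarrow>\<^sub>C complex"
  have p_le: "p g \<le> r" if "rel (apply_bcontfun g) r" for g r
    unfolding p_def using that rel_nonneg by (intro cInf_lower bdd_belowI[of _ 0]) auto
  have p_ge: "m \<le> p g" if "\<And>r. rel (apply_bcontfun g) r \<Longrightarrow> m \<le> r" for g m
    unfolding p_def
  proof (rule cInf_greatest)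
    show "{r. rel (apply_bcontfun g) r} \<noteq> {}"
      using rel_sup[of "norm g" "apply_bcontfun g"] norm_bounded[of g] by auto
  qed (use that in auto)
  have "sublinear p"
    unfolding sublinear_def
  proof (intro conjI allI impI)
    fix g h
    have "p (g + h) - p h \<le> r" if r: "rel (apply_bcontfun g) r" for r
    proof -
      have "p (g + h) - r \<le> s" if s: "rel (apply_bcontfun h) s" for s
        using p_le[of "g + h" "r + s"] rel_add[OF r s] by simp
      then have "p (g + h) - r \<le> p h" by (rule p_ge)
      then show ?thesis by simp
    qed
    then have "p (g + h) - p h \<le> p g" by (rule p_ge)
    then show "p (g + h) \<le> p g + p h" by simp
  next
    fix c g assume c: "(0::real) \<le> c"
    have *: "p (c *\<^sub>R g) \<le> c * r" if "rel (apply_bcontfun g) r" for r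
      using p_le[of "c *\<^sub>R g" "c * r"] rel_cmult[OF that, of "complex_of_real c"] c
      by (simp add: scaleR_conv_of_real)
    show "p (c *\<^sub>R g) \<le> c * p g"
    proof (cases "c = 0")
      case True
      have "rel (apply_bcontfun 0) 0" using rel_sup[of 0 "\<lambda>x. 0"] by simp
      then show ?thesis using True p_le[of 0 0] by simp
    next
      case False
      then have "p (c *\<^sub>R g) / c \<le> p g"
        using c * by (intro p_ge) (simp add: field_simps)
      then show ?thesis using c False by (simp add: field_simps)
    qed
  qed
  then obtain \<psi> where \<psi>: "linear \<psi>" "\<psi> \<le> p" "p (const_bcontfun 1) \<le> \<psi> (const_bcontfun 1)"
    by (rule hahn_banach_sublinear)
  define \<Psi> where "\<Psi> f = \<psi> (Bcontfun f)" for f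
  have \<Psi>_add: "\<Psi> (\<lambda>x. f x + g x) = \<Psi> f + \<Psi> g" if "f \<in> bcontfun" "g \<in> bcontfun" for f g
  proof -
    have "Bcontfun (\<lambda>x. f x + g x) = Bcontfun f + Bcontfun g"
      using that by (intro bcontfun_eqI) (simp add: Bcontfun_inverse plus_cont)
    then show ?thesis using \<psi>(1) by (simp add: \<Psi>_def linear_add)
  qed
  have \<Psi>_scale: "\<Psi> (\<lambda>x. complex_of_real c * f x) = c * \<Psi> f" if "f \<in> bcontfun" for f c
  proof -
    have "Bcontfun (\<lambda>x. complex_of_real c * f x) = c *\<^sub>R Bcontfun f"
      using that by (intro bcontfun_eqI) (simp add: Bcontfun_inverse bcontfun_cmult scaleR_conv_of_real)
    then show ?thesis using \<psi>(1) by (simp add: \<Psi>_def linear_scale)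
  qed
  have \<Psi>_le: "\<Psi> f \<le> r" if "f \<in> bcontfun" "rel f r" for f r
    using \<psi>(2) p_le[of "Bcontfun f" r] that by (auto simp: \<Psi>_def le_fun_def Bcontfun_inverse intro: order_trans)
  have \<Psi>_one: "1 \<le> \<Psi> (\<lambda>x. 1)"
  proof -
    have "1 \<le> p (const_bcontfun 1)" by (rule p_ge) (simp add: rel_one)
    then show ?thesis using \<psi>(3) by (simp add: \<Psi>_def const_bcontfun_def)
  qed
  \<comment> \<open>The unique complex linear functional with real part \<open>\<Psi>\<close>.\<close>
  define \<Theta> where "\<Theta> f = Complex (\<Psi> f) (- \<Psi> (\<lambda>x. \<i> * f x))" for f
  have \<Theta>_add: "\<Theta> (\<lambda>x. f x + g x) = \<Theta> f + \<Theta> g" if "f \<in> bcontfun" "g \<in> bcontfun" for f g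
    using \<Psi>_add[OF that] \<Psi>_add[OF bcontfun_cmult[OF that(1), of \<i>] bcontfun_cmult[OF that(2), of \<i>]]
    by (simp add: \<Theta>_def complex_eq_iff distrib_left)
  have \<Theta>_scale: "\<Theta> (\<lambda>x. complex_of_real c * f x) = complex_of_real c * \<Theta> f" if "f \<in> bcontfun" for f c
    using \<Psi>_scale[OF that, of c] \<Psi>_scale[OF bcontfun_cmult[OF that, of \<i>], of c]
    by (simp add: \<Theta>_def complex_eq_iff mult.left_commute[of \<i>])
  have \<Theta>_i: "\<Theta> (\<lambda>x. \<i> * f x) = \<i> * \<Theta> f" if "f \<in> bcontfun" for f
    using \<Psi>_scale[OF that, of "- 1"] by (simp add: \<Theta>_def complex_eq_iff mult.assoc[symmetric])
  have \<Theta>_cmult: "\<Theta> (\<lambda>x. c * f x) = c * \<Theta> f" if f: "f \<in> bcontfun" for f c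
  proof -
    have "(\<lambda>x. c * f x) = (\<lambda>x. complex_of_real (Re c) * f x + complex_of_real (Im c) * (\<i> * f x))"
      by (simp add: fun_eq_iff complex_eq_iff)
    then have "\<Theta> (\<lambda>x. c * f x) = \<Theta> (\<lambda>x. complex_of_real (Re c) * f x + complex_of_real (Im c) * (\<i> * f x))"
      by simp
    also have "\<dots> = complex_of_real (Re c) * \<Theta> f + complex_of_real (Im c) * (\<i> * \<Theta> f)"
      by (simp only: \<Theta>_add \<Theta>_scale \<Theta>_i bcontfun_cmult f)
    also have "\<dots> = c * \<Theta> f" by (simp add: complex_eq_iff)
    finally show ?thesis .
  qed
  have \<Theta>_le: "cmod (\<Theta> f) \<le> r" if f: "f \<in> bcontfun" and r: "rel f r" for f r
  proof (cases "\<Theta> f = 0")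
    case True
    then show ?thesis using rel_nonneg[OF r] by simp
  next
    case False
    \<comment> \<open>Rotating \<open>f\<close> makes \<open>\<Theta> f\<close> real and positive, where it agrees with its real part \<open>\<Psi>\<close>.\<close>
    define c where "c = cnj (\<Theta> f) / complex_of_real (cmod (\<Theta> f))"
    have c: "cmod c = 1" using False by (simp add: c_def norm_divide)
    have "\<Theta> (\<lambda>x. c * f x) = complex_of_real (cmod (\<Theta> f))"
      using False unfolding \<Theta>_cmult[OF f] c_def
      by (simp add: field_simps complex_norm_square[symmetric] power2_eq_square)
    then have "cmod (\<Theta> f) = \<Psi> (\<lambda>x. c * f x)"
      by (simp add: \<Theta>_def complex_eq_iff)
    also have "\<dots> \<le> r"
      using \<Psi>_le[OF bcontfun_cmult[OF f, of c], of r] rel_cmult[OF r, of c] c by simp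
    finally show ?thesis .
  qed
  define z where "z = \<Theta> (\<lambda>x. 1)"
  have z: "1 \<le> cmod z"
    using \<Psi>_one complex_Re_le_cmod[of z] by (simp add: z_def \<Theta>_def)
  then have z0: "z \<noteq> 0" by auto
  have dz: "cmod (w / z) \<le> cmod w" for w
    using z mult_right_mono[of 1 "cmod z" "cmod w"] z0 by (simp add: norm_divide field_simps)
  show ?thesis
  proof (rule that[of "1 / \<epsilon>" "\<lambda>f. \<Theta> f / z"])
    show "0 < 1 / \<epsilon>" using \<epsilon> by simp
    show "normalized_functional K (1 / \<epsilon>) a (\<lambda>f. \<Theta> f / z)"
      unfolding normalized_functional_def
    proof (intro conjI ballI allI impI)
    show "\<Theta> (\<lambda>x. f x + g x) / z = \<Theta> f / z + \<Theta> g / z" if "f \<in> bcontfun" "g \<in> bcontfun" for f g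
      by (simp add: \<Theta>_add[OF that] add_divide_distrib)
    show "\<Theta> (\<lambda>x. c * f x) / z = c * (\<Theta> f / z)" if "f \<in> bcontfun" for c f
      by (simp add: \<Theta>_cmult[OF that])
    show "\<Theta> (\<lambda>x. 1) / z = 1" using z0 by (simp add: z_def)
    show "cmod (\<Theta> f / z) \<le> 1 / \<epsilon> * \<delta>"
      if "f \<in> bcontfun" "0 \<le> \<delta>" "\<forall>x\<in>K. cmod (f x) \<le> \<delta>" for f \<delta>
      using dz[of "\<Theta> f"] \<Theta>_le[OF that(1) rel_sup[of \<delta> f]] that by simp
    show "a * cmod (\<Theta> u / z) \<le> C" if u: "u \<in> C0_functions" "herz_schur_bound u C" for u C
    proof -
      have "u \<in> bcontfun"
        using u by (intro bcontfun_normI[of u C] C0_continuous herz_schur_bound_le)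
      from \<Theta>_le[OF this rel_hs[OF u]] dz[of "\<Theta> u"] have "cmod (\<Theta> u / z) \<le> C / a" by simp
      then show ?thesis using a by (simp add: field_simps)
    qed
    qed
  qed
qed

section \<open>Slice maps and the lower bound for products\<close>

lemma C0_functions_bcontfun:
  assumes "u \<in> C0_functions" "herz_schur_bound u C"
  shows "u \<in> bcontfun"
  using assms by (intro bcontfun_normI[of u C] C0_continuous herz_schur_bound_le)

lemma C0_slice:
  fixes w :: "'a::t2_space \<times> 'b::t2_space \<Rightarrow> complex"
  assumes "w \<in> C0_functions"
  shows "(\<lambda>y. w (x, y)) \<in> C0_functions"
  by (rule C0_comp_embedding[OF assms, where r = snd])
    (simp_all add: continuous_on_Pair continuous_on_snd)

lemma bcontfun_zero: "(\<lambda>x. 0::complex) \<in> bcontfun"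
  by (rule const_bcontfun)

lemma bcontfun_sum:
  fixes f :: "'i \<Rightarrow> 'a::topological_space \<Rightarrow> complex"
  assumes "\<And>i. i \<in> I \<Longrightarrow> f i \<in> bcontfun"
  shows "(\<lambda>x. \<Sum>i\<in>I. f i x) \<in> bcontfun"
  using assms by (induction I rule: infinite_finite_induct) (simp_all add: bcontfun_zero plus_cont)

text \<open>
  Pairing \<open>w\<close> in the first variable with the matrix entries \<open>a s t * x s * y t\<close> gives a multiplier
  in the second variable: testing it against a matrix \<open>b\<close> and vectors \<open>p, q\<close> is the same as testing
  \<open>w\<close> against \<open>a \<otimes> b\<close> and the vectors \<open>x \<otimes> p\<close>, \<open>y \<otimes> q\<close>.
\<close>

lemma herz_schur_bound_slices:
  fixes w :: "'g::group_add \<times> 'h::group_add \<Rightarrow> complex"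
  assumes w: "herz_schur_bound w E" and A: "finite A" and a: "mat_bound A A a M"
  shows "herz_schur_bound (\<lambda>z. \<Sum>s\<in>A. \<Sum>t\<in>A. a s t * x s * y t * w (- t + s, z))
      (E * M * vec_norm A x * vec_norm A y)"
    (is "herz_schur_bound ?v (E * M * ?X * ?Y)")
  unfolding herz_schur_bound_def finite_schur_bound_def
proof (intro conjI allI impI)
  have EM: "0 \<le> E" "0 \<le> M" using herz_schur_bound_nonneg[OF w] mat_bound_nonneg[OF a] .
  then show EXY: "0 \<le> E * M * ?X * ?Y" by (simp add: sum_nonneg)
  fix B :: "'h set" and b N
  assume B: "finite B" and b: "mat_bound B B b N"
  show "mat_bound B B (\<lambda>k l. ?v (- l + k) * b k l) (E * M * ?X * ?Y * N)"
    unfolding mat_bound_def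
  proof (intro conjI allI)
    show "0 \<le> E * M * ?X * ?Y * N" using EXY mat_bound_nonneg[OF b] by simp
    fix p q :: "'h \<Rightarrow> complex"
    let ?P = "vec_norm B p" and ?Q = "vec_norm B q"
    have prod_norm: "(\<Sum>i\<in>A \<times> B. (cmod (f (fst i) * g (snd i)))\<^sup>2)
        = (\<Sum>s\<in>A. (cmod (f s))\<^sup>2) * (\<Sum>k\<in>B. (cmod (g k))\<^sup>2)" for f :: "'g \<Rightarrow> complex" and g :: "'h \<Rightarrow> complex"
      by (simp add: sum_product sum.cartesian_product norm_mult power_mult_distrib split_beta)
    have Sigma_sum: "(\<Sum>i\<in>A \<times> B. g i) = (\<Sum>s\<in>A. \<Sum>k\<in>B. g (s, k))" for g :: "'g \<times> 'h \<Rightarrow> complex"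
      by (simp add: sum.cartesian_product)
    have "mat_bound (A \<times> B) (A \<times> B)
        (\<lambda>i j. w (- j + i) * (a (fst i) (fst j) * b (snd i) (snd j))) (E * (M * N))"
      by (rule finite_schur_boundD[OF w[unfolded herz_schur_bound_def] _ mat_bound_kronecker[OF a b]])
        (simp add: A B)
    from mat_boundD[OF this, of "\<lambda>i. x (fst i) * p (snd i)" "\<lambda>j. y (fst j) * q (snd j)"]
    have "cmod (\<Sum>i\<in>A \<times> B. \<Sum>j\<in>A \<times> B. w (- j + i) * (a (fst i) (fst j) * b (snd i) (snd j))
          * (x (fst i) * p (snd i)) * (y (fst j) * q (snd j))) \<le> E * M * ?X * ?Y * N * ?P * ?Q"
      unfolding prod_norm real_sqrt_mult by (simp only: mult_ac)
    also have "(\<Sum>i\<in>A \<times> B. \<Sum>j\<in>A \<times> B. w (- j + i) * (a (fst i) (fst j) * b (snd i) (snd j))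
          * (x (fst i) * p (snd i)) * (y (fst j) * q (snd j)))
        = (\<Sum>s\<in>A. \<Sum>k\<in>B. \<Sum>t\<in>A. \<Sum>l\<in>B. a s t * x s * y t * w (- t + s, - l + k) * b k l * p k * q l)"
      by (simp add: Sigma_sum mult_ac)
    also have "\<dots> = (\<Sum>k\<in>B. \<Sum>s\<in>A. \<Sum>t\<in>A. \<Sum>l\<in>B. a s t * x s * y t * w (- t + s, - l + k) * b k l * p k * q l)"
      by (rule sum.swap)
    also have "\<dots> = (\<Sum>k\<in>B. \<Sum>s\<in>A. \<Sum>l\<in>B. \<Sum>t\<in>A. a s t * x s * y t * w (- t + s, - l + k) * b k l * p k * q l)"
      by (intro sum.cong refl sum.swap)
    also have "\<dots> = (\<Sum>k\<in>B. \<Sum>l\<in>B. \<Sum>s\<in>A. \<Sum>t\<in>A. a s t * x s * y t * w (- t + s, - l + k) * b k l * p k * q l)"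
      by (intro sum.cong refl sum.swap)
    also have "\<dots> = (\<Sum>k\<in>B. \<Sum>l\<in>B. ?v (- l + k) * b k l * p k * q l)"
      by (simp add: sum_distrib_right)
    finally show "cmod (\<Sum>k\<in>B. \<Sum>l\<in>B. ?v (- l + k) * b k l * p k * q l)
        \<le> E * M * ?X * ?Y * N * ?P * ?Q" .
  qed
qed

lemma normalized_functional_sum:
  assumes \<Phi>: "normalized_functional K B b \<Phi>" and f: "\<And>i. i \<in> I \<Longrightarrow> f i \<in> bcontfun"
  shows "\<Phi> (\<lambda>x. \<Sum>i\<in>I. c i * f i x) = (\<Sum>i\<in>I. c i * \<Phi> (f i))"
proof -
  have "\<Phi> (\<lambda>x. 0) = 0"
    using normalized_functional_cmult[OF \<Phi> bcontfun_zero, of 0] by simp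
  then show ?thesis
    using f
  proof (induction I rule: infinite_finite_induct)
    case (insert i I)
    then show ?case
      using normalized_functional_add[OF \<Phi>, of "\<lambda>x. c i * f i x" "\<lambda>x. \<Sum>i\<in>I. c i * f i x"]
      by (simp add: bcontfun_cmult bcontfun_sum normalized_functional_cmult[OF \<Phi>])
  qed simp_all
qed

text \<open>
  Continuity and decay of the slice come from uniform estimates for \<open>w\<close> over the compact set \<open>K\<close> that
  controls \<open>\<Phi>\<close>. For the multiplier norm, \<open>\<Phi>\<close> is moved outside the finite sum that tests the slice;
  there it acts on a multiplier in \<open>C\<^sub>0\<close> whose norm is given by \<open>herz_schur_bound_slices\<close>.
\<close>

lemma slice_map:
  fixes w :: "'g::{topological_group_add, t2_space} \<times> 'h::{topological_group_add, t2_space} \<Rightarrow> complex"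
  assumes w: "w \<in> C0_functions" "herz_schur_bound w E"
    and K: "compact K" and B: "0 < B" and b: "0 < b" and \<Phi>: "normalized_functional K B b \<Phi>"
  shows "(\<lambda>x. \<Phi> (\<lambda>y. w (x, y))) \<in> C0_functions" "herz_schur_bound (\<lambda>x. \<Phi> (\<lambda>y. w (x, y))) (E / b)"
proof -
  have bc: "(\<lambda>y. w (x, y)) \<in> bcontfun" for x
    using C0_slice[OF w(1)] herz_schur_bound_le[OF w(2)]
    by (intro bcontfun_normI[of _ E] C0_continuous) auto
  show "(\<lambda>x. \<Phi> (\<lambda>y. w (x, y))) \<in> C0_functions"
    unfolding C0_functions_def
  proof (intro CollectI conjI allI impI)
    show "continuous_on UNIV (\<lambda>x. \<Phi> (\<lambda>y. w (x, y)))"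
      unfolding continuous_on_topological
    proof (intro ballI allI impI)
      fix x0 S assume S: "open S" "\<Phi> (\<lambda>y. w (x0, y)) \<in> S"
      then obtain e where e: "0 < e" "\<forall>z. dist z (\<Phi> (\<lambda>y. w (x0, y))) < e \<longrightarrow> z \<in> S"
        unfolding open_dist by blast
      have cont: "continuous_on (UNIV \<times> K) w"
        by (rule continuous_on_subset[OF C0_continuous[OF w(1)]]) simp
      have "0 < e / (2 * B)" using e B by simp
      then obtain X0 where X0: "x0 \<in> X0" "open X0"
        and d: "\<forall>x\<in>X0 \<inter> UNIV. \<forall>t\<in>K. dist (w (x, t)) (w (x0, t)) \<le> e / (2 * B)"
        by (rule continuous_on_prod_compactE[OF cont K UNIV_I])
      have "\<Phi> (\<lambda>y. w (x, y)) \<in> S" if "x \<in> X0" for x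
      proof (rule e(2)[rule_format])
        have "cmod (\<Phi> (\<lambda>y. w (x, y) - w (x0, y))) \<le> B * (e / (2 * B))"
        proof (rule normalized_functional_sup[OF \<Phi>])
          show "(\<lambda>y. w (x, y) - w (x0, y)) \<in> bcontfun" by (rule minus_cont[OF bc bc])
        qed (use d that e(1) B in \<open>auto simp: dist_norm\<close>)
        also have "\<dots> < e" using e B by simp
        finally show "dist (\<Phi> (\<lambda>y. w (x, y))) (\<Phi> (\<lambda>y. w (x0, y))) < e"
          by (simp add: normalized_functional_diff[OF \<Phi> bc bc] dist_norm)
      qed
      with X0 show "\<exists>A. open A \<and> x0 \<in> A \<and> (\<forall>y\<in>UNIV. y \<in> A \<longrightarrow> \<Phi> (\<lambda>z. w (y, z)) \<in> S)" by blast
    qed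
    fix \<epsilon> :: real assume \<epsilon>: "0 < \<epsilon>"
    then have "0 < \<epsilon> / (2 * B)" using B by simp
    then obtain L where L: "compact L" "\<forall>z. z \<notin> L \<longrightarrow> cmod (w z) < \<epsilon> / (2 * B)"
      by (rule C0_functionsE[OF w(1)])
    have "cmod (\<Phi> (\<lambda>y. w (x, y))) < \<epsilon>" if "x \<notin> fst ` L" for x
    proof -
      have "(x, y) \<notin> L" for y using that by force
      then have "cmod (\<Phi> (\<lambda>y. w (x, y))) \<le> B * (\<epsilon> / (2 * B))"
        using \<epsilon> B by (intro normalized_functional_sup[OF \<Phi>] bc) (auto intro: less_imp_le L(2)[rule_format])
      also have "\<dots> < \<epsilon>" using \<epsilon> B by simp
      finally show ?thesis .
    qed
    moreover have "compact (fst ` L)"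
      using L(1) by (intro compact_continuous_image continuous_on_fst continuous_on_id)
    ultimately show "\<exists>K. compact K \<and> (\<forall>x. x \<notin> K \<longrightarrow> cmod (\<Phi> (\<lambda>y. w (x, y))) < \<epsilon>)" by blast
  qed
  show "herz_schur_bound (\<lambda>x. \<Phi> (\<lambda>y. w (x, y))) (E / b)"
    unfolding herz_schur_bound_def finite_schur_bound_def
  proof (intro conjI allI impI)
    show Eb: "0 \<le> E / b" using herz_schur_bound_nonneg[OF w(2)] b by simp
    fix A :: "'g set" and a M
    assume A: "finite A" and a: "mat_bound A A a M"
    show "mat_bound A A (\<lambda>s t. \<Phi> (\<lambda>y. w (- t + s, y)) * a s t) (E / b * M)"
      unfolding mat_bound_def
    proof (intro conjI allI)
      show "0 \<le> E / b * M" using Eb mat_bound_nonneg[OF a] by (rule mult_nonneg_nonneg)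
      fix x y :: "'g \<Rightarrow> complex"
      let ?v = "\<lambda>z. \<Sum>s\<in>A. \<Sum>t\<in>A. a s t * x s * y t * w (- t + s, z)"
      have "(\<Sum>s\<in>A. \<Sum>t\<in>A. \<Phi> (\<lambda>y. w (- t + s, y)) * a s t * x s * y t)
          = (\<Sum>i\<in>A \<times> A. a (fst i) (snd i) * x (fst i) * y (snd i) * \<Phi> (\<lambda>z. w (- snd i + fst i, z)))"
        by (simp add: sum.cartesian_product split_beta mult_ac)
      also have "\<dots> = \<Phi> (\<lambda>z. \<Sum>i\<in>A \<times> A. a (fst i) (snd i) * x (fst i) * y (snd i) * w (- snd i + fst i, z))"
        by (rule normalized_functional_sum[OF \<Phi>, symmetric]) (rule bc)
      also have "\<dots> = \<Phi> ?v"
        by (simp add: sum.cartesian_product split_beta)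
      finally have eq: "(\<Sum>s\<in>A. \<Sum>t\<in>A. \<Phi> (\<lambda>y. w (- t + s, y)) * a s t * x s * y t) = \<Phi> ?v" .
      have "?v \<in> C0_functions"
        by (intro C0_sum C0_cmult C0_slice[OF w(1)])
      from normalized_functional_herz_schur[OF \<Phi> this herz_schur_bound_slices[OF w(2) A a]]
      have "cmod (\<Phi> ?v) \<le> E * M * vec_norm A x * vec_norm A y / b"
        using b by (simp add: pos_le_divide_eq mult.commute[of b])
      then show "cmod (\<Sum>s\<in>A. \<Sum>t\<in>A. \<Phi> (\<lambda>y. w (- t + s, y)) * a s t * x s * y t)
          \<le> E / b * M * vec_norm A x * vec_norm A y"
        unfolding eq by (simp add: mult_ac)
    qed
  qed
qed

lemma not_haagerup_boundE:
  assumes "\<not> haagerup_bound TYPE('a::{topological_group_add, t2_space}) C"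
  obtains K \<epsilon> where "compact (K :: 'a set)" "0 < \<epsilon>"
    "\<forall>u. u \<in> C0_functions \<longrightarrow> herz_schur_bound u C \<longrightarrow> (\<exists>x\<in>K. \<epsilon> \<le> cmod (u x - 1))"
proof -
  have "\<exists>K \<epsilon>. compact (K :: 'a set) \<and> 0 < \<epsilon> \<and>
      (\<forall>u. u \<in> C0_functions \<longrightarrow> herz_schur_bound u C \<longrightarrow> (\<exists>x\<in>K. \<epsilon> \<le> cmod (u x - 1)))"
    using assms by (simp add: haagerup_bound_def not_less Bex_def) meson
  then show ?thesis using that by blast
qed

text \<open>
  For \<open>w\<close> close to 1 on \<open>K \<times> L\<close> with bound \<open>E\<close>, applying the separating functionals of both factors
  to \<open>w\<close> gives a number that is close to 1 and has modulus at most \<open>E / (a b)\<close>.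
\<close>

lemma haagerup_bound_prod_ge:
  assumes E: "haagerup_bound TYPE('g::{topological_group_add, t2_space} \<times> 'h::{topological_group_add, t2_space}) E"
    and a: "0 < a" and nG: "\<not> haagerup_bound TYPE('g) a"
    and b: "0 < b" and nH: "\<not> haagerup_bound TYPE('h) b"
  shows "a * b \<le> E"
proof (rule field_le_epsilon)
  fix e :: real assume e: "0 < e"
  obtain K :: "'g set" and \<epsilon> where K: "compact K" "0 < \<epsilon>"
    and nK: "\<forall>u. u \<in> C0_functions \<longrightarrow> herz_schur_bound u a \<longrightarrow> (\<exists>x\<in>K. \<epsilon> \<le> cmod (u x - 1))"
    by (rule not_haagerup_boundE[OF nG])
  obtain L :: "'h set" and \<delta> where L: "compact L" "0 < \<delta>"
    and nL: "\<forall>u. u \<in> C0_functions \<longrightarrow> herz_schur_bound u b \<longrightarrow> (\<exists>x\<in>L. \<delta> \<le> cmod (u x - 1))"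
    by (rule not_haagerup_boundE[OF nH])
  obtain \<Phi> B where B: "0 < B" and \<Phi>: "normalized_functional K B a \<Phi>"
    by (rule separating_functional[OF a K(2) nK[rule_format]])
  obtain \<Psi> D where D: "0 < D" and \<Psi>: "normalized_functional L D b \<Psi>"
    by (rule separating_functional[OF b L(2) nL[rule_format]])
  \<comment> \<open>The error in \<open>w\<close> is magnified by \<open>B\<close> and \<open>D\<close>, and then by \<open>a * b\<close> when clearing denominators.\<close>
  define \<eta> where "\<eta> = e / (a * b * B * D)"
  have \<eta>: "0 < \<eta>" using e a b B D by (simp add: \<eta>_def)
  obtain w :: "'g \<times> 'h \<Rightarrow> complex" where w: "w \<in> C0_functions" "herz_schur_bound w E"
    "\<forall>z\<in>K \<times> L. cmod (w z - 1) < \<eta>"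
    by (rule haagerup_boundE[OF E compact_Times[OF K(1) L(1)] \<eta>])
  define u where "u x = \<Psi> (\<lambda>y. w (x, y))" for x
  have u: "u \<in> C0_functions" "herz_schur_bound u (E / b)"
    unfolding u_def by (rule slice_map[OF w(1,2) L(1) D b \<Psi>])+
  have one: "(\<lambda>x. 1 :: complex) \<in> bcontfun" by (rule const_bcontfun)
  have bc: "(\<lambda>y. w (x, y)) \<in> bcontfun" for x
    using C0_slice[OF w(1)] herz_schur_bound_le[OF w(2)]
    by (intro bcontfun_normI[of _ E] C0_continuous) auto
  have "cmod (u x - 1) \<le> D * \<eta>" if "x \<in> K" for x
  proof -
    have "cmod (\<Psi> (\<lambda>y. w (x, y) - 1)) \<le> D * \<eta>"
    proof (rule normalized_functional_sup[OF \<Psi>])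
      show "(\<lambda>y. w (x, y) - 1) \<in> bcontfun" by (rule minus_cont[OF bc one])
    qed (use w(3) that \<eta> in \<open>auto intro: less_imp_le\<close>)
    then show ?thesis by (simp add: normalized_functional_diff[OF \<Psi> bc one] normalized_functional_one[OF \<Psi>] u_def)
  qed
  then have "cmod (\<Phi> (\<lambda>x. u x - 1)) \<le> B * (D * \<eta>)"
    using minus_cont[OF C0_functions_bcontfun[OF u] one] D \<eta> by (intro normalized_functional_sup[OF \<Phi>]) auto
  then have "1 - cmod (\<Phi> u) \<le> B * D * \<eta>"
    using norm_triangle_ineq2[of 1 "\<Phi> u"]
    by (simp add: normalized_functional_diff[OF \<Phi> C0_functions_bcontfun[OF u] one]
        normalized_functional_one[OF \<Phi>] norm_minus_commute mult.assoc)
  then have "a * b * (1 - cmod (\<Phi> u)) \<le> a * b * (B * D * \<eta>)"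
    using a b by (intro mult_left_mono) auto
  also have "\<dots> = e" using a b B D by (simp add: \<eta>_def field_simps)
  finally have "a * b \<le> b * (a * cmod (\<Phi> u)) + e" by (simp add: algebra_simps)
  also have "b * (a * cmod (\<Phi> u)) \<le> b * (E / b)"
    using b by (intro mult_left_mono normalized_functional_herz_schur[OF \<Phi>] u) auto
  finally show "a * b \<le> E + e" using b by simp
qed

section \<open>Square-integrable functions and Hilbert-Schmidt kernels\<close>

lemma L2_spaceD:
  assumes "\<xi> \<in> L2_space \<mu>"
  shows "\<xi> \<in> borel_measurable \<mu>" "integrable \<mu> (\<lambda>x. (cmod (\<xi> x))\<^sup>2)"
  using assms by (auto simp: L2_space_def)

lemma L2_norm_nonneg [simp]: "0 \<le> L2_norm \<mu> \<xi>"
  by (simp add: L2_norm_def)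

lemma L2_norm_power2: "(L2_norm \<mu> \<xi>)\<^sup>2 = (\<integral>x. (cmod (\<xi> x))\<^sup>2 \<partial>\<mu>)"
  by (simp add: L2_norm_def)

lemma nn_integral_L2:
  assumes "\<xi> \<in> L2_space \<mu>"
  shows "(\<integral>\<^sup>+x. ennreal ((cmod (\<xi> x))\<^sup>2) \<partial>\<mu>) = ennreal ((L2_norm \<mu> \<xi>)\<^sup>2)"
  unfolding L2_norm_power2 by (rule nn_integral_eq_integral[OF L2_spaceD(2)[OF assms]]) simp

lemma L2_spaceI:
  assumes "\<xi> \<in> borel_measurable \<mu>" "(\<integral>\<^sup>+x. ennreal ((cmod (\<xi> x))\<^sup>2) \<partial>\<mu>) < \<infinity>"
  shows "\<xi> \<in> L2_space \<mu>"
  unfolding L2_space_def using assms by (auto intro!: integrableI_bounded)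

lemma L2_space_dominated:
  assumes "\<xi> \<in> L2_space \<mu>" "\<eta> \<in> borel_measurable \<mu>" "\<And>x. cmod (\<eta> x) \<le> cmod (\<xi> x)"
  shows "\<eta> \<in> L2_space \<mu>" "L2_norm \<mu> \<eta> \<le> L2_norm \<mu> \<xi>"
proof -
  have le: "(cmod (\<eta> x))\<^sup>2 \<le> (cmod (\<xi> x))\<^sup>2" for x
    by (rule power_mono[OF assms(3)]) simp
  have int: "integrable \<mu> (\<lambda>x. (cmod (\<eta> x))\<^sup>2)"
    by (rule Bochner_Integration.integrable_bound[OF L2_spaceD(2)[OF assms(1)]]) (use assms(2) le in auto)
  then show "\<eta> \<in> L2_space \<mu>" using assms(2) by (simp add: L2_space_def)
  show "L2_norm \<mu> \<eta> \<le> L2_norm \<mu> \<xi>"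
    unfolding L2_norm_def by (intro real_sqrt_le_mono integral_mono int L2_spaceD(2)[OF assms(1)] le)
qed

lemma L2_space_indicator:
  assumes "\<xi> \<in> L2_space \<mu>" "E \<in> sets \<mu>"
  shows "(\<lambda>x. indicator E x * \<xi> x) \<in> L2_space \<mu>" "L2_norm \<mu> (\<lambda>x. indicator E x * \<xi> x) \<le> L2_norm \<mu> \<xi>"
proof -
  have *: "(\<lambda>x. indicator E x * \<xi> x) \<in> borel_measurable \<mu>"
    using assms(2) L2_spaceD(1)[OF assms(1)] by simp
  show "(\<lambda>x. indicator E x * \<xi> x) \<in> L2_space \<mu>"
    by (rule L2_space_dominated(1)[OF assms(1) *]) (simp add: indicator_def)
  show "L2_norm \<mu> (\<lambda>x. indicator E x * \<xi> x) \<le> L2_norm \<mu> \<xi>"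
    by (rule L2_space_dominated(2)[OF assms(1) *]) (simp add: indicator_def)
qed

lemma L2_space_cmult:
  assumes "\<xi> \<in> L2_space \<mu>"
  shows "(\<lambda>x. c * \<xi> x) \<in> L2_space \<mu>"
  using assms by (auto simp: L2_space_def norm_mult power_mult_distrib)

lemma L2_norm_cmult: "L2_norm \<mu> (\<lambda>x. c * \<xi> x) = cmod c * L2_norm \<mu> \<xi>"
  by (simp add: L2_norm_def norm_mult power_mult_distrib real_sqrt_mult)

lemma L2_space_add:
  assumes "\<xi> \<in> L2_space \<mu>" "\<eta> \<in> L2_space \<mu>"
  shows "(\<lambda>x. \<xi> x + \<eta> x) \<in> L2_space \<mu>"
proof -
  have le: "(cmod (\<xi> x + \<eta> x))\<^sup>2 \<le> 2 * (cmod (\<xi> x))\<^sup>2 + 2 * (cmod (\<eta> x))\<^sup>2" for x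
  proof -
    have "(cmod (\<xi> x + \<eta> x))\<^sup>2 \<le> (cmod (\<xi> x) + cmod (\<eta> x))\<^sup>2"
      by (intro power_mono norm_triangle_ineq) simp
    also have "\<dots> \<le> 2 * (cmod (\<xi> x))\<^sup>2 + 2 * (cmod (\<eta> x))\<^sup>2"
      using zero_le_power2[of "cmod (\<xi> x) - cmod (\<eta> x)"] by (simp add: power2_eq_square algebra_simps)
    finally show ?thesis .
  qed
  have "integrable \<mu> (\<lambda>x. 2 * (cmod (\<xi> x))\<^sup>2 + 2 * (cmod (\<eta> x))\<^sup>2)"
    using L2_spaceD(2)[OF assms(1)] L2_spaceD(2)[OF assms(2)] by simp
  then have "integrable \<mu> (\<lambda>x. (cmod (\<xi> x + \<eta> x))\<^sup>2)"
    by (rule Bochner_Integration.integrable_bound)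
      (use L2_spaceD(1)[OF assms(1)] L2_spaceD(1)[OF assms(2)] in \<open>auto intro!: AE_I2 order_trans[OF le]\<close>)
  then show ?thesis
    using L2_spaceD(1)[OF assms(1)] L2_spaceD(1)[OF assms(2)] by (simp add: L2_space_def)
qed

lemma L2_space_zero: "(\<lambda>x. 0) \<in> L2_space \<mu>"
  by (simp add: L2_space_def)

lemma L2_space_sum:
  "(\<And>i. i \<in> I \<Longrightarrow> \<xi> i \<in> L2_space \<mu>) \<Longrightarrow> (\<lambda>x. \<Sum>i\<in>I. \<xi> i x) \<in> L2_space \<mu>"
  by (induction I rule: infinite_finite_induct) (simp_all add: L2_space_zero L2_space_add)

lemma L2_Cauchy_Schwarz:
  assumes "\<xi> \<in> L2_space \<mu>" "\<eta> \<in> L2_space \<mu>"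
  shows "integrable \<mu> (\<lambda>x. \<xi> x * \<eta> x)" "cmod (\<integral>x. \<xi> x * \<eta> x \<partial>\<mu>) \<le> L2_norm \<mu> \<xi> * L2_norm \<mu> \<eta>"
proof -
  note meas [measurable] = L2_spaceD(1)[OF assms(1)] L2_spaceD(1)[OF assms(2)]
  have "(\<integral>\<^sup>+x. ennreal (cmod (\<xi> x)) * ennreal (cmod (\<eta> x)) \<partial>\<mu>)\<^sup>2
      \<le> (\<integral>\<^sup>+x. (ennreal (cmod (\<xi> x)))\<^sup>2 \<partial>\<mu>) * (\<integral>\<^sup>+x. (ennreal (cmod (\<eta> x)))\<^sup>2 \<partial>\<mu>)"
    by (rule Cauchy_Schwarz_nn_integral) simp_all
  also have "\<dots> = ennreal ((L2_norm \<mu> \<xi> * L2_norm \<mu> \<eta>)\<^sup>2)"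
    using nn_integral_L2[OF assms(1)] nn_integral_L2[OF assms(2)]
    by (simp add: ennreal_power ennreal_mult power_mult_distrib)
  finally have sq: "(\<integral>\<^sup>+x. ennreal (cmod (\<xi> x * \<eta> x)) \<partial>\<mu>)\<^sup>2 \<le> ennreal ((L2_norm \<mu> \<xi> * L2_norm \<mu> \<eta>)\<^sup>2)"
    by (simp add: norm_mult ennreal_mult)
  have le: "(\<integral>\<^sup>+x. ennreal (cmod (\<xi> x * \<eta> x)) \<partial>\<mu>) \<le> ennreal (L2_norm \<mu> \<xi> * L2_norm \<mu> \<eta>)"
  proof (cases "\<integral>\<^sup>+x. ennreal (cmod (\<xi> x * \<eta> x)) \<partial>\<mu>")
    case (real r)
    then have "r\<^sup>2 \<le> (L2_norm \<mu> \<xi> * L2_norm \<mu> \<eta>)\<^sup>2"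
      using sq by (simp add: ennreal_power)
    then have "r \<le> L2_norm \<mu> \<xi> * L2_norm \<mu> \<eta>"
      by (rule power2_le_imp_le) simp
    then show ?thesis by (simp add: real(2) ennreal_leI)
  next
    case top
    have "(top :: ennreal)\<^sup>2 = top" by (simp add: power2_eq_square)
    then have "top \<le> ennreal ((L2_norm \<mu> \<xi> * L2_norm \<mu> \<eta>)\<^sup>2)"
      using sq unfolding top by (simp only:)
    then show ?thesis using ennreal_less_top leD by blast
  qed
  then show int: "integrable \<mu> (\<lambda>x. \<xi> x * \<eta> x)"
    using le_less_trans[OF le ennreal_less_top] by (intro integrableI_bounded) simp_all
  have "ennreal (cmod (\<integral>x. \<xi> x * \<eta> x \<partial>\<mu>)) \<le> (\<integral>\<^sup>+x. ennreal (cmod (\<xi> x * \<eta> x)) \<partial>\<mu>)"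
    by (rule integral_norm_bound_ennreal[OF int])
  also note le
  finally show "cmod (\<integral>x. \<xi> x * \<eta> x \<partial>\<mu>) \<le> L2_norm \<mu> \<xi> * L2_norm \<mu> \<eta>"
    by (simp add: ennreal_le_iff)
qed

text \<open>
  Functions with disjoint supports are orthogonal.
\<close>

lemma L2_norm_sum_disjoint:
  assumes A: "finite A" and g: "\<And>p. p \<in> A \<Longrightarrow> g p \<in> L2_space \<mu>"
    and supp: "\<And>p x. p \<in> A \<Longrightarrow> g p x \<noteq> 0 \<Longrightarrow> x \<in> E p" and disj: "disjoint_family_on E A"
  shows "(L2_norm \<mu> (\<lambda>x. \<Sum>p\<in>A. \<alpha> p * g p x))\<^sup>2 = (\<Sum>p\<in>A. (cmod (\<alpha> p))\<^sup>2 * (L2_norm \<mu> (g p))\<^sup>2)"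
proof -
  have pt: "(cmod (\<Sum>p\<in>A. \<alpha> p * g p x))\<^sup>2 = (\<Sum>p\<in>A. (cmod (\<alpha> p))\<^sup>2 * (cmod (g p x))\<^sup>2)" for x
  proof (cases "\<exists>p\<in>A. g p x \<noteq> 0")
    case True
    then obtain p where p: "p \<in> A" "g p x \<noteq> 0" by blast
    have zero: "g q x = 0" if "q \<in> A - {p}" for q
      using disj supp[OF p] supp[of q x] p(1) that unfolding disjoint_family_on_def by blast
    show ?thesis
      unfolding sum.remove[OF A p(1)]
      by (simp add: zero norm_mult power_mult_distrib)
  qed auto
  show ?thesis
    unfolding L2_norm_power2 pt
    using L2_spaceD(2)[OF g] by (subst Bochner_Integration.integral_sum) auto
qed

text \<open>
  The norm of \<open>f\<close> in \<open>L\<^sup>2(G \<times> G)\<close>, that is, the Hilbert-Schmidt norm of \<open>kernel_op \<mu> f\<close>.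
\<close>

definition kernel_norm :: "'a measure \<Rightarrow> ('a \<times> 'a \<Rightarrow> complex) \<Rightarrow> real" where
  "kernel_norm \<mu> f = sqrt (enn2real (\<integral>\<^sup>+ s. (\<integral>\<^sup>+ t. ennreal ((cmod (f (s, t)))\<^sup>2) \<partial>\<mu>) \<partial>\<mu>))"

text \<open>
  \<open>\<langle>T\<^sub>f \<xi>, \<eta>\<^sup>*\<rangle>\<close> for the operator \<open>T\<^sub>f\<close> with kernel \<open>f\<close> and the complex conjugate \<open>\<eta>\<^sup>*\<close> of \<open>\<eta>\<close>; it is
  linear in all three arguments.
\<close>

definition kernel_pairing :: "'a measure \<Rightarrow> ('a \<times> 'a \<Rightarrow> complex) \<Rightarrow> ('a \<Rightarrow> complex) \<Rightarrow> ('a \<Rightarrow> complex) \<Rightarrow> complex" where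
  "kernel_pairing \<mu> f \<eta> \<xi> = (\<integral>s. \<eta> s * kernel_op \<mu> f \<xi> s \<partial>\<mu>)"

lemma kernel_norm_nonneg [simp]: "0 \<le> kernel_norm \<mu> f"
  by (simp add: kernel_norm_def)

text \<open>
  The calculus of \<open>L\<^sup>2\<close> kernels is developed for Borel measures that are finite on compact sets;
  Haar measure is an instance (\<open>left_haar_measure_compact_finite\<close>).
\<close>

locale compact_finite_measure =
  fixes \<mu> :: "'a::{topological_group_add, t2_space} measure"
  assumes sets_eq: "sets \<mu> = sets borel"
    and finite_compact: "compact K \<Longrightarrow> emeasure \<mu> K < \<infinity>"
begin

abbreviation "L2 \<equiv> L2_space \<mu>"
abbreviation "nrm \<equiv> L2_norm \<mu>"
abbreviation "kernels \<equiv> L2_kernels \<mu>"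
abbreviation "hs_norm \<equiv> kernel_norm \<mu>"
abbreviation "op_norm f \<equiv> L2_op_norm \<mu> (kernel_op \<mu> f)"
abbreviation "pairing \<equiv> kernel_pairing \<mu>"

lemma space_eq [simp]: "space \<mu> = UNIV"
  using sets_eq_imp_space_eq[OF sets_eq] by simp

lemma compact_sets: "compact K \<Longrightarrow> K \<in> sets \<mu>"
  by (simp add: sets_eq borel_closed compact_imp_closed)

text \<open>
  The measure \<open>\<mu>\<close> itself need not be \<open>\<sigma>\<close>-finite, so integrals depending on a parameter are not known
  to be measurable. Kernels live on a \<open>\<sigma>\<close>-compact set, however, and the restriction of \<open>\<mu>\<close> to such a
  set is \<open>\<sigma>\<close>-finite.
\<close>

lemma sigma_finite_support:
  fixes K :: "nat \<Rightarrow> 'a set"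
  assumes K: "\<And>n. compact (K n)"
  shows "sigma_finite_measure (density \<mu> (\<lambda>x. ennreal (indicator (\<Union>n. K n) x)))" (is "sigma_finite_measure ?\<nu>")
proof
  let ?S = "\<Union>n. K n"
  have S: "?S \<in> sets \<mu>" using K by (auto intro: compact_sets)
  have eq: "emeasure ?\<nu> B = emeasure \<mu> (?S \<inter> B)" if "B \<in> sets \<mu>" for B
    using S that by (simp add: emeasure_density ennreal_indicator indicator_inter_arith[symmetric])
  show "\<exists>B. countable B \<and> B \<subseteq> sets ?\<nu> \<and> \<Union>B = space ?\<nu> \<and> (\<forall>b\<in>B. emeasure ?\<nu> b \<noteq> \<infinity>)"
  proof (intro exI conjI ballI)
    show "countable (insert (- ?S) (range K))" by simp
    show "insert (- ?S) (range K) \<subseteq> sets ?\<nu>"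
      using K S sets.compl_sets[OF S] by (auto intro: compact_sets simp: Compl_eq_Diff_UNIV)
    show "\<Union>(insert (- ?S) (range K)) = space ?\<nu>" by auto
    fix b assume "b \<in> insert (- ?S) (range K)"
    then consider "b = - ?S" | n where "b = K n" by blast
    then show "emeasure ?\<nu> b \<noteq> \<infinity>"
    proof cases
      case 1
      then show ?thesis using eq[of "- ?S"] sets.compl_sets[OF S] by (simp add: Compl_eq_Diff_UNIV)
    next
      case 2
      have "emeasure ?\<nu> (K n) \<le> emeasure \<mu> (K n)"
        using compact_sets[OF K] S by (subst eq) (auto intro!: emeasure_mono)
      then show ?thesis using 2 finite_compact[OF K[of n]] by (auto simp: top_unique)
    qed
  qed
qed

lemma measurable_nn_integral_section:
  fixes h :: "'a \<times> 'a \<Rightarrow> ennreal"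
  assumes h: "h \<in> borel_measurable (\<mu> \<Otimes>\<^sub>M \<mu>)" and K: "\<And>n. compact (K n)"
    and supp: "\<And>s t. h (s, t) \<noteq> 0 \<Longrightarrow> t \<in> (\<Union>n::nat. K n)"
  shows "(\<lambda>s. \<integral>\<^sup>+t. h (s, t) \<partial>\<mu>) \<in> borel_measurable \<mu>"
proof -
  let ?S = "\<Union>n. K n" let ?\<nu> = "density \<mu> (\<lambda>x. ennreal (indicator ?S x))"
  have S: "?S \<in> sets \<mu>" using K by (auto intro: compact_sets)
  interpret \<nu>: sigma_finite_measure ?\<nu> by (rule sigma_finite_support[OF K])
  have "h \<in> borel_measurable (\<mu> \<Otimes>\<^sub>M ?\<nu>)"
    using h by (simp cong: measurable_cong_sets sets_pair_measure_cong)
  then have "(\<lambda>s. \<integral>\<^sup>+t. h (s, t) \<partial>?\<nu>) \<in> borel_measurable \<mu>"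
    by (intro \<nu>.borel_measurable_nn_integral) simp
  moreover have "(\<integral>\<^sup>+t. h (s, t) \<partial>?\<nu>) = (\<integral>\<^sup>+t. h (s, t) \<partial>\<mu>)" for s
  proof -
    have "(\<lambda>t. h (s, t)) \<in> borel_measurable \<mu>" by (rule measurable_Pair2[OF h]) simp
    then have "(\<integral>\<^sup>+t. h (s, t) \<partial>?\<nu>) = (\<integral>\<^sup>+t. ennreal (indicator ?S t) * h (s, t) \<partial>\<mu>)"
      using S by (subst nn_integral_density) auto
    also have "\<dots> = (\<integral>\<^sup>+t. h (s, t) \<partial>\<mu>)"
      using supp[of s] by (intro nn_integral_cong) (auto simp: indicator_def)
    finally show ?thesis .
  qed
  ultimately show ?thesis by simp
qed

lemma measurable_integral_section:
  fixes h :: "'a \<times> 'a \<Rightarrow> complex"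
  assumes h: "h \<in> borel_measurable (\<mu> \<Otimes>\<^sub>M \<mu>)" and K: "\<And>n. compact (K n)"
    and supp: "\<And>s t. h (s, t) \<noteq> 0 \<Longrightarrow> t \<in> (\<Union>n::nat. K n)"
  shows "(\<lambda>s. \<integral>t. h (s, t) \<partial>\<mu>) \<in> borel_measurable \<mu>"
proof -
  let ?S = "\<Union>n. K n" let ?\<nu> = "density \<mu> (\<lambda>x. ennreal (indicator ?S x))"
  have S: "?S \<in> sets \<mu>" using K by (auto intro: compact_sets)
  interpret \<nu>: sigma_finite_measure ?\<nu> by (rule sigma_finite_support[OF K])
  have "h \<in> borel_measurable (\<mu> \<Otimes>\<^sub>M ?\<nu>)"
    using h by (simp cong: measurable_cong_sets sets_pair_measure_cong)
  then have "(\<lambda>s. \<integral>t. h (s, t) \<partial>?\<nu>) \<in> borel_measurable \<mu>"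
    by (intro \<nu>.borel_measurable_lebesgue_integral) simp
  moreover have "(\<integral>t. h (s, t) \<partial>?\<nu>) = (\<integral>t. h (s, t) \<partial>\<mu>)" for s
  proof -
    have "(\<lambda>t. h (s, t)) \<in> borel_measurable \<mu>" by (rule measurable_Pair2[OF h]) simp
    then have "(\<integral>t. h (s, t) \<partial>?\<nu>) = (\<integral>t. indicator ?S t *\<^sub>R h (s, t) \<partial>\<mu>)"
      using S by (subst integral_density) auto
    also have "\<dots> = (\<integral>t. h (s, t) \<partial>\<mu>)"
      using supp[of s] by (intro Bochner_Integration.integral_cong) (auto simp: indicator_def)
    finally show ?thesis .
  qed
  ultimately show ?thesis by simp
qed

lemma L2_kernelsE:
  assumes "f \<in> kernels"
  obtains K :: "nat \<Rightarrow> 'a set" where "\<forall>n. compact (K n)"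
    "\<forall>s t. f (s, t) \<noteq> 0 \<longrightarrow> s \<in> (\<Union>n. K n) \<and> t \<in> (\<Union>n. K n)"
  using assms unfolding L2_kernels_def by blast

lemma L2_kernels_measurable: "f \<in> kernels \<Longrightarrow> f \<in> borel_measurable (\<mu> \<Otimes>\<^sub>M \<mu>)"
  by (simp add: L2_kernels_def)

lemma kernel_row_measurable:
  assumes f: "f \<in> kernels"
  shows "(\<lambda>s. \<integral>\<^sup>+ t. ennreal ((cmod (f (s, t)))\<^sup>2) \<partial>\<mu>) \<in> borel_measurable \<mu>"
proof -
  obtain K :: "nat \<Rightarrow> 'a set" where K: "\<forall>n. compact (K n)"
    "\<forall>s t. f (s, t) \<noteq> 0 \<longrightarrow> s \<in> (\<Union>n. K n) \<and> t \<in> (\<Union>n. K n)"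
    by (rule L2_kernelsE[OF f])
  have "(\<lambda>p. ennreal ((cmod (f p))\<^sup>2)) \<in> borel_measurable (\<mu> \<Otimes>\<^sub>M \<mu>)"
    using L2_kernels_measurable[OF f] by measurable
  then show ?thesis
    by (rule measurable_nn_integral_section[where K = K]) (use K in auto)
qed

lemma kernel_norm_power2:
  assumes f: "f \<in> kernels"
  shows "(\<integral>\<^sup>+ s. (\<integral>\<^sup>+ t. ennreal ((cmod (f (s, t)))\<^sup>2) \<partial>\<mu>) \<partial>\<mu>) = ennreal ((hs_norm f)\<^sup>2)"
  using f by (simp add: kernel_norm_def L2_kernels_def)

lemma kernel_row_L2:
  assumes f: "f \<in> kernels"
  shows "AE s in \<mu>. (\<lambda>t. f (s, t)) \<in> L2"
proof -
  have "AE s in \<mu>. (\<integral>\<^sup>+ t. ennreal ((cmod (f (s, t)))\<^sup>2) \<partial>\<mu>) \<noteq> \<infinity>"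
    using f by (intro nn_integral_PInf_AE kernel_row_measurable) (auto simp: L2_kernels_def)
  then show ?thesis
  proof eventually_elim
    case (elim s)
    have "(\<lambda>t. f (s, t)) \<in> borel_measurable \<mu>"
      by (rule measurable_Pair2[OF L2_kernels_measurable[OF f]]) simp
    then show ?case using elim by (intro L2_spaceI) (auto simp: less_top)
  qed
qed

text \<open>
  A Hilbert-Schmidt operator is bounded by its Hilbert-Schmidt norm: the Cauchy-Schwarz inequality is
  applied in almost every row.
\<close>

lemma kernel_op_L2:
  assumes f: "f \<in> kernels" and \<xi>: "\<xi> \<in> L2"
  shows "kernel_op \<mu> f \<xi> \<in> L2"
    and "nrm (kernel_op \<mu> f \<xi>) \<le> hs_norm f * nrm \<xi>"
proof -
  obtain K :: "nat \<Rightarrow> 'a set" where K: "\<forall>n. compact (K n)"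
    "\<forall>s t. f (s, t) \<noteq> 0 \<longrightarrow> s \<in> (\<Union>n. K n) \<and> t \<in> (\<Union>n. K n)"
    by (rule L2_kernelsE[OF f])
  have [measurable]: "\<xi> \<in> borel_measurable \<mu>" "f \<in> borel_measurable (\<mu> \<Otimes>\<^sub>M \<mu>)"
    using L2_spaceD(1)[OF \<xi>] L2_kernels_measurable[OF f] by auto
  have "(\<lambda>p. f p * \<xi> (snd p)) \<in> borel_measurable (\<mu> \<Otimes>\<^sub>M \<mu>)" by measurable
  then have "(\<lambda>s. \<integral>t. f (s, t) * \<xi> (snd (s, t)) \<partial>\<mu>) \<in> borel_measurable \<mu>"
    by (rule measurable_integral_section[where K = K]) (use K in auto)
  then have meas: "kernel_op \<mu> f \<xi> \<in> borel_measurable \<mu>"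
    by (simp add: kernel_op_def)
  have "AE s in \<mu>. ennreal ((cmod (kernel_op \<mu> f \<xi> s))\<^sup>2)
      \<le> (\<integral>\<^sup>+ t. ennreal ((cmod (f (s, t)))\<^sup>2) \<partial>\<mu>) * ennreal ((nrm \<xi>)\<^sup>2)"
    using kernel_row_L2[OF f]
  proof eventually_elim
    case (elim s)
    have "(cmod (kernel_op \<mu> f \<xi> s))\<^sup>2 \<le> (nrm (\<lambda>t. f (s, t)))\<^sup>2 * (nrm \<xi>)\<^sup>2"
      unfolding kernel_op_def power_mult_distrib[symmetric]
      by (intro power_mono L2_Cauchy_Schwarz(2)[OF elim \<xi>]) simp
    then show ?case
      unfolding nn_integral_L2[OF elim] by (simp add: ennreal_mult[symmetric] ennreal_leI)
  qed
  then have "(\<integral>\<^sup>+s. ennreal ((cmod (kernel_op \<mu> f \<xi> s))\<^sup>2) \<partial>\<mu>)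
      \<le> (\<integral>\<^sup>+s. (\<integral>\<^sup>+ t. ennreal ((cmod (f (s, t)))\<^sup>2) \<partial>\<mu>) * ennreal ((nrm \<xi>)\<^sup>2) \<partial>\<mu>)"
    by (rule nn_integral_mono_AE)
  also have "\<dots> = ennreal ((hs_norm f)\<^sup>2) * ennreal ((nrm \<xi>)\<^sup>2)"
    using kernel_row_measurable[OF f] by (simp add: nn_integral_multc kernel_norm_power2[OF f])
  finally have le: "(\<integral>\<^sup>+s. ennreal ((cmod (kernel_op \<mu> f \<xi> s))\<^sup>2) \<partial>\<mu>) \<le> ennreal ((hs_norm f * nrm \<xi>)\<^sup>2)"
    by (simp add: power_mult_distrib ennreal_mult)
  show L2: "kernel_op \<mu> f \<xi> \<in> L2"
    using le by (intro L2_spaceI[OF meas]) (auto intro: le_less_trans)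
  have "(nrm (kernel_op \<mu> f \<xi>))\<^sup>2 \<le> (hs_norm f * nrm \<xi>)\<^sup>2"
    using le unfolding nn_integral_L2[OF L2] by (simp add: ennreal_le_iff)
  then show "nrm (kernel_op \<mu> f \<xi>) \<le> hs_norm f * nrm \<xi>"
    by (rule power2_le_imp_le) simp
qed

lemma kernel_dominated:
  assumes f: "f \<in> kernels" and g: "g \<in> borel_measurable (\<mu> \<Otimes>\<^sub>M \<mu>)"
    and c: "0 \<le> c" and le: "\<And>p. cmod (g p) \<le> c * cmod (f p)"
  shows "g \<in> kernels" "hs_norm g \<le> c * hs_norm f"
proof -
  have g0: "g p = 0" if "f p = 0" for p
    using le[of p] that by simp
  have le2: "ennreal ((cmod (g p))\<^sup>2) \<le> ennreal (c\<^sup>2) * ennreal ((cmod (f p))\<^sup>2)" for p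
    using power_mono[OF le[of p], of 2] c
    by (simp add: ennreal_mult[symmetric] power_mult_distrib ennreal_leI)
  have row: "(\<integral>\<^sup>+ t. ennreal ((cmod (g (s, t)))\<^sup>2) \<partial>\<mu>) \<le> ennreal (c\<^sup>2) * (\<integral>\<^sup>+ t. ennreal ((cmod (f (s, t)))\<^sup>2) \<partial>\<mu>)" for s
  proof -
    have "(\<lambda>t. f (s, t)) \<in> borel_measurable \<mu>"
      by (rule measurable_Pair2[OF L2_kernels_measurable[OF f]]) simp
    then have "(\<integral>\<^sup>+ t. ennreal (c\<^sup>2) * ennreal ((cmod (f (s, t)))\<^sup>2) \<partial>\<mu>)
        = ennreal (c\<^sup>2) * (\<integral>\<^sup>+ t. ennreal ((cmod (f (s, t)))\<^sup>2) \<partial>\<mu>)"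
      by (intro nn_integral_cmult) measurable
    moreover have "(\<integral>\<^sup>+ t. ennreal ((cmod (g (s, t)))\<^sup>2) \<partial>\<mu>)
        \<le> (\<integral>\<^sup>+ t. ennreal (c\<^sup>2) * ennreal ((cmod (f (s, t)))\<^sup>2) \<partial>\<mu>)"
      by (intro nn_integral_mono le2)
    ultimately show ?thesis by simp
  qed
  have "(\<integral>\<^sup>+ s. (\<integral>\<^sup>+ t. ennreal ((cmod (g (s, t)))\<^sup>2) \<partial>\<mu>) \<partial>\<mu>)
      \<le> (\<integral>\<^sup>+ s. ennreal (c\<^sup>2) * (\<integral>\<^sup>+ t. ennreal ((cmod (f (s, t)))\<^sup>2) \<partial>\<mu>) \<partial>\<mu>)"
    by (intro nn_integral_mono row)
  also have "\<dots> = ennreal (c\<^sup>2) * ennreal ((hs_norm f)\<^sup>2)"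
    using kernel_row_measurable[OF f] by (simp add: nn_integral_cmult kernel_norm_power2[OF f])
  finally have fin: "(\<integral>\<^sup>+ s. (\<integral>\<^sup>+ t. ennreal ((cmod (g (s, t)))\<^sup>2) \<partial>\<mu>) \<partial>\<mu>) \<le> ennreal ((c * hs_norm f)\<^sup>2)"
    by (simp add: power_mult_distrib ennreal_mult)
  obtain K :: "nat \<Rightarrow> 'a set" where K: "\<forall>n. compact (K n)"
    "\<forall>s t. f (s, t) \<noteq> 0 \<longrightarrow> s \<in> (\<Union>n. K n) \<and> t \<in> (\<Union>n. K n)"
    by (rule L2_kernelsE[OF f])
  have "\<forall>s t. g (s, t) \<noteq> 0 \<longrightarrow> s \<in> (\<Union>n. K n) \<and> t \<in> (\<Union>n. K n)"
    using K(2) g0 by blast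
  then show G: "g \<in> kernels"
    unfolding L2_kernels_def using g K(1) le_less_trans[OF fin, of \<infinity>] by auto
  have "(hs_norm g)\<^sup>2 \<le> (c * hs_norm f)\<^sup>2"
    using fin unfolding kernel_norm_power2[OF G] by (simp add: ennreal_le_iff)
  then show "hs_norm g \<le> c * hs_norm f"
    by (rule power2_le_imp_le) (simp add: c)
qed

end

section \<open>The bilinear form of a kernel and its block decompositions\<close>

lemma sum_indicator_disjoint:
  fixes g :: "'i \<Rightarrow> complex"
  assumes I: "finite I" and R: "disjoint_family_on R I" and j: "j \<in> I" "z \<in> R j"
  shows "(\<Sum>i\<in>I. indicator (R i) z * g i) = g j"
proof -
  have "indicator (R i) z * g i = (if i = j then g j else 0)" if "i \<in> I" for i
    using R j that unfolding disjoint_family_on_def by (cases "z \<in> R i") auto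
  then have "(\<Sum>i\<in>I. indicator (R i) z * g i) = (\<Sum>i\<in>I. if i = j then g j else 0)"
    by (rule sum.cong[OF refl])
  then show ?thesis using I j(1) by simp
qed

lemma sum_indicator_outside:
  fixes g :: "'i \<Rightarrow> complex"
  assumes "z \<notin> (\<Union>i\<in>I. R i)"
  shows "(\<Sum>i\<in>I. indicator (R i) z * g i) = 0"
  using assms by (intro sum.neutral) (auto simp: indicator_def)

lemma disjoint_family_on_rectangles:
  assumes "disjoint_family_on E A"
  shows "disjoint_family_on (\<lambda>i. E (fst i) \<times> E (snd i)) (A \<times> A)"
  using assms unfolding disjoint_family_on_def by (auto simp: prod_eq_iff)

context compact_finite_measure
begin

lemma kernel_row_integrable:
  assumes f: "f \<in> kernels" and \<xi>: "\<xi> \<in> L2"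
  shows "AE s in \<mu>. integrable \<mu> (\<lambda>t. f (s, t) * \<xi> t)"
  using kernel_row_L2[OF f] by eventually_elim (rule L2_Cauchy_Schwarz(1)[OF _ \<xi>])

lemma kernel_pairing_integrable:
  assumes "f \<in> kernels" "\<eta> \<in> L2" "\<xi> \<in> L2"
  shows "integrable \<mu> (\<lambda>s. \<eta> s * kernel_op \<mu> f \<xi> s)"
  by (rule L2_Cauchy_Schwarz(1)[OF assms(2) kernel_op_L2(1)[OF assms(1,3)]])

lemma kernel_pairing_le:
  assumes "f \<in> kernels" "\<eta> \<in> L2" "\<xi> \<in> L2"
  shows "cmod (pairing f \<eta> \<xi>) \<le> nrm \<eta> * nrm (kernel_op \<mu> f \<xi>)"
  unfolding kernel_pairing_def
  by (rule L2_Cauchy_Schwarz(2)[OF assms(2) kernel_op_L2(1)[OF assms(1,3)]])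

lemma kernel_pairing_le_kernel_norm:
  assumes "f \<in> kernels" "\<eta> \<in> L2" "\<xi> \<in> L2"
  shows "cmod (pairing f \<eta> \<xi>) \<le> hs_norm f * nrm \<eta> * nrm \<xi>"
  using order_trans[OF kernel_pairing_le[OF assms] mult_left_mono[OF kernel_op_L2(2)[OF assms(1,3)] L2_norm_nonneg]]
  by (simp add: mult_ac)

lemma kernel_pairing_cmult_kernel: "pairing (\<lambda>p. c * f p) \<eta> \<xi> = c * pairing f \<eta> \<xi>"
  by (simp add: kernel_pairing_def kernel_op_def mult.assoc mult.left_commute[of _ c])

lemma kernel_pairing_cmult_left: "pairing f (\<lambda>s. c * \<eta> s) \<xi> = c * pairing f \<eta> \<xi>"
  by (simp add: kernel_pairing_def mult.assoc)

lemma kernel_pairing_cmult_right: "pairing f \<eta> (\<lambda>t. c * \<xi> t) = c * pairing f \<eta> \<xi>"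
  by (simp add: kernel_pairing_def kernel_op_def mult.left_commute[of _ c])

lemma kernel_pairing_sum_kernel:
  assumes I: "finite I" and g: "\<And>i. i \<in> I \<Longrightarrow> g i \<in> kernels"
    and G: "(\<lambda>p. \<Sum>i\<in>I. g i p) \<in> kernels" and \<eta>: "\<eta> \<in> L2" and \<xi>: "\<xi> \<in> L2"
  shows "pairing (\<lambda>p. \<Sum>i\<in>I. g i p) \<eta> \<xi> = (\<Sum>i\<in>I. pairing (g i) \<eta> \<xi>)"
proof -
  have "AE s in \<mu>. \<forall>i\<in>I. integrable \<mu> (\<lambda>t. g i (s, t) * \<xi> t)"
    using kernel_row_integrable[OF g \<xi>] by (intro AE_finite_allI[OF I])
  then have "AE s in \<mu>. \<eta> s * kernel_op \<mu> (\<lambda>p. \<Sum>i\<in>I. g i p) \<xi> s = (\<Sum>i\<in>I. \<eta> s * kernel_op \<mu> (g i) \<xi> s)"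
    by eventually_elim (simp add: kernel_op_def sum_distrib_right sum_distrib_left[symmetric] Bochner_Integration.integral_sum)
  then have "pairing (\<lambda>p. \<Sum>i\<in>I. g i p) \<eta> \<xi> = (\<integral>s. (\<Sum>i\<in>I. \<eta> s * kernel_op \<mu> (g i) \<xi> s) \<partial>\<mu>)"
    unfolding kernel_pairing_def
    using kernel_pairing_integrable[OF G \<eta> \<xi>] kernel_pairing_integrable[OF g \<eta> \<xi>]
    by (intro integral_cong_AE) (auto intro!: borel_measurable_sum)
  also have "\<dots> = (\<Sum>i\<in>I. pairing (g i) \<eta> \<xi>)"
    unfolding kernel_pairing_def
    by (rule Bochner_Integration.integral_sum) (rule kernel_pairing_integrable[OF g \<eta> \<xi>])
  finally show ?thesis .
qed

lemma kernel_pairing_diff_kernel: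
  assumes f: "f \<in> kernels" and g: "g \<in> kernels" and fg: "(\<lambda>p. f p - g p) \<in> kernels"
    and \<eta>: "\<eta> \<in> L2" and \<xi>: "\<xi> \<in> L2"
  shows "pairing (\<lambda>p. f p - g p) \<eta> \<xi> = pairing f \<eta> \<xi> - pairing g \<eta> \<xi>"
proof -
  have "pairing f \<eta> \<xi> = pairing (\<lambda>p. \<Sum>b\<in>UNIV. (if b then \<lambda>p. f p - g p else g) p) \<eta> \<xi>"
    by (simp add: UNIV_bool)
  also have "\<dots> = (\<Sum>b\<in>UNIV. pairing (if b then \<lambda>p. f p - g p else g) \<eta> \<xi>)"
    by (rule kernel_pairing_sum_kernel[OF _ _ _ \<eta> \<xi>]) (use f g fg in \<open>simp_all add: UNIV_bool\<close>)
  finally show ?thesis by (simp add: UNIV_bool)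
qed

lemma kernel_pairing_sum_right:
  assumes I: "finite I" and f: "f \<in> kernels" and \<eta>: "\<eta> \<in> L2"
    and \<xi>: "\<And>i. i \<in> I \<Longrightarrow> \<xi> i \<in> L2"
  shows "pairing f \<eta> (\<lambda>t. \<Sum>i\<in>I. \<xi> i t) = (\<Sum>i\<in>I. pairing f \<eta> (\<xi> i))"
proof -
  have "AE s in \<mu>. \<forall>i\<in>I. integrable \<mu> (\<lambda>t. f (s, t) * \<xi> i t)"
    using kernel_row_integrable[OF f \<xi>] by (intro AE_finite_allI[OF I])
  then have "AE s in \<mu>. \<eta> s * kernel_op \<mu> f (\<lambda>t. \<Sum>i\<in>I. \<xi> i t) s = (\<Sum>i\<in>I. \<eta> s * kernel_op \<mu> f (\<xi> i) s)"
  proof eventually_elim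
    case (elim s)
    have "(\<integral>t. f (s, t) * (\<Sum>i\<in>I. \<xi> i t) \<partial>\<mu>) = (\<Sum>i\<in>I. \<integral>t. f (s, t) * \<xi> i t \<partial>\<mu>)"
      unfolding sum_distrib_left by (rule Bochner_Integration.integral_sum) (use elim in blast)
    then show ?case by (simp add: kernel_op_def sum_distrib_left)
  qed
  then have "pairing f \<eta> (\<lambda>t. \<Sum>i\<in>I. \<xi> i t) = (\<integral>s. (\<Sum>i\<in>I. \<eta> s * kernel_op \<mu> f (\<xi> i) s) \<partial>\<mu>)"
    unfolding kernel_pairing_def
    using kernel_pairing_integrable[OF f \<eta> L2_space_sum[of I \<xi>, OF \<xi>]] kernel_pairing_integrable[OF f \<eta> \<xi>]
    by (intro integral_cong_AE) (auto intro!: borel_measurable_sum)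
  also have "\<dots> = (\<Sum>i\<in>I. pairing f \<eta> (\<xi> i))"
    unfolding kernel_pairing_def
    by (rule Bochner_Integration.integral_sum) (rule kernel_pairing_integrable[OF f \<eta> \<xi>])
  finally show ?thesis .
qed

lemma kernel_pairing_sum_left:
  assumes f: "f \<in> kernels" and \<eta>: "\<And>i. i \<in> I \<Longrightarrow> \<eta> i \<in> L2" and \<xi>: "\<xi> \<in> L2"
  shows "pairing f (\<lambda>s. \<Sum>i\<in>I. \<eta> i s) \<xi> = (\<Sum>i\<in>I. pairing f (\<eta> i) \<xi>)"
  unfolding kernel_pairing_def sum_distrib_right
  by (rule Bochner_Integration.integral_sum) (rule kernel_pairing_integrable[OF f \<eta> \<xi>])

lemma kernel_pairing_add_right:
  assumes f: "f \<in> kernels" and \<eta>: "\<eta> \<in> L2" and \<xi>: "\<xi> \<in> L2" "\<zeta> \<in> L2"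
  shows "pairing f \<eta> (\<lambda>t. \<xi> t + \<zeta> t) = pairing f \<eta> \<xi> + pairing f \<eta> \<zeta>"
  using kernel_pairing_sum_right[of UNIV f \<eta> "\<lambda>b. if b then \<xi> else \<zeta>", OF _ f \<eta>] \<xi>
  by (simp add: UNIV_bool add.commute)

lemma kernel_pairing_add_left:
  assumes f: "f \<in> kernels" and \<eta>: "\<eta> \<in> L2" "\<zeta> \<in> L2" and \<xi>: "\<xi> \<in> L2"
  shows "pairing f (\<lambda>t. \<eta> t + \<zeta> t) \<xi> = pairing f \<eta> \<xi> + pairing f \<zeta> \<xi>"
  using kernel_pairing_sum_left[of f UNIV "\<lambda>b. if b then \<eta> else \<zeta>" \<xi>, OF f _ \<xi>] \<eta>
  by (simp add: UNIV_bool add.commute)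

text \<open>
  Take for \<open>\<eta>\<close> the complex conjugate of \<open>kernel_op \<mu> f \<xi>\<close>.
\<close>

lemma kernel_op_norm_le_dual:
  assumes f: "f \<in> kernels" and \<xi>: "\<xi> \<in> L2"
    and c0: "0 \<le> c" and c: "\<And>\<eta>. \<eta> \<in> L2 \<Longrightarrow> cmod (pairing f \<eta> \<xi>) \<le> c * nrm \<eta>"
  shows "nrm (kernel_op \<mu> f \<xi>) \<le> c"
proof -
  let ?\<zeta> = "kernel_op \<mu> f \<xi>" and ?\<eta> = "\<lambda>s. cnj (kernel_op \<mu> f \<xi> s)"
  have \<zeta>: "?\<zeta> \<in> L2" by (rule kernel_op_L2(1)[OF f \<xi>])
  have \<eta>: "?\<eta> \<in> L2" "nrm ?\<eta> = nrm ?\<zeta>"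
    using \<zeta> borel_measurable_continuous_on[OF continuous_on_cnj[OF continuous_on_id] L2_spaceD(1)[OF \<zeta>]]
    by (auto simp: L2_space_def L2_norm_def)
  have "pairing f ?\<eta> \<xi> = (\<integral>s. complex_of_real ((cmod (?\<zeta> s))\<^sup>2) \<partial>\<mu>)"
    unfolding kernel_pairing_def
    by (intro Bochner_Integration.integral_cong refl) (subst complex_norm_square, simp add: mult.commute)
  also have "\<dots> = complex_of_real ((nrm ?\<zeta>)\<^sup>2)"
    by (simp add: L2_norm_power2 del: of_real_power)
  finally have "(nrm ?\<zeta>)\<^sup>2 \<le> c * nrm ?\<zeta>"
    using c[OF \<eta>(1)] by (simp add: \<eta>(2) norm_power)
  then show ?thesis
    using c0 by (cases "nrm ?\<zeta> = 0") (simp_all add: power2_eq_square mult_le_cancel_right_pos less_le)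
qed

lemma L2_op_norm_le:
  assumes "\<And>\<xi>. \<xi> \<in> L2 \<Longrightarrow> nrm (T \<xi>) \<le> N * nrm \<xi>" "0 \<le> N"
  shows "L2_op_norm \<mu> T \<le> N"
  unfolding L2_op_norm_def
proof (rule cSUP_least)
  have "(\<lambda>x. 0) \<in> {\<xi> \<in> L2. nrm \<xi> \<le> 1}"
    by (simp add: L2_space_zero L2_norm_def)
  then show "{\<xi> \<in> L2. nrm \<xi> \<le> 1} \<noteq> {}" by blast
  fix \<xi> assume "\<xi> \<in> {\<xi> \<in> L2. nrm \<xi> \<le> 1}"
  then show "nrm (T \<xi>) \<le> N"
    using assms(1)[of \<xi>] mult_left_mono[of "nrm \<xi>" 1 N] assms(2) by auto
qed

text \<open>
  The supremum defining the operator norm is taken over a bounded set, because of the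
  Hilbert-Schmidt bound. The case \<open>\<parallel>\<xi>\<parallel> = 0\<close>, where \<open>\<xi>\<close> cannot be normalised, is covered by that bound as well.
\<close>

lemma L2_op_norm_kernel_op:
  assumes f: "f \<in> kernels" and \<xi>: "\<xi> \<in> L2"
  shows "nrm (kernel_op \<mu> f \<xi>) \<le> op_norm f * nrm \<xi>"
    and "0 \<le> op_norm f"
proof -
  have bdd: "bdd_above ((\<lambda>\<xi>. nrm (kernel_op \<mu> f \<xi>)) ` {\<xi> \<in> L2. nrm \<xi> \<le> 1})"
  proof (rule bdd_aboveI2)
    fix \<xi> assume "\<xi> \<in> {\<xi> \<in> L2. nrm \<xi> \<le> 1}"
    then show "nrm (kernel_op \<mu> f \<xi>) \<le> hs_norm f"
      using kernel_op_L2(2)[OF f, of \<xi>] mult_left_mono[of "nrm \<xi>" 1 "hs_norm f"] by auto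
  qed
  have le: "nrm (kernel_op \<mu> f \<zeta>) \<le> op_norm f" if "\<zeta> \<in> L2" "nrm \<zeta> \<le> 1" for \<zeta>
    unfolding L2_op_norm_def using that by (intro cSUP_upper bdd) auto
  have "nrm (kernel_op \<mu> f (\<lambda>x. 0)) \<le> op_norm f"
    by (rule le) (simp_all add: L2_space_zero L2_norm_def)
  then show "0 \<le> op_norm f"
    using L2_norm_nonneg order_trans by blast
  show "nrm (kernel_op \<mu> f \<xi>) \<le> op_norm f * nrm \<xi>"
  proof (cases "nrm \<xi> = 0")
    case True
    then show ?thesis using kernel_op_L2(2)[OF f \<xi>] by simp
  next
    case False
    define c where "c = complex_of_real (1 / nrm \<xi>)"
    have c: "cmod c = 1 / nrm \<xi>" by (simp add: c_def norm_divide)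
    have "kernel_op \<mu> f (\<lambda>x. c * \<xi> x) = (\<lambda>s. c * kernel_op \<mu> f \<xi> s)"
      by (simp add: kernel_op_def mult.left_commute[of _ c])
    then have "cmod c * nrm (kernel_op \<mu> f \<xi>) \<le> op_norm f"
      using le[OF L2_space_cmult[OF \<xi>, of c]] False by (simp add: L2_norm_cmult c)
    then show ?thesis
      using False L2_norm_nonneg[of \<mu> \<xi>] by (simp add: c field_simps less_le)
  qed
qed

lemma kernel_pairing_le_op_norm:
  assumes "f \<in> kernels" "\<eta> \<in> L2" "\<xi> \<in> L2"
  shows "cmod (pairing f \<eta> \<xi>) \<le> op_norm f * nrm \<eta> * nrm \<xi>"
  using order_trans[OF kernel_pairing_le[OF assms]
      mult_left_mono[OF L2_op_norm_kernel_op(1)[OF assms(1,3)] L2_norm_nonneg]]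
  by (simp add: mult_ac)

text \<open>
  On the union of the rectangles \<open>E p \<times> E q\<close> the kernel \<open>\<phi>\<close> is within \<open>\<epsilon>\<close> of the step kernel with values
  \<open>c p q\<close>. The difference of the two multiples of \<open>f\<close> is a kernel of Hilbert-Schmidt norm at most
  \<open>\<epsilon> * hs_norm f\<close>, and the step multiple of \<open>f\<close> decomposes into scalar multiples of the
  blocks of \<open>f\<close>.
\<close>

lemma kernel_pairing_step_approx:
  assumes f: "f \<in> kernels" and \<eta>: "\<eta> \<in> L2" and \<xi>: "\<xi> \<in> L2"
    and A: "finite A" and E: "\<And>p. p \<in> A \<Longrightarrow> E p \<in> sets \<mu>" and disj: "disjoint_family_on E A"
    and \<eta>E: "\<And>s. \<eta> s \<noteq> 0 \<Longrightarrow> s \<in> (\<Union>p\<in>A. E p)" and \<xi>E: "\<And>s. \<xi> s \<noteq> 0 \<Longrightarrow> s \<in> (\<Union>p\<in>A. E p)"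
    and \<phi>f: "(\<lambda>p. \<phi> p * f p) \<in> kernels" and \<epsilon>: "0 \<le> \<epsilon>"
    and osc: "\<And>p q s t. p \<in> A \<Longrightarrow> q \<in> A \<Longrightarrow> s \<in> E p \<Longrightarrow> t \<in> E q \<Longrightarrow> cmod (\<phi> (s, t) - c p q) \<le> \<epsilon>"
  shows "cmod (pairing (\<lambda>p. \<phi> p * f p) \<eta> \<xi>
      - (\<Sum>p\<in>A. \<Sum>q\<in>A. c p q * pairing f (\<lambda>s. indicator (E p) s * \<eta> s) (\<lambda>t. indicator (E q) t * \<xi> t)))
    \<le> \<epsilon> * hs_norm f * nrm \<eta> * nrm \<xi>"
proof -
  note [measurable] = L2_kernels_measurable[OF f] L2_kernels_measurable[OF \<phi>f]
  let ?I = "A \<times> A"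
  define R where "R i = E (fst i) \<times> E (snd i)" for i
  define c' where "c' i = c (fst i) (snd i)" for i
  have R[measurable]: "R i \<in> sets (\<mu> \<Otimes>\<^sub>M \<mu>)" if "i \<in> ?I" for i
    using E that by (auto simp: R_def)
  have I: "finite ?I" using A by simp
  have Rdisj: "disjoint_family_on R ?I"
    unfolding R_def using disj by (rule disjoint_family_on_rectangles)
  note ptR = sum_indicator_disjoint[OF I Rdisj] and ptR0 = sum_indicator_outside[of _ R ?I]
  \<comment> \<open>The error kernel, cut off outside the union of the rectangles, where nothing is known about \<open>\<phi>\<close>.\<close>
  define d where "d z = (\<Sum>i\<in>?I. indicator (R i) z * ((\<phi> z - c' i) * f z))" for z
  have d_le: "cmod (d z) \<le> \<epsilon> * cmod (f z)" for z
  proof (cases "z \<in> (\<Union>i\<in>?I. R i)")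
    case True
    then obtain i where i: "i \<in> ?I" "z \<in> R i" by blast
    have "cmod (\<phi> z - c' i) \<le> \<epsilon>"
      using osc[of "fst i" "snd i" "fst z" "snd z"] i by (auto simp: R_def c'_def mem_Times_iff)
    then show ?thesis
      unfolding d_def ptR[OF i] norm_mult by (intro mult_right_mono) auto
  qed (simp add: d_def ptR0 \<epsilon>)
  have ind_meas: "(\<lambda>z. indicator (R i) z * (\<phi> z * f z)) \<in> borel_measurable (\<mu> \<Otimes>\<^sub>M \<mu>)"
    "(\<lambda>z. indicator (R i) z * f z) \<in> borel_measurable (\<mu> \<Otimes>\<^sub>M \<mu>)" if "i \<in> ?I" for i
    using R[OF that] by measurable
  have ind: "(\<lambda>z. indicator (R i) z * (\<phi> z * f z)) \<in> kernels" "(\<lambda>z. indicator (R i) z * f z) \<in> kernels"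
    if "i \<in> ?I" for i
    by (rule kernel_dominated(1)[OF \<phi>f ind_meas(1)[OF that], of 1]; simp add: indicator_def)
      (rule kernel_dominated(1)[OF f ind_meas(2)[OF that], of 1]; simp add: indicator_def)
  have d_meas: "d \<in> borel_measurable (\<mu> \<Otimes>\<^sub>M \<mu>)"
  proof -
    have "(\<lambda>z. indicator (R i) z * (\<phi> z * f z) - c' i * (indicator (R i) z * f z)) \<in> borel_measurable (\<mu> \<Otimes>\<^sub>M \<mu>)"
      if "i \<in> ?I" for i
      using ind_meas[OF that] by measurable
    moreover have "d = (\<lambda>z. \<Sum>i\<in>?I. indicator (R i) z * (\<phi> z * f z) - c' i * (indicator (R i) z * f z))"
      by (simp add: d_def fun_eq_iff algebra_simps)
    ultimately show ?thesis by (auto intro: borel_measurable_sum)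
  qed
  have d: "d \<in> kernels" "hs_norm d \<le> \<epsilon> * hs_norm f"
    using kernel_dominated[OF f d_meas \<epsilon> d_le] by auto
  have piece: "pairing (\<lambda>z. indicator (R i) z * g z) \<eta> \<xi>
      = pairing g (\<lambda>s. indicator (E (fst i)) s * \<eta> s) (\<lambda>t. indicator (E (snd i)) t * \<xi> t)" for i g
    unfolding kernel_pairing_def kernel_op_def R_def
    by (intro Bochner_Integration.integral_cong refl) (auto simp: indicator_times mult_ac indicator_def)
  have whole: "pairing (\<lambda>z. \<phi> z * f z) \<eta> \<xi> = pairing (\<lambda>z. \<Sum>i\<in>?I. indicator (R i) z * (\<phi> z * f z)) \<eta> \<xi>"
  proof -
    have pt: "\<eta> s * (\<phi> (s, t) * f (s, t) * \<xi> t) = \<eta> s * ((\<Sum>i\<in>?I. indicator (R i) (s, t) * (\<phi> (s, t) * f (s, t))) * \<xi> t)" for s t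
    proof (cases "\<eta> s = 0 \<or> \<xi> t = 0")
      case False
      then obtain p q where "p \<in> A" "s \<in> E p" "q \<in> A" "t \<in> E q" using \<eta>E[of s] \<xi>E[of t] by blast
      then have "(p, q) \<in> ?I" "(s, t) \<in> R (p, q)" by (auto simp: R_def)
      from ptR[OF this] show ?thesis by simp
    qed auto
    show ?thesis
      unfolding kernel_pairing_def kernel_op_def by (simp only: integral_mult_right_zero[symmetric] pt)
  qed
  have sum_in: "(\<lambda>z. \<Sum>i\<in>?I. indicator (R i) z * (\<phi> z * f z)) \<in> kernels"
  proof (rule kernel_dominated(1)[OF \<phi>f, where c = 1])
    show "(\<lambda>z. \<Sum>i\<in>?I. indicator (R i) z * (\<phi> z * f z)) \<in> borel_measurable (\<mu> \<Otimes>\<^sub>M \<mu>)"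
      by (intro borel_measurable_sum ind_meas)
    show "cmod (\<Sum>i\<in>?I. indicator (R i) z * (\<phi> z * f z)) \<le> 1 * cmod (\<phi> z * f z)" for z
    proof (cases "z \<in> (\<Union>i\<in>?I. R i)")
      case True
      then obtain i where i: "i \<in> ?I" "z \<in> R i" by blast
      show ?thesis unfolding ptR[OF i] by simp
    qed (simp add: ptR0)
  qed simp
  have err_in: "(\<lambda>z. indicator (R i) z * ((\<phi> z - c' i) * f z)) \<in> kernels" if i: "i \<in> ?I" for i
  proof -
    have "(\<lambda>z. indicator (R i) z * (\<phi> z * f z) - c' i * (indicator (R i) z * f z)) \<in> borel_measurable (\<mu> \<Otimes>\<^sub>M \<mu>)"
      using ind_meas[OF i] by measurable
    then have "(\<lambda>z. indicator (R i) z * ((\<phi> z - c' i) * f z)) \<in> borel_measurable (\<mu> \<Otimes>\<^sub>M \<mu>)"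
      by (simp add: algebra_simps)
    then show ?thesis
    proof (rule kernel_dominated(1)[OF f _ \<epsilon>])
      fix z show "cmod (indicator (R i) z * ((\<phi> z - c' i) * f z)) \<le> \<epsilon> * cmod (f z)"
        using osc[of "fst i" "snd i" "fst z" "snd z"] i \<epsilon>
        by (auto simp: R_def c'_def mem_Times_iff indicator_def norm_mult intro!: mult_right_mono)
    qed
  qed
  have "pairing d \<eta> \<xi> = (\<Sum>i\<in>?I. pairing (\<lambda>z. indicator (R i) z * ((\<phi> z - c' i) * f z)) \<eta> \<xi>)"
    unfolding d_def
    by (rule kernel_pairing_sum_kernel[OF I err_in _ \<eta> \<xi>]) (use d(1) in \<open>simp_all add: d_def[abs_def]\<close>)
  also have "\<dots> = (\<Sum>i\<in>?I. pairing (\<lambda>z. indicator (R i) z * (\<phi> z * f z)) \<eta> \<xi>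
      - c' i * pairing (\<lambda>z. indicator (R i) z * f z) \<eta> \<xi>)"
  proof (rule sum.cong[OF refl])
    fix i assume i: "i \<in> ?I"
    have cm: "(\<lambda>z. c' i * (indicator (R i) z * f z)) \<in> kernels"
      by (rule kernel_dominated(1)[OF ind(2)[OF i], where c = "cmod (c' i)"])
        (use ind_meas(2)[OF i] in \<open>auto simp: norm_mult\<close>)
    have "pairing (\<lambda>z. indicator (R i) z * (\<phi> z * f z) - c' i * (indicator (R i) z * f z)) \<eta> \<xi>
      = pairing (\<lambda>z. indicator (R i) z * (\<phi> z * f z)) \<eta> \<xi>
        - pairing (\<lambda>z. c' i * (indicator (R i) z * f z)) \<eta> \<xi>"
      by (rule kernel_pairing_diff_kernel[OF ind(1)[OF i] cm _ \<eta> \<xi>])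
        (use err_in[OF i] in \<open>simp add: algebra_simps\<close>)
    then show "pairing (\<lambda>z. indicator (R i) z * ((\<phi> z - c' i) * f z)) \<eta> \<xi>
      = pairing (\<lambda>z. indicator (R i) z * (\<phi> z * f z)) \<eta> \<xi>
        - c' i * pairing (\<lambda>z. indicator (R i) z * f z) \<eta> \<xi>"
      by (simp add: kernel_pairing_cmult_kernel algebra_simps)
  qed
  also have "\<dots> = pairing (\<lambda>z. \<phi> z * f z) \<eta> \<xi>
      - (\<Sum>i\<in>?I. c' i * pairing f (\<lambda>s. indicator (E (fst i)) s * \<eta> s) (\<lambda>t. indicator (E (snd i)) t * \<xi> t))"
    unfolding whole
    by (subst kernel_pairing_sum_kernel[OF I ind(1) sum_in \<eta> \<xi>]) (simp_all add: sum_subtractf piece)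
  also have "(\<Sum>i\<in>?I. c' i * pairing f (\<lambda>s. indicator (E (fst i)) s * \<eta> s) (\<lambda>t. indicator (E (snd i)) t * \<xi> t))
      = (\<Sum>p\<in>A. \<Sum>q\<in>A. c p q * pairing f (\<lambda>s. indicator (E p) s * \<eta> s) (\<lambda>t. indicator (E q) t * \<xi> t))"
    by (simp add: c'_def sum.cartesian_product split_beta)
  finally have "pairing (\<lambda>z. \<phi> z * f z) \<eta> \<xi>
      - (\<Sum>p\<in>A. \<Sum>q\<in>A. c p q * pairing f (\<lambda>s. indicator (E p) s * \<eta> s) (\<lambda>t. indicator (E q) t * \<xi> t))
      = pairing d \<eta> \<xi>" by simp
  moreover have "cmod (pairing d \<eta> \<xi>) \<le> \<epsilon> * hs_norm f * nrm \<eta> * nrm \<xi>"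
    by (rule order_trans[OF kernel_pairing_le_kernel_norm[OF d(1) \<eta> \<xi>]])
      (intro mult_right_mono d(2) L2_norm_nonneg)
  ultimately show ?thesis by simp
qed

end

section \<open>From finite matrices to operators\<close>

text \<open>
  Cover \<open>K \<times> K\<close> by finitely many open rectangles on which \<open>\<phi>\<close> oscillates by at most \<open>\<epsilon>\<close>, and divide \<open>K\<close>
  into the atoms of the finite algebra generated by the sides of all rectangles. A product of two
  atoms that meets a rectangle is contained in it. Each atom is indexed by one of its points.
\<close>

lemma oscillation_partition:
  fixes \<phi> :: "'a::t2_space \<times> 'a \<Rightarrow> complex"
  assumes \<phi>: "continuous_on UNIV \<phi>" and K: "compact K" and \<epsilon>: "0 < \<epsilon>"
  obtains A E where "finite A" "\<forall>p\<in>A. E p \<in> sets borel" "disjoint_family_on E A" "(\<Union>p\<in>A. E p) = K"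
    "\<forall>p\<in>A. \<forall>q\<in>A. \<forall>s\<in>E p. \<forall>t\<in>E q. cmod (\<phi> (s, t) - \<phi> (p, q)) \<le> \<epsilon>"
proof -
  define \<R> where "\<R> = {i. open (fst i) \<and> open (snd i) \<and>
    (\<forall>y\<in>fst i \<times> snd i. \<forall>z\<in>fst i \<times> snd i. cmod (\<phi> y - \<phi> z) \<le> \<epsilon>)}"
  have cover: "K \<times> K \<subseteq> (\<Union>i\<in>\<R>. fst i \<times> snd i)"
  proof
    fix z assume "z \<in> K \<times> K"
    have "open (\<phi> -` ball (\<phi> z) (\<epsilon> / 2))"
      by (rule open_vimage[OF open_ball \<phi>])
    moreover have "z \<in> \<phi> -` ball (\<phi> z) (\<epsilon> / 2)" using \<epsilon> by simp
    ultimately obtain U V where UV: "open U" "open V" "z \<in> U \<times> V" "U \<times> V \<subseteq> \<phi> -` ball (\<phi> z) (\<epsilon> / 2)"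
      by (rule open_prod_elim)
    have "cmod (\<phi> x - \<phi> y) \<le> \<epsilon>" if "x \<in> U \<times> V" "y \<in> U \<times> V" for x y
    proof -
      have "dist (\<phi> z) (\<phi> x) < \<epsilon> / 2" "dist (\<phi> z) (\<phi> y) < \<epsilon> / 2"
        using UV(4) that by auto
      then have "dist (\<phi> x) (\<phi> y) < \<epsilon>" by (metis dist_commute dist_triangle_half_r)
      then show ?thesis by (simp add: dist_norm)
    qed
    then have "(U, V) \<in> \<R>" using UV by (auto simp: \<R>_def)
    then show "z \<in> (\<Union>i\<in>\<R>. fst i \<times> snd i)" using UV(3) by (intro UN_I) auto
  qed
  obtain R where R: "R \<subseteq> \<R>" "finite R" "K \<times> K \<subseteq> (\<Union>i\<in>R. fst i \<times> snd i)"
    by (rule compactE_image[OF compact_Times[OF K K] _ cover]) (auto simp: \<R>_def intro: open_Times)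
  \<comment> \<open>Two points have the same value of \<open>c\<close> iff they lie in the same atom.\<close>
  define c where "c x = ({i\<in>R. x \<in> fst i}, {i\<in>R. x \<in> snd i})" for x
  define rep where "rep v = (SOME x. x \<in> K \<and> c x = v)" for v
  have rep: "rep (c x) \<in> K" "c (rep (c x)) = c x" if "x \<in> K" for x
    using someI[of "\<lambda>y. y \<in> K \<and> c y = c x" x] that by (auto simp: rep_def)
  define A where "A = rep ` c ` K"
  define E where "E p = {x\<in>K. c x = c p}" for p
  have "finite (c ` K)"
    by (rule finite_subset[of _ "Pow R \<times> Pow R"]) (auto simp: c_def R(2))
  then have "finite A" by (simp add: A_def)
  moreover have "\<forall>p\<in>A. E p \<in> sets borel"
  proof
    fix p
    have o: "open (fst i)" "open (snd i)" if "i \<in> R" for i using R(1) that by (auto simp: \<R>_def)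
    have "{x \<in> space borel. \<forall>i\<in>R. (x \<in> fst i \<longleftrightarrow> p \<in> fst i) \<and> (x \<in> snd i \<longleftrightarrow> p \<in> snd i)} \<in> sets borel"
    proof (rule sets.sets_Collect_finite_All[OF _ R(2)])
      fix i assume i: "i \<in> R"
      have "{x. x \<in> fst i \<longleftrightarrow> p \<in> fst i} = (if p \<in> fst i then fst i else - fst i)"
        "{x. x \<in> snd i \<longleftrightarrow> p \<in> snd i} = (if p \<in> snd i then snd i else - snd i)" by auto
      then have "{x. x \<in> fst i \<longleftrightarrow> p \<in> fst i} \<in> sets borel" "{x. x \<in> snd i \<longleftrightarrow> p \<in> snd i} \<in> sets borel"
        using o[OF i] by (auto simp: borel_comp)
      then have "{x. x \<in> fst i \<longleftrightarrow> p \<in> fst i} \<inter> {x. x \<in> snd i \<longleftrightarrow> p \<in> snd i} \<in> sets borel" by (rule sets.Int)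
      then show "{x \<in> space borel. (x \<in> fst i \<longleftrightarrow> p \<in> fst i) \<and> (x \<in> snd i \<longleftrightarrow> p \<in> snd i)} \<in> sets borel"
        by (simp add: Collect_conj_eq)
    qed
    moreover have "K \<in> sets borel" using K by (simp add: borel_closed compact_imp_closed)
    ultimately have "K \<inter> {x \<in> space borel. \<forall>i\<in>R. (x \<in> fst i \<longleftrightarrow> p \<in> fst i) \<and> (x \<in> snd i \<longleftrightarrow> p \<in> snd i)} \<in> sets borel"
      by (rule sets.Int[rotated])
    also have "K \<inter> {x \<in> space borel. \<forall>i\<in>R. (x \<in> fst i \<longleftrightarrow> p \<in> fst i) \<and> (x \<in> snd i \<longleftrightarrow> p \<in> snd i)} = E p"
      by (auto simp: E_def c_def)
    finally show "E p \<in> sets borel" .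
  qed
  moreover have "disjoint_family_on E A"
    unfolding disjoint_family_on_def A_def E_def using rep by auto
  moreover have "(\<Union>p\<in>A. E p) = K"
    using rep by (auto simp: A_def E_def)
  moreover have "\<forall>p\<in>A. \<forall>q\<in>A. \<forall>s\<in>E p. \<forall>t\<in>E q. cmod (\<phi> (s, t) - \<phi> (p, q)) \<le> \<epsilon>"
  proof (intro ballI)
    fix p q s t assume pq: "p \<in> A" "q \<in> A" and st: "s \<in> E p" "t \<in> E q"
    have "(p, q) \<in> K \<times> K" using pq rep by (auto simp: A_def)
    then obtain i where i: "i \<in> R" "p \<in> fst i" "q \<in> snd i" using R(3) by auto
    moreover have "s \<in> fst i" "t \<in> snd i"
      using st i by (auto simp: E_def c_def)
    ultimately show "cmod (\<phi> (s, t) - \<phi> (p, q)) \<le> \<epsilon>"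
      using R(1) unfolding \<R>_def by blast
  qed
  ultimately show ?thesis by (rule that)
qed

context compact_finite_measure
begin

text \<open>
  The kernel \<open>\<phi>\<close> is measurable for the Borel sets of the product, which may form a larger
  \<open>\<sigma>\<close>-algebra than the product \<open>\<sigma>\<close>-algebra. On a \<open>\<sigma>\<close>-compact set, however, it is a pointwise limit of step functions on
  measurable rectangles.
\<close>

lemma multiplier_measurable:
  assumes \<phi>: "continuous_on UNIV \<phi>" and f: "f \<in> kernels"
  shows "(\<lambda>z. \<phi> z * f z) \<in> borel_measurable (\<mu> \<Otimes>\<^sub>M \<mu>)"
proof -
  obtain K :: "nat \<Rightarrow> 'a set" where K: "\<forall>n. compact (K n)"
    "\<forall>s t. f (s, t) \<noteq> 0 \<longrightarrow> s \<in> (\<Union>n. K n) \<and> t \<in> (\<Union>n. K n)"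
    by (rule L2_kernelsE[OF f])
  define L where "L n = (\<Union>i\<le>n. K i)" for n
  have L: "compact (L n)" for n using K(1) by (auto simp: L_def)
  have "\<exists>A E. finite A \<and> (\<forall>p\<in>A. E p \<in> sets borel) \<and> disjoint_family_on E A \<and> (\<Union>p\<in>A. E p) = L n \<and>
    (\<forall>p\<in>A. \<forall>q\<in>A. \<forall>s\<in>E p. \<forall>t\<in>E q. cmod (\<phi> (s, t) - \<phi> (p, q)) \<le> inverse (real (Suc n)))" for n
    by (rule oscillation_partition[OF \<phi> L[of n], of "inverse (real (Suc n))"]) (simp, blast)
  then obtain A E where AE: "\<forall>n. finite (A n) \<and> (\<forall>p\<in>A n. E n p \<in> sets borel) \<and> disjoint_family_on (E n) (A n) \<and>
      (\<Union>p\<in>A n. E n p) = L n \<and>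
      (\<forall>p\<in>A n. \<forall>q\<in>A n. \<forall>s\<in>E n p. \<forall>t\<in>E n q. cmod (\<phi> (s, t) - \<phi> (p, q)) \<le> inverse (real (Suc n)))"
    by metis
  define R where "R n i = E n (fst i) \<times> E n (snd i)" for n and i :: "'a \<times> 'a"
  define \<psi> where "\<psi> n z = (\<Sum>i\<in>A n \<times> A n. indicator (R n i) z * \<phi> i)" for n z
  show ?thesis
  proof (rule borel_measurable_LIMSEQ_metric)
    fix n
    have "R n i \<in> sets (\<mu> \<Otimes>\<^sub>M \<mu>)" if "i \<in> A n \<times> A n" for i
      using AE that by (auto simp: R_def sets_eq)
    then have "\<psi> n \<in> borel_measurable (\<mu> \<Otimes>\<^sub>M \<mu>)"
      unfolding \<psi>_def[abs_def] by (intro borel_measurable_sum borel_measurable_times) auto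
    then show "(\<lambda>z. \<psi> n z * f z) \<in> borel_measurable (\<mu> \<Otimes>\<^sub>M \<mu>)"
      using L2_kernels_measurable[OF f] by (rule borel_measurable_times)
  next
    fix z
    show "(\<lambda>n. \<psi> n z * f z) \<longlonglongrightarrow> \<phi> z * f z"
    proof (cases "f z = 0")
      case False
      obtain s t where z: "z = (s, t)" by (cases z)
      obtain i j where ij: "s \<in> K i" "t \<in> K j" using K(2) False z by blast
      have "(\<lambda>n. \<psi> n z - \<phi> z) \<longlonglongrightarrow> 0"
      proof (rule Lim_null_comparison[OF _ LIMSEQ_inverse_real_of_nat])
        show "\<forall>\<^sub>F n in sequentially. cmod (\<psi> n z - \<phi> z) \<le> inverse (real (Suc n))"
          using eventually_ge_at_top[of "max i j"]
        proof eventually_elim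
          case (elim n)
          then have "s \<in> L n" "t \<in> L n" using ij by (auto simp: L_def)
          then obtain p q where pq: "p \<in> A n" "q \<in> A n" "s \<in> E n p" "t \<in> E n q" using AE by blast
          have "\<psi> n z = \<phi> (p, q)"
            unfolding \<psi>_def
            by (rule sum_indicator_disjoint)
              (use AE pq in \<open>auto simp: R_def[abs_def] z intro: disjoint_family_on_rectangles\<close>)
          moreover have "cmod (\<phi> (s, t) - \<phi> (p, q)) \<le> inverse (real (Suc n))" using AE pq by blast
          ultimately show ?case by (simp add: z norm_minus_commute)
        qed
      qed
      then have "(\<lambda>n. \<psi> n z) \<longlonglongrightarrow> \<phi> z" by (simp add: LIM_zero_iff)
      then show ?thesis by (intro tendsto_mult tendsto_const)
    qed simp
  qed
qed

text \<open>
  Dominated convergence for \<open>\<bar>\<xi>\<bar>\<^sup>2\<close>: every point of the union lies in \<open>L n\<close> for all large \<open>n\<close>.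
\<close>

lemma L2_norm_tail:
  assumes \<xi>: "\<xi> \<in> L2" and L: "\<And>n. L n \<in> sets \<mu>" and mono: "incseq L"
  shows "(\<lambda>n. nrm (\<lambda>x. indicator ((\<Union>n. L n) - L n) x * \<xi> x)) \<longlonglongrightarrow> 0"
proof -
  let ?S = "\<Union>n. L n"
  have S: "?S - L n \<in> sets \<mu>" for n using L by auto
  have "(\<lambda>n. \<integral>x. (cmod (indicator (?S - L n) x * \<xi> x))\<^sup>2 \<partial>\<mu>) \<longlonglongrightarrow> (\<integral>x. 0 \<partial>\<mu>)"
  proof (rule integral_dominated_convergence)
    show "(\<lambda>x. 0) \<in> borel_measurable \<mu>" by simp
    show "(\<lambda>x. (cmod (indicator (?S - L n) x * \<xi> x))\<^sup>2) \<in> borel_measurable \<mu>" for n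
      using L2_spaceD(2)[OF L2_space_indicator(1)[OF \<xi> S]] by auto
    show "integrable \<mu> (\<lambda>x. (cmod (\<xi> x))\<^sup>2)" by (rule L2_spaceD(2)[OF \<xi>])
    show "AE x in \<mu>. (\<lambda>n. (cmod (indicator (?S - L n) x * \<xi> x))\<^sup>2) \<longlonglongrightarrow> 0"
    proof (rule AE_I2)
      fix x
      have "\<forall>\<^sub>F n in sequentially. x \<notin> ?S - L n"
      proof (cases "x \<in> ?S")
        case True
        then obtain m where "x \<in> L m" by blast
        then show ?thesis
          using mono by (auto simp: eventually_sequentially incseq_def intro!: exI[of _ m])
      qed simp
      then show "(\<lambda>n. (cmod (indicator (?S - L n) x * \<xi> x))\<^sup>2) \<longlonglongrightarrow> 0"
        by (rule tendsto_eventually[OF eventually_mono]) simp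
    qed
    show "AE x in \<mu>. norm ((cmod (indicator (?S - L n) x * \<xi> x))\<^sup>2) \<le> (cmod (\<xi> x))\<^sup>2" for n
      by (rule AE_I2) (simp add: indicator_def)
  qed
  then have "(\<lambda>n. sqrt (\<integral>x. (cmod (indicator (?S - L n) x * \<xi> x))\<^sup>2 \<partial>\<mu>)) \<longlonglongrightarrow> sqrt 0"
    by (intro tendsto_real_sqrt) simp
  then show ?thesis by (simp add: L2_norm_def)
qed

text \<open>
  Up to an arbitrarily small error, \<open>\<phi>\<close> is constant on the products of the atoms of a partition of \<open>K\<close>. The
  blocks of \<open>f\<close> between the pieces of \<open>\<eta>\<close> and \<open>\<xi>\<close> then satisfy the hypothesis of
  \<open>finite_schur_bound_weighted\<close> with the operator norm of \<open>f\<close> as the bound.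
\<close>

lemma finite_schur_bound_compact_support:
  assumes \<phi>: "continuous_on UNIV \<phi>" and C: "finite_schur_bound (\<lambda>s t. \<phi> (s, t)) C"
    and f: "f \<in> kernels" and \<phi>f: "(\<lambda>z. \<phi> z * f z) \<in> kernels"
    and \<eta>: "\<eta> \<in> L2" and \<xi>: "\<xi> \<in> L2"
    and K: "compact K" and \<eta>K: "\<And>s. \<eta> s \<noteq> 0 \<Longrightarrow> s \<in> K" and \<xi>K: "\<And>s. \<xi> s \<noteq> 0 \<Longrightarrow> s \<in> K"
  shows "cmod (pairing (\<lambda>z. \<phi> z * f z) \<eta> \<xi>)
    \<le> C * op_norm f * nrm \<eta> * nrm \<xi>" (is "_ \<le> C * ?N * _ * _")
proof (rule field_le_epsilon)
  fix e :: real assume e: "0 < e"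
  define r where "r = hs_norm f * nrm \<eta> * nrm \<xi>"
  have r: "0 \<le> r" by (simp add: r_def)
  define \<epsilon> where "\<epsilon> = e / (r + 1)"
  have \<epsilon>: "0 < \<epsilon>" "\<epsilon> * r \<le> e" using e r by (auto simp: \<epsilon>_def field_simps)
  obtain A E where A: "finite A" and E: "\<forall>p\<in>A. E p \<in> sets borel" and disj: "disjoint_family_on E A"
    and union: "(\<Union>p\<in>A. E p) = K"
    and osc: "\<forall>p\<in>A. \<forall>q\<in>A. \<forall>s\<in>E p. \<forall>t\<in>E q. cmod (\<phi> (s, t) - \<phi> (p, q)) \<le> \<epsilon>"
    by (rule oscillation_partition[OF \<phi> K \<epsilon>(1)])
  define piece where "piece \<zeta> p = (\<lambda>s. indicator (E p) s * \<zeta> s)" for \<zeta> :: "'a \<Rightarrow> complex" and p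
  have piece: "piece \<zeta> p \<in> L2" if "\<zeta> \<in> L2" "p \<in> A" for \<zeta> p
    unfolding piece_def using that E by (intro L2_space_indicator) (auto simp: sets_eq)
  have norm_pieces: "sqrt (\<Sum>p\<in>A. (cmod (\<alpha> p))\<^sup>2 * (nrm (piece \<zeta> p))\<^sup>2) = nrm (\<lambda>x. \<Sum>p\<in>A. \<alpha> p * piece \<zeta> p x)"
    if "\<zeta> \<in> L2" for \<zeta> \<alpha>
    by (subst L2_norm_sum_disjoint[OF A piece[OF that] _ disj, symmetric])
      (auto simp: piece_def indicator_def split: if_splits)
  have sum_pieces: "(\<Sum>p\<in>A. piece \<zeta> p x) = \<zeta> x" if "\<And>s. \<zeta> s \<noteq> 0 \<Longrightarrow> s \<in> K" for \<zeta> x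
  proof (cases "x \<in> K")
    case True
    then obtain p where "p \<in> A" "x \<in> E p" using union by blast
    from sum_indicator_disjoint[OF A disj this, of "\<lambda>_. \<zeta> x"] show ?thesis by (simp add: piece_def)
  next
    case False
    then have "\<zeta> x = 0" using that by blast
    then show ?thesis by (simp add: piece_def)
  qed
  have norm_pieces1: "sqrt (\<Sum>p\<in>A. (nrm (piece \<zeta> p))\<^sup>2) = nrm \<zeta>"
    if "\<zeta> \<in> L2" "\<And>s. \<zeta> s \<noteq> 0 \<Longrightarrow> s \<in> K" for \<zeta>
    using norm_pieces[OF that(1), of "\<lambda>_. 1"] sum_pieces[OF that(2)] by simp
  let ?b = "\<lambda>p q. pairing f (piece \<eta> p) (piece \<xi> q)"
  have "cmod (\<Sum>p\<in>A. \<Sum>q\<in>A. \<phi> (p, q) * ?b p q)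
    \<le> C * ?N * sqrt (\<Sum>p\<in>A. (nrm (piece \<eta> p))\<^sup>2) * sqrt (\<Sum>q\<in>A. (nrm (piece \<xi> q))\<^sup>2)"
  proof (rule finite_schur_bound_weighted[OF C A L2_op_norm_kernel_op(2)[OF f \<xi>] L2_norm_nonneg L2_norm_nonneg])
    fix \<alpha> \<beta> :: "'a \<Rightarrow> complex"
    have in1: "(\<lambda>s. \<Sum>p\<in>A. \<alpha> p * piece \<eta> p s) \<in> L2"
      by (intro L2_space_sum L2_space_cmult piece[OF \<eta>])
    have in2: "(\<lambda>s. \<Sum>p\<in>A. \<beta> p * piece \<xi> p s) \<in> L2"
      by (intro L2_space_sum L2_space_cmult piece[OF \<xi>])
    have "pairing f (\<lambda>s. \<Sum>p\<in>A. \<alpha> p * piece \<eta> p s) (\<lambda>t. \<Sum>q\<in>A. \<beta> q * piece \<xi> q t)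
        = (\<Sum>p\<in>A. pairing f (\<lambda>s. \<alpha> p * piece \<eta> p s) (\<lambda>t. \<Sum>q\<in>A. \<beta> q * piece \<xi> q t))"
      by (rule kernel_pairing_sum_left[OF f L2_space_cmult[OF piece[OF \<eta>]] in2])
    also have "\<dots> = (\<Sum>p\<in>A. \<Sum>q\<in>A. pairing f (\<lambda>s. \<alpha> p * piece \<eta> p s) (\<lambda>t. \<beta> q * piece \<xi> q t))"
      by (rule sum.cong[OF refl], rule kernel_pairing_sum_right[OF A f])
        (simp_all add: L2_space_cmult piece \<eta> \<xi>)
    finally have "(\<Sum>p\<in>A. \<Sum>q\<in>A. ?b p q * \<alpha> p * \<beta> q)
        = pairing f (\<lambda>s. \<Sum>p\<in>A. \<alpha> p * piece \<eta> p s) (\<lambda>t. \<Sum>q\<in>A. \<beta> q * piece \<xi> q t)"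
      by (simp add: kernel_pairing_cmult_left kernel_pairing_cmult_right mult_ac)
    then show "cmod (\<Sum>p\<in>A. \<Sum>q\<in>A. ?b p q * \<alpha> p * \<beta> q)
      \<le> ?N * sqrt (\<Sum>p\<in>A. (cmod (\<alpha> p))\<^sup>2 * (nrm (piece \<eta> p))\<^sup>2)
          * sqrt (\<Sum>q\<in>A. (cmod (\<beta> q))\<^sup>2 * (nrm (piece \<xi> q))\<^sup>2)"
      unfolding norm_pieces[OF \<eta>] norm_pieces[OF \<xi>] using kernel_pairing_le_op_norm[OF f in1 in2] by simp
  qed
  then have main: "cmod (\<Sum>p\<in>A. \<Sum>q\<in>A. \<phi> (p, q) * ?b p q) \<le> C * ?N * nrm \<eta> * nrm \<xi>"
    using norm_pieces1[of \<eta>] norm_pieces1[of \<xi>] \<eta> \<xi> \<eta>K \<xi>K by simp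
  have "cmod (pairing (\<lambda>z. \<phi> z * f z) \<eta> \<xi> - (\<Sum>p\<in>A. \<Sum>q\<in>A. \<phi> (p, q) * ?b p q))
      \<le> \<epsilon> * hs_norm f * nrm \<eta> * nrm \<xi>"
    unfolding piece_def
  proof (rule kernel_pairing_step_approx[OF f \<eta> \<xi> A _ disj _ _ \<phi>f])
    show "E p \<in> sets \<mu>" if "p \<in> A" for p using E that by (simp add: sets_eq)
    show "0 \<le> \<epsilon>" using \<epsilon>(1) by simp
    show "cmod (\<phi> (s, t) - \<phi> (p, q)) \<le> \<epsilon>" if "p \<in> A" "q \<in> A" "s \<in> E p" "t \<in> E q" for p q s t
      using osc that by blast
  qed (use \<eta>K \<xi>K union in auto)
  also have "\<dots> \<le> e" using \<epsilon>(2) by (simp add: r_def mult.assoc)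
  finally show "cmod (pairing (\<lambda>z. \<phi> z * f z) \<eta> \<xi>) \<le> C * ?N * nrm \<eta> * nrm \<xi> + e"
    using main norm_triangle_sub[of "pairing (\<lambda>z. \<phi> z * f z) \<eta> \<xi>" "\<Sum>p\<in>A. \<Sum>q\<in>A. \<phi> (p, q) * ?b p q"]
    by linarith
qed

text \<open>
  The kernel \<open>f\<close> lives on the union of an increasing sequence of compact sets \<open>L n\<close>. Cutting the test functions down to
  \<open>L n\<close> reduces the claim to the case of compact support, and the parts cut off
  tend to 0 in \<open>L\<^sup>2\<close>.
\<close>

theorem finite_schur_bound_imp_schur_bound:
  assumes \<phi>: "continuous_on UNIV \<phi>" and C: "finite_schur_bound (\<lambda>s t. \<phi> (s, t)) C"
  shows "schur_bound \<mu> \<phi> C"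
  unfolding schur_bound_def
proof (intro conjI ballI)
  show C0: "0 \<le> C" by (rule finite_schur_bound_nonneg[OF C])
  fix f assume f: "f \<in> kernels"
  let ?N = "op_norm f" and ?g = "\<lambda>z. \<phi> z * f z"
  have "cmod (\<phi> z) \<le> C" for z
    using finite_schur_bound_entry[OF C, of "fst z" "snd z"] by simp
  then have g_le: "cmod (\<phi> z * f z) \<le> C * cmod (f z)" for z
    by (simp add: norm_mult mult_right_mono)
  show g: "?g \<in> kernels"
    by (rule kernel_dominated(1)[OF f multiplier_measurable[OF \<phi> f] C0 g_le])
  obtain K :: "nat \<Rightarrow> 'a set" where K: "\<forall>n. compact (K n)"
    "\<forall>s t. f (s, t) \<noteq> 0 \<longrightarrow> s \<in> (\<Union>n. K n) \<and> t \<in> (\<Union>n. K n)"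
    by (rule L2_kernelsE[OF f])
  define L where "L n = (\<Union>i\<le>n. K i)" for n
  have L: "compact (L n)" for n using K(1) by (auto simp: L_def)
  have Lmono: "incseq L" by (force simp: incseq_def L_def)
  let ?S = "\<Union>n. L n"
  have S: "?S = (\<Union>n. K n)" by (auto simp: L_def)
  have sets: "L n \<in> sets \<mu>" "?S \<in> sets \<mu>" "?S - L n \<in> sets \<mu>" for n
    using compact_sets[OF L] by auto
  have dual: "cmod (pairing ?g \<eta> \<xi>) \<le> C * ?N * nrm \<eta> * nrm \<xi>"
    if \<eta>: "\<eta> \<in> L2" and \<xi>: "\<xi> \<in> L2" for \<eta> \<xi>
  proof -
    define cut where "cut B \<zeta> = (\<lambda>x. indicator B x * \<zeta> x)" for B :: "'a set" and \<zeta> :: "'a \<Rightarrow> complex"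
    have cut: "cut B \<zeta> \<in> L2" "nrm (cut B \<zeta>) \<le> nrm \<zeta>"
      if "\<zeta> \<in> L2" "B \<in> sets \<mu>" for B \<zeta>
      unfolding cut_def by (rule L2_space_indicator[OF that])+
    define G where "G = hs_norm ?g"
    have split: "cut ?S \<zeta> = (\<lambda>x. cut (L n) \<zeta> x + cut (?S - L n) \<zeta> x)" for n \<zeta>
      by (auto simp: cut_def indicator_def fun_eq_iff)
    have pt: "\<eta> s * (\<phi> (s, t) * f (s, t) * \<xi> t) = cut ?S \<eta> s * (\<phi> (s, t) * f (s, t) * cut ?S \<xi> t)" for s t
      using K(2) by (cases "f (s, t) = 0") (auto simp: cut_def S)
    have "pairing ?g \<eta> \<xi> = pairing ?g (cut ?S \<eta>) (cut ?S \<xi>)"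
      unfolding kernel_pairing_def kernel_op_def by (simp only: integral_mult_right_zero[symmetric] pt)
    have le: "cmod (pairing ?g \<eta> \<xi>) \<le> C * ?N * nrm \<eta> * nrm \<xi>
        + (G * nrm \<eta> * nrm (cut (?S - L n) \<xi>) + G * nrm (cut (?S - L n) \<eta>) * nrm \<xi>)" for n
    proof -
      have "pairing ?g \<eta> \<xi> = pairing ?g (cut (L n) \<eta>) (cut (L n) \<xi>)
          + (pairing ?g (cut (L n) \<eta>) (cut (?S - L n) \<xi>) + pairing ?g (cut (?S - L n) \<eta>) (cut ?S \<xi>))"
      proof -
        have "pairing ?g (cut ?S \<eta>) (cut ?S \<xi>)
            = pairing ?g (cut (L n) \<eta>) (cut ?S \<xi>) + pairing ?g (cut (?S - L n) \<eta>) (cut ?S \<xi>)"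
          by (subst split[of \<eta> n], rule kernel_pairing_add_left[OF g]) (intro cut \<eta> \<xi> sets)+
        also have "pairing ?g (cut (L n) \<eta>) (cut ?S \<xi>)
            = pairing ?g (cut (L n) \<eta>) (cut (L n) \<xi>) + pairing ?g (cut (L n) \<eta>) (cut (?S - L n) \<xi>)"
          by (subst split[of \<xi> n], rule kernel_pairing_add_right[OF g]) (intro cut \<eta> \<xi> sets)+
        finally show ?thesis
          using \<open>pairing ?g \<eta> \<xi> = pairing ?g (cut ?S \<eta>) (cut ?S \<xi>)\<close> by simp
      qed
      moreover have "cmod (pairing ?g (cut (L n) \<eta>) (cut (L n) \<xi>)) \<le> C * ?N * nrm \<eta> * nrm \<xi>"
      proof (rule order_trans[OF finite_schur_bound_compact_support[OF \<phi> C f g _ _ L[of n]]])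
        show "C * ?N * nrm (cut (L n) \<eta>) * nrm (cut (L n) \<xi>) \<le> C * ?N * nrm \<eta> * nrm \<xi>"
          using L2_op_norm_kernel_op(2)[OF f \<xi>] C0
          by (intro mult_mono cut \<eta> \<xi> sets mult_nonneg_nonneg L2_norm_nonneg order_refl)
      qed (use cut[OF \<eta> sets(1)] cut[OF \<xi> sets(1)] in \<open>auto simp: cut_def indicator_def split: if_splits\<close>)
      moreover have "cmod (pairing ?g (cut (L n) \<eta>) (cut (?S - L n) \<xi>))
          \<le> G * nrm \<eta> * nrm (cut (?S - L n) \<xi>)"
        unfolding G_def
        by (rule order_trans[OF kernel_pairing_le_kernel_norm[OF g cut(1)[OF \<eta> sets(1)] cut(1)[OF \<xi> sets(3)]]])
          (intro mult_mono cut \<eta> \<xi> sets mult_nonneg_nonneg L2_norm_nonneg kernel_norm_nonneg order_refl)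
      moreover have "cmod (pairing ?g (cut (?S - L n) \<eta>) (cut ?S \<xi>))
          \<le> G * nrm (cut (?S - L n) \<eta>) * nrm \<xi>"
        unfolding G_def
        by (rule order_trans[OF kernel_pairing_le_kernel_norm[OF g cut(1)[OF \<eta> sets(3)] cut(1)[OF \<xi> sets(2)]]])
          (intro mult_mono cut \<eta> \<xi> sets mult_nonneg_nonneg L2_norm_nonneg kernel_norm_nonneg order_refl)
      ultimately show ?thesis
        by (metis (no_types, lifting) norm_triangle_le norm_triangle_mono)
    qed
    have "(\<lambda>n. C * ?N * nrm \<eta> * nrm \<xi>
        + (G * nrm \<eta> * nrm (cut (?S - L n) \<xi>) + G * nrm (cut (?S - L n) \<eta>) * nrm \<xi>))
        \<longlonglongrightarrow> C * ?N * nrm \<eta> * nrm \<xi> + (G * nrm \<eta> * 0 + G * 0 * nrm \<xi>)"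
      unfolding cut_def
      by (intro tendsto_add tendsto_mult tendsto_const L2_norm_tail[OF \<xi> sets(1) Lmono] L2_norm_tail[OF \<eta> sets(1) Lmono])
    from LIMSEQ_le_const[OF this] show ?thesis using le by auto
  qed
  show "op_norm ?g \<le> C * ?N"
  proof (rule L2_op_norm_le)
    have N: "0 \<le> ?N" by (rule L2_op_norm_kernel_op(2)[OF f L2_space_zero])
    then show "0 \<le> C * ?N" using C0 by simp
    fix \<xi> assume \<xi>: "\<xi> \<in> L2"
    show "nrm (kernel_op \<mu> ?g \<xi>) \<le> C * ?N * nrm \<xi>"
    proof (rule kernel_op_norm_le_dual[OF g \<xi>])
      show "0 \<le> C * ?N * nrm \<xi>" using C0 N by simp
      show "cmod (pairing ?g \<eta> \<xi>) \<le> C * ?N * nrm \<xi> * nrm \<eta>" if "\<eta> \<in> L2" for \<eta>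
        using dual[OF that \<xi>] by (simp add: mult_ac)
    qed
  qed
qed

end

section \<open>From operators to finite matrices\<close>

lemma left_haar_measureD:
  assumes "left_haar_measure \<mu>"
  shows left_haar_measure_sets: "sets \<mu> = sets borel"
    and left_haar_measure_compact: "compact K \<Longrightarrow> emeasure \<mu> K < \<infinity>"
    and left_haar_measure_inner: "open U \<Longrightarrow> emeasure \<mu> U = (SUP K\<in>{K. compact K \<and> K \<subseteq> U}. emeasure \<mu> K)"
    and left_haar_measure_translate: "B \<in> sets borel \<Longrightarrow> emeasure \<mu> ((\<lambda>x. g + x) ` B) = emeasure \<mu> B"
    and left_haar_measure_nonzero: "emeasure \<mu> UNIV \<noteq> 0"
proof -
  note \<mu> = assms[unfolded left_haar_measure_def]
  show "sets \<mu> = sets borel" by (rule conjunct1[OF \<mu>])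
  show "emeasure \<mu> K < \<infinity>" if "compact K"
    by (rule mp[OF spec[OF conjunct1[OF conjunct2[OF \<mu>]]] that])
  show "emeasure \<mu> U = (SUP K\<in>{K. compact K \<and> K \<subseteq> U}. emeasure \<mu> K)" if "open U"
    by (rule mp[OF spec[OF conjunct1[OF conjunct2[OF conjunct2[OF conjunct2[OF \<mu>]]]]] that])
  show "emeasure \<mu> ((\<lambda>x. g + x) ` B) = emeasure \<mu> B" if "B \<in> sets borel"
    using spec[OF conjunct1[OF conjunct2[OF conjunct2[OF conjunct2[OF conjunct2[OF \<mu>]]]]], of g] that by (rule bspec)
  show "emeasure \<mu> UNIV \<noteq> 0"
    by (rule conjunct2[OF conjunct2[OF conjunct2[OF conjunct2[OF conjunct2[OF \<mu>]]]]])
qed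

lemma left_haar_measure_compact_finite:
  "left_haar_measure \<mu> \<Longrightarrow> compact_finite_measure \<mu>"
  by (intro compact_finite_measure.intro left_haar_measure_sets left_haar_measure_compact)

text \<open>
  If an open nonempty set were null, so would be every compact set, which is covered by finitely many
  of its translates; by inner regularity the whole group would be null.
\<close>

lemma left_haar_measure_open_pos:
  fixes \<mu> :: "'a::{topological_group_add, t2_space} measure"
  assumes \<mu>: "left_haar_measure \<mu>" and U: "open U" "U \<noteq> {}"
  shows "0 < emeasure \<mu> U"
proof (rule ccontr)
  assume "\<not> 0 < emeasure \<mu> U"
  then have U0: "emeasure \<mu> U = 0" by simp
  note sets = left_haar_measure_sets[OF \<mu>] and inner = left_haar_measure_inner[OF \<mu> open_UNIV]
    and inv = left_haar_measure_translate[OF \<mu>] and nz = left_haar_measure_nonzero[OF \<mu>]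
  obtain x0 where x0: "x0 \<in> U" using U(2) by blast
  have op: "open ((\<lambda>x. g + x) ` U)" for g
  proof -
    have "(\<lambda>x. g + x) ` U = (\<lambda>x. - g + x) -` U"
    proof safe
      fix x assume "- g + x \<in> U"
      then show "x \<in> (\<lambda>x. g + x) ` U" by (intro image_eqI[of _ _ "- g + x"]) (simp_all add: add.assoc[symmetric])
    qed (simp add: add.assoc[symmetric])
    then show ?thesis
      by (simp only:) (intro open_vimage[OF U(1)] continuous_intros)
  qed
  have null: "(\<lambda>x. g + x) ` U \<in> null_sets \<mu>" for g
    using op[of g] inv[of U g] U(1) U0 by (auto simp: null_sets_def sets)
  have "emeasure \<mu> K = 0" if K: "compact K" for K
  proof -
    have cover: "K \<subseteq> (\<Union>k\<in>K. (\<lambda>x. (k - x0) + x) ` U)"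
      using x0 by (auto intro!: bexI image_eqI[of _ _ x0])
    obtain C where C: "C \<subseteq> K" "finite C" "K \<subseteq> (\<Union>k\<in>C. (\<lambda>x. (k - x0) + x) ` U)"
      by (rule compactE_image[OF K op cover])
    have "(\<Union>k\<in>C. (\<lambda>x. (k - x0) + x) ` U) \<in> null_sets \<mu>"
      using C(2) by (intro null_sets_UN' null countable_finite)
    from null_sets_subset[OF this _ C(3)] have "K \<in> null_sets \<mu>"
      using K by (simp add: sets borel_closed compact_imp_closed)
    then show ?thesis by auto
  qed
  then have "emeasure \<mu> UNIV = 0"
    unfolding inner by (intro antisym SUP_least) auto
  then show False using nz by simp
qed

lemma disjoint_neighbourhoods:
  fixes \<phi> :: "'a::t2_space \<times> 'a \<Rightarrow> complex"
  assumes \<phi>: "continuous_on UNIV \<phi>" and A: "finite A" and \<epsilon>: "0 < \<epsilon>"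
  obtains U where "\<forall>p\<in>A. open (U p) \<and> p \<in> U p" "disjoint_family_on U A"
    "\<forall>p\<in>A. \<forall>q\<in>A. \<forall>s\<in>U p. \<forall>t\<in>U q. cmod (\<phi> (s, t) - \<phi> (p, q)) \<le> \<epsilon>"
proof -
  have "\<exists>V W. open V \<and> open W \<and> p \<in> V \<and> q \<in> W \<and> (p \<noteq> q \<longrightarrow> V \<inter> W = {})" for p q :: 'a
    by (cases "p = q") (use hausdorff[of p q] in \<open>auto intro: exI[of _ UNIV]\<close>)
  then obtain V W where VW: "\<And>p q :: 'a. open (V p q) \<and> open (W p q) \<and> p \<in> V p q \<and> q \<in> W p q \<and> (p \<noteq> q \<longrightarrow> V p q \<inter> W p q = {})"
    by metis
  have "\<exists>P Q. open P \<and> open Q \<and> p \<in> P \<and> q \<in> Q \<and> (\<forall>s\<in>P. \<forall>t\<in>Q. cmod (\<phi> (s, t) - \<phi> (p, q)) \<le> \<epsilon>)" for p q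
  proof -
    have "open (\<phi> -` ball (\<phi> (p, q)) \<epsilon>)"
      by (rule open_vimage[OF open_ball \<phi>])
    moreover have "(p, q) \<in> \<phi> -` ball (\<phi> (p, q)) \<epsilon>" using \<epsilon> by simp
    ultimately obtain P Q where "open P" "open Q" "(p, q) \<in> P \<times> Q" "P \<times> Q \<subseteq> \<phi> -` ball (\<phi> (p, q)) \<epsilon>"
      by (rule open_prod_elim)
    then show ?thesis
      by (intro exI[of _ P] exI[of _ Q]) (force simp: dist_norm norm_minus_commute)
  qed
  then obtain P Q where PQ: "\<And>p q. open (P p q) \<and> open (Q p q) \<and> p \<in> P p q \<and> q \<in> Q p q \<and>
      (\<forall>s\<in>P p q. \<forall>t\<in>Q p q. cmod (\<phi> (s, t) - \<phi> (p, q)) \<le> \<epsilon>)"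
    by metis
  \<comment> \<open>Each point occurs as the first and as the second component of a pair, whence four factors.\<close>
  define U where "U p = (\<Inter>q\<in>A. V p q \<inter> W q p \<inter> P p q \<inter> Q q p)" for p
  have U: "U p \<subseteq> V p q" "U p \<subseteq> W q p" "U p \<subseteq> P p q" "U p \<subseteq> Q q p" if "q \<in> A" for p q
    using that unfolding U_def by auto
  show ?thesis
  proof (rule that[of U])
    show "\<forall>p\<in>A. open (U p) \<and> p \<in> U p"
      unfolding U_def using VW PQ A by (auto intro!: open_INT open_Int)
    show "disjoint_family_on U A"
      unfolding disjoint_family_on_def
    proof (intro ballI impI)
      fix p q assume "p \<in> A" "q \<in> A" "p \<noteq> q"
      then have "U p \<subseteq> V p q" "U q \<subseteq> W p q" "V p q \<inter> W p q = {}" using U VW by simp_all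
      then show "U p \<inter> U q = {}" by blast
    qed
    show "\<forall>p\<in>A. \<forall>q\<in>A. \<forall>s\<in>U p. \<forall>t\<in>U q. cmod (\<phi> (s, t) - \<phi> (p, q)) \<le> \<epsilon>"
    proof (intro ballI)
      fix p q s t assume "p \<in> A" "q \<in> A" "s \<in> U p" "t \<in> U q"
      then have "s \<in> P p q" "t \<in> Q p q" using U(3)[of q p] U(4)[of p q] by auto
      then show "cmod (\<phi> (s, t) - \<phi> (p, q)) \<le> \<epsilon>" using PQ[of p q] by simp
    qed
  qed
qed

text \<open>
  Bessel's inequality, for an orthonormal system with disjoint supports.
\<close>

lemma L2_bessel:
  assumes A: "finite A" and e: "\<And>p. p \<in> A \<Longrightarrow> e p \<in> L2_space \<mu>" "\<And>p. p \<in> A \<Longrightarrow> L2_norm \<mu> (e p) = 1"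
    and supp: "\<And>p x. p \<in> A \<Longrightarrow> e p x \<noteq> 0 \<Longrightarrow> x \<in> E p" and disj: "disjoint_family_on E A"
    and \<eta>: "\<eta> \<in> L2_space \<mu>"
  shows "sqrt (\<Sum>p\<in>A. (cmod (\<integral>x. e p x * \<eta> x \<partial>\<mu>))\<^sup>2) \<le> L2_norm \<mu> \<eta>"
proof -
  define d where "d p = (\<integral>x. e p x * \<eta> x \<partial>\<mu>)" for p
  define X where "X = vec_norm A d"
  define u where "u x = (\<Sum>p\<in>A. cnj (d p) * e p x)" for x
  have X: "0 \<le> X" "X\<^sup>2 = (\<Sum>p\<in>A. (cmod (d p))\<^sup>2)" by (simp_all add: X_def sum_nonneg)
  have u: "u \<in> L2_space \<mu>"
    unfolding u_def[abs_def] by (intro L2_space_sum L2_space_cmult e(1))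
  have "(L2_norm \<mu> u)\<^sup>2 = X\<^sup>2"
    unfolding u_def[abs_def] X(2) by (subst L2_norm_sum_disjoint[OF A e(1) supp disj]) (simp_all add: e(2))
  then have nu: "L2_norm \<mu> u = X" using X(1) by simp
  have "(\<integral>x. u x * \<eta> x \<partial>\<mu>) = (\<integral>x. (\<Sum>p\<in>A. cnj (d p) * (e p x * \<eta> x)) \<partial>\<mu>)"
    by (simp add: u_def sum_distrib_right mult.assoc)
  also have "\<dots> = (\<Sum>p\<in>A. cnj (d p) * d p)"
    using L2_Cauchy_Schwarz(1)[OF e(1) \<eta>] by (subst Bochner_Integration.integral_sum) (simp_all add: d_def)
  also have "\<dots> = complex_of_real (X\<^sup>2)"
    unfolding X(2) of_real_sum by (intro sum.cong refl) (subst complex_norm_square, simp add: mult.commute)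
  finally have "cmod (complex_of_real (X\<^sup>2)) \<le> X * L2_norm \<mu> \<eta>"
    using L2_Cauchy_Schwarz(2)[OF u \<eta>] by (simp only: nu)
  then have "X * X \<le> X * L2_norm \<mu> \<eta>" by (simp add: power2_eq_square norm_mult)
  then have "X \<le> L2_norm \<mu> \<eta>"
    using X(1) by (cases "X = 0") (simp_all add: less_le)
  then show ?thesis by (simp add: X_def d_def)
qed

context compact_finite_measure
begin

lemma tensor_kernel:
  assumes u: "u \<in> L2" and v: "v \<in> L2" and K: "compact K"
    and uK: "\<And>x. u x \<noteq> 0 \<Longrightarrow> x \<in> K" and vK: "\<And>x. v x \<noteq> 0 \<Longrightarrow> x \<in> K"
  shows "(\<lambda>z. u (fst z) * v (snd z)) \<in> kernels"
    and "hs_norm (\<lambda>z. u (fst z) * v (snd z)) = nrm u * nrm v"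
proof -
  note [measurable] = L2_spaceD(1)[OF u] L2_spaceD(1)[OF v]
  have row: "(\<integral>\<^sup>+t. ennreal ((cmod (u (fst (s, t)) * v (snd (s, t))))\<^sup>2) \<partial>\<mu>)
      = ennreal ((cmod (u s))\<^sup>2) * ennreal ((nrm v)\<^sup>2)" for s
    unfolding nn_integral_L2[OF v, symmetric]
    by (subst nn_integral_cmult[symmetric]) (simp_all add: norm_mult power_mult_distrib ennreal_mult)
  have int: "(\<integral>\<^sup>+s. \<integral>\<^sup>+t. ennreal ((cmod (u (fst (s, t)) * v (snd (s, t))))\<^sup>2) \<partial>\<mu> \<partial>\<mu>)
      = ennreal ((nrm u * nrm v)\<^sup>2)"
    unfolding row by (subst nn_integral_multc) (simp_all add: nn_integral_L2[OF u] power_mult_distrib ennreal_mult)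
  have "\<exists>K. (\<forall>n::nat. compact (K n)) \<and> (\<forall>s t. u (fst (s, t)) * v (snd (s, t)) \<noteq> 0 \<longrightarrow> s \<in> (\<Union>n. K n) \<and> t \<in> (\<Union>n. K n))"
    using K uK vK by (intro exI[of _ "\<lambda>_. K"]) auto
  then show "(\<lambda>z. u (fst z) * v (snd z)) \<in> kernels"
    unfolding L2_kernels_def using int by simp
  show "hs_norm (\<lambda>z. u (fst z) * v (snd z)) = nrm u * nrm v"
    unfolding kernel_norm_def int by simp
qed

text \<open>
  A matrix \<open>a\<close> on a finite set \<open>A\<close> is realised on \<open>L\<^sup>2(G)\<close>: choose disjoint compact sets \<open>K p\<close> of
  positive measure, so close to the points \<open>p\<close> of \<open>A\<close> that \<open>\<phi>\<close> is nearly constant on \<open>K p \<times> K q\<close>, and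
  let \<open>e p\<close> be the normalised indicator function of \<open>K p\<close>. The kernel
  \<open>f = \<Sum> a p q * e p \<otimes> e q\<close> has at most the operator norm of \<open>a\<close>, and the operator with kernel
  \<open>\<phi> * f\<close>, compressed to the span of the \<open>e p\<close>, is close to the Schur product of \<open>\<phi>\<close> and \<open>a\<close>. The
  Hilbert-Schmidt norm of \<open>f\<close> is bounded independently of the choice of the sets, so that the error tends to 0.
\<close>

theorem schur_bound_imp_finite_schur_bound:
  assumes \<mu>: "left_haar_measure \<mu>" and \<phi>: "continuous_on UNIV \<phi>" and C: "schur_bound \<mu> \<phi> C"
  shows "finite_schur_bound (\<lambda>s t. \<phi> (s, t)) C"
  unfolding finite_schur_bound_def
proof (intro conjI allI impI)
  show C0: "0 \<le> C" using C by (simp add: schur_bound_def)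
  fix A :: "'a set" and a M assume A: "finite A" and a: "mat_bound A A a M"
  have M: "0 \<le> M" by (rule mat_bound_nonneg[OF a])
  show "mat_bound A A (\<lambda>s t. \<phi> (s, t) * a s t) (C * M)"
    unfolding mat_bound_def
  proof (intro conjI allI)
    show "0 \<le> C * M" using C0 M by simp
    fix x y :: "'a \<Rightarrow> complex"
    define X where "X = vec_norm A x"
    define Y where "Y = vec_norm A y"
    define B where "B = (\<Sum>p\<in>A. \<Sum>q\<in>A. cmod (a p q))"
    have nonneg: "0 \<le> X" "0 \<le> Y" "0 \<le> B" by (simp_all add: X_def Y_def B_def sum_nonneg)
    have "cmod (\<Sum>i\<in>A. \<Sum>j\<in>A. \<phi> (i, j) * a i j * x i * y j) \<le> C * M * X * Y"
    proof (rule field_le_epsilon)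
      fix e' :: real assume e': "0 < e'"
      define r where "r = B * card A * X * Y"
      have r: "0 \<le> r" using nonneg by (simp add: r_def)
      define \<epsilon> where "\<epsilon> = e' / (r + 1)"
      have \<epsilon>: "0 < \<epsilon>" "\<epsilon> * r \<le> e'" using e' r by (auto simp: \<epsilon>_def field_simps)
      obtain U where U: "\<forall>p\<in>A. open (U p) \<and> p \<in> U p" and Udisj: "disjoint_family_on U A"
        and osc: "\<forall>p\<in>A. \<forall>q\<in>A. \<forall>s\<in>U p. \<forall>t\<in>U q. cmod (\<phi> (s, t) - \<phi> (p, q)) \<le> \<epsilon>"
        by (rule disjoint_neighbourhoods[OF \<phi> A \<epsilon>(1)])
      have "\<exists>K. compact K \<and> K \<subseteq> U p \<and> 0 < emeasure \<mu> K" if "p \<in> A" for p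
      proof -
        have "open (U p)" "U p \<noteq> {}" using U that by auto
        then have "0 < emeasure \<mu> (U p)" by (rule left_haar_measure_open_pos[OF \<mu>])
        also have "emeasure \<mu> (U p) = (SUP K\<in>{K. compact K \<and> K \<subseteq> U p}. emeasure \<mu> K)"
          by (rule left_haar_measure_inner[OF \<mu> \<open>open (U p)\<close>])
        finally show ?thesis by (auto simp: less_SUP_iff)
      qed
      then obtain K where K: "\<And>p. p \<in> A \<Longrightarrow> compact (K p) \<and> K p \<subseteq> U p \<and> 0 < emeasure \<mu> (K p)" by metis
      have Ksets: "K p \<in> sets \<mu>" and Kfin: "emeasure \<mu> (K p) < \<infinity>" if "p \<in> A" for p
        using K[OF that] compact_sets finite_compact by auto
      have Kdisj: "disjoint_family_on K A"
        using Udisj K unfolding disjoint_family_on_def by blast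
      define m where "m p = measure \<mu> (K p)" for p
      have m: "0 < m p" if "p \<in> A" for p
        using K[OF that] Kfin[OF that] by (auto simp: m_def measure_def enn2real_positive_iff less_top)
      define e where "e p x = complex_of_real (indicator (K p) x / sqrt (m p))" for p x
      have e_meas: "e p \<in> borel_measurable \<mu>" if "p \<in> A" for p
        unfolding e_def[abs_def] using Ksets[OF that] by simp
      have e_sq: "(cmod (e p x))\<^sup>2 = indicator (K p) x / m p" if "p \<in> A" for p x
        using m[OF that] by (simp add: e_def norm_divide power_divide indicator_def)
      have e: "e p \<in> L2" "nrm (e p) = 1" if "p \<in> A" for p
      proof -
        have "integrable \<mu> (\<lambda>x. indicator (K p) x / m p :: real)"
          using Ksets[OF that] Kfin[OF that] by (intro integrable_divide_zero impI integrable_real_indicator)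
        then show "e p \<in> L2"
          using e_meas[OF that] by (simp add: L2_space_def e_sq[OF that])
        have "(\<integral>x. indicator (K p) x / m p \<partial>\<mu>) = 1"
          using m[OF that] Ksets[OF that] Kfin[OF that] by (simp add: m_def)
        then show "nrm (e p) = 1" by (simp add: L2_norm_def e_sq[OF that])
      qed
      have esupp: "x \<in> K p" if "e p x \<noteq> 0" for p x using that by (auto simp: e_def indicator_def split: if_splits)
      have e_ortho: "(\<integral>x. e p x * e q x \<partial>\<mu>) = (if p = q then 1 else 0)" if "p \<in> A" "q \<in> A" for p q
      proof (cases "p = q")
        case True
        have "e p x * e p x = complex_of_real ((cmod (e p x))\<^sup>2)" for x
          unfolding e_def norm_of_real power2_abs by (simp only: power2_eq_square of_real_mult)
        then have "(\<integral>x. e p x * e p x \<partial>\<mu>) = complex_of_real ((nrm (e p))\<^sup>2)"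
          by (simp add: L2_norm_power2 del: of_real_power)
        then show ?thesis using True e(2)[OF that(1)] by simp
      next
        case False
        then have zero: "e p x * e q x = 0" for x
          using Kdisj that esupp[of p x] esupp[of q x] unfolding disjoint_family_on_def by fastforce
        show ?thesis using False unfolding zero by simp
      qed
      \<comment> \<open>The kernel \<open>w \<otimes> w\<close> dominates \<open>f\<close> up to the constant \<open>B\<close>.\<close>
      define w where "w x = (\<Sum>p\<in>A. e p x)" for x
      have w: "w \<in> L2" unfolding w_def[abs_def] by (intro L2_space_sum e)
      have "(nrm w)\<^sup>2 = card A"
        using L2_norm_sum_disjoint[where \<alpha> = "\<lambda>_. 1", OF A e(1) esupp Kdisj] e(2) by (simp add: w_def[abs_def])
      have e_w: "cmod (e p x) \<le> cmod (w x)" if "p \<in> A" for p x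
      proof -
        have "w x = complex_of_real (\<Sum>p\<in>A. indicator (K p) x / sqrt (m p))"
          by (simp add: w_def e_def)
        moreover have nn: "0 \<le> indicator (K p) x / sqrt (m p)" if "p \<in> A" for p
          using m[OF that] by simp
        ultimately have "cmod (w x) = (\<Sum>p\<in>A. indicator (K p) x / sqrt (m p))"
          by (simp only: norm_of_real abs_of_nonneg sum_nonneg)
        moreover have "cmod (e p x) = indicator (K p) x / sqrt (m p)"
          unfolding e_def norm_of_real using nn[OF that] by (rule abs_of_nonneg)
        ultimately show ?thesis
          using member_le_sum[of p A "\<lambda>p. indicator (K p) x / sqrt (m p)"] nn that A by auto
      qed
      define f where "f z = (\<Sum>p\<in>A. \<Sum>q\<in>A. a p q * e p (fst z) * e q (snd z))" for z
      have KK: "compact (\<Union>p\<in>A. K p)" using A K by blast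
      have wK: "x \<in> (\<Union>p\<in>A. K p)" if "w x \<noteq> 0" for x
        using that esupp unfolding w_def by (metis (no_types, lifting) UN_I sum.neutral)
      have f_meas: "f \<in> borel_measurable (\<mu> \<Otimes>\<^sub>M \<mu>)"
        unfolding f_def[abs_def]
      proof (intro borel_measurable_sum)
        fix p q assume "p \<in> A" "q \<in> A"
        then have [measurable]: "e p \<in> borel_measurable \<mu>" "e q \<in> borel_measurable \<mu>" using e_meas by auto
        show "(\<lambda>z. a p q * e p (fst z) * e q (snd z)) \<in> borel_measurable (\<mu> \<Otimes>\<^sub>M \<mu>)" by measurable
      qed
      have f_le: "cmod (f z) \<le> B * cmod (w (fst z) * w (snd z))" for z
      proof -
        have "cmod (f z) \<le> (\<Sum>p\<in>A. \<Sum>q\<in>A. cmod (a p q) * cmod (w (fst z) * w (snd z)))"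
          unfolding f_def
        proof (intro sum_norm_le)
          fix p q assume "p \<in> A" "q \<in> A"
          then show "cmod (a p q * e p (fst z) * e q (snd z)) \<le> cmod (a p q) * cmod (w (fst z) * w (snd z))"
            unfolding norm_mult mult.assoc by (intro mult_left_mono mult_mono e_w norm_ge_zero)
        qed
        then show ?thesis by (simp add: B_def sum_distrib_right)
      qed
      have f: "f \<in> kernels" and "hs_norm f \<le> B * (nrm w * nrm w)"
        using kernel_dominated[OF tensor_kernel(1)[OF w w KK wK wK] f_meas nonneg(3) f_le]
        by (auto simp: tensor_kernel(2)[OF w w KK wK wK])
      then have f_norm: "hs_norm f \<le> B * card A"
        using \<open>(nrm w)\<^sup>2 = card A\<close> by (simp add: power2_eq_square)
      have pairing: "pairing f \<eta> \<xi> = (\<Sum>p\<in>A. \<Sum>q\<in>A. a p q * (\<integral>s. e p s * \<eta> s \<partial>\<mu>) * (\<integral>t. e q t * \<xi> t \<partial>\<mu>))"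
        if \<eta>: "\<eta> \<in> L2" and \<xi>: "\<xi> \<in> L2" for \<eta> \<xi>
      proof -
        have i1: "integrable \<mu> (\<lambda>t. e q t * \<xi> t)" "integrable \<mu> (\<lambda>t. e q t * \<eta> t)" if "q \<in> A" for q
          using L2_Cauchy_Schwarz(1)[OF e(1)[OF that] \<xi>] L2_Cauchy_Schwarz(1)[OF e(1)[OF that] \<eta>] by auto
        have "kernel_op \<mu> f \<xi> s = (\<integral>t. (\<Sum>p\<in>A. \<Sum>q\<in>A. (a p q * e p s) * (e q t * \<xi> t)) \<partial>\<mu>)" for s
          by (simp add: kernel_op_def f_def sum_distrib_right mult.assoc)
        also have "\<dots> s = (\<Sum>p\<in>A. \<Sum>q\<in>A. a p q * e p s * (\<integral>t. e q t * \<xi> t \<partial>\<mu>))" for s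
          using i1 by (simp add: Bochner_Integration.integral_sum)
        finally have "pairing f \<eta> \<xi>
            = (\<integral>s. (\<Sum>p\<in>A. \<Sum>q\<in>A. (a p q * (\<integral>t. e q t * \<xi> t \<partial>\<mu>)) * (e p s * \<eta> s)) \<partial>\<mu>)"
          unfolding kernel_pairing_def by (simp add: sum_distrib_left mult_ac)
        also have "\<dots> = (\<Sum>p\<in>A. \<Sum>q\<in>A. (a p q * (\<integral>t. e q t * \<xi> t \<partial>\<mu>)) * (\<integral>s. e p s * \<eta> s \<partial>\<mu>))"
          using i1 by (simp add: Bochner_Integration.integral_sum)
        finally show ?thesis by (simp add: mult_ac)
      qed
      have "op_norm f \<le> M"
      proof (rule L2_op_norm_le[OF _ M], rule kernel_op_norm_le_dual[OF f])
        fix \<xi> \<eta> assume \<xi>: "\<xi> \<in> L2" and \<eta>: "\<eta> \<in> L2"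
        have "cmod (pairing f \<eta> \<xi>) \<le> M * sqrt (\<Sum>p\<in>A. (cmod (\<integral>s. e p s * \<eta> s \<partial>\<mu>))\<^sup>2)
            * sqrt (\<Sum>q\<in>A. (cmod (\<integral>t. e q t * \<xi> t \<partial>\<mu>))\<^sup>2)"
          unfolding pairing[OF \<eta> \<xi>] by (rule mat_boundD[OF a])
        also have "\<dots> \<le> M * nrm \<eta> * nrm \<xi>"
          by (intro mult_mono L2_bessel[OF A e(1) e(2) esupp Kdisj] \<eta> \<xi> M order_refl mult_nonneg_nonneg
              L2_norm_nonneg real_sqrt_ge_zero sum_nonneg zero_le_power2)
        finally show "cmod (pairing f \<eta> \<xi>) \<le> M * nrm \<xi> * nrm \<eta>" by (simp add: mult_ac)
      qed (use M in auto)
      then have "C * op_norm f \<le> C * M" using C0 by (rule mult_left_mono)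
      moreover have \<phi>f: "(\<lambda>z. \<phi> z * f z) \<in> kernels"
        and "op_norm (\<lambda>z. \<phi> z * f z) \<le> C * op_norm f"
        using C f unfolding schur_bound_def by auto
      ultimately have \<phi>f_norm: "op_norm (\<lambda>z. \<phi> z * f z) \<le> C * M" by simp
      \<comment> \<open>The isometric embedding of \<open>\<ell>\<^sup>2(A)\<close> that transports matrices on \<open>A\<close> to kernels.\<close>
      define comb where "comb c = (\<lambda>s. \<Sum>p\<in>A. c p * e p s)" for c
      have comb: "comb c \<in> L2" for c unfolding comb_def by (intro L2_space_sum L2_space_cmult e)
      have comb_norm: "nrm (comb c) = vec_norm A c" for c
      proof -
        have "(nrm (comb c))\<^sup>2 = (\<Sum>p\<in>A. (cmod (c p))\<^sup>2)"
          unfolding comb_def using L2_norm_sum_disjoint[where \<alpha> = c, OF A e(1) esupp Kdisj] e(2) by simp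
        then show ?thesis by (metis L2_norm_nonneg real_sqrt_unique)
      qed
      have comb_supp: "s \<in> (\<Union>p\<in>A. K p)" if "comb c s \<noteq> 0" for c s
        using that esupp unfolding comb_def by (metis (no_types, lifting) UN_I mult_zero_right sum.neutral)
      have comb_piece: "(\<lambda>s. indicator (K p) s * comb c s) = (\<lambda>s. c p * e p s)" if p: "p \<in> A" for p c
      proof
        fix s
        have "indicator (K p) s * (c q * e q s) = (if q = p then c p * e p s else 0)" if "q \<in> A" for q
          using Kdisj that p esupp[of q s] esupp[of p s] unfolding disjoint_family_on_def
          by (cases "e q s = 0") (auto simp: indicator_def)
        then have "indicator (K p) s * comb c s = (\<Sum>q\<in>A. if q = p then c p * e p s else 0)"
          unfolding comb_def sum_distrib_left by (rule sum.cong[OF refl])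
        then show "indicator (K p) s * comb c s = c p * e p s" using A p by simp
      qed
      have pairing_piece: "pairing f (\<lambda>s. indicator (K p) s * comb x s) (\<lambda>t. indicator (K q) t * comb y t)
          = a p q * x p * y q" if pq: "p \<in> A" "q \<in> A" for p q
      proof -
        have "pairing f (e p) (e q) = (\<Sum>p'\<in>A. \<Sum>q'\<in>A. if q' = q then if p' = p then a p q else 0 else 0)"
          unfolding pairing[OF e(1)[OF pq(1)] e(1)[OF pq(2)]] using pq
          by (intro sum.cong refl) (simp add: e_ortho)
        then have "pairing f (e p) (e q) = a p q" using A pq by simp
        then show ?thesis
          unfolding comb_piece[OF pq(1)] comb_piece[OF pq(2)] kernel_pairing_cmult_left kernel_pairing_cmult_right
          by (simp add: mult_ac)
      qed
      have "cmod (pairing (\<lambda>z. \<phi> z * f z) (comb x) (comb y)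
          - (\<Sum>p\<in>A. \<Sum>q\<in>A. \<phi> (p, q) * pairing f (\<lambda>s. indicator (K p) s * comb x s) (\<lambda>t. indicator (K q) t * comb y t)))
        \<le> \<epsilon> * hs_norm f * nrm (comb x) * nrm (comb y)"
      proof (rule kernel_pairing_step_approx[OF f comb comb A Ksets Kdisj comb_supp comb_supp \<phi>f])
        show "0 \<le> \<epsilon>" using \<epsilon>(1) by simp
        show "cmod (\<phi> (s, t) - \<phi> (p, q)) \<le> \<epsilon>" if "p \<in> A" "q \<in> A" "s \<in> K p" "t \<in> K q" for p q s t
          using osc K that by blast
      qed
      also have "(\<Sum>p\<in>A. \<Sum>q\<in>A. \<phi> (p, q) * pairing f (\<lambda>s. indicator (K p) s * comb x s) (\<lambda>t. indicator (K q) t * comb y t))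
          = (\<Sum>p\<in>A. \<Sum>q\<in>A. \<phi> (p, q) * a p q * x p * y q)"
        by (intro sum.cong refl) (simp add: pairing_piece mult.assoc)
      also have "\<epsilon> * hs_norm f * nrm (comb x) * nrm (comb y) \<le> \<epsilon> * (B * card A) * X * Y"
        unfolding comb_norm X_def[symmetric] Y_def[symmetric]
        using \<epsilon>(1) nonneg by (intro mult_right_mono mult_left_mono f_norm) auto
      also have "\<dots> \<le> e'" using \<epsilon>(2) by (simp add: r_def mult.assoc)
      finally have 1: "cmod (pairing (\<lambda>z. \<phi> z * f z) (comb x) (comb y)
          - (\<Sum>p\<in>A. \<Sum>q\<in>A. \<phi> (p, q) * a p q * x p * y q)) \<le> e'" .
      have 2: "cmod (pairing (\<lambda>z. \<phi> z * f z) (comb x) (comb y)) \<le> C * M * X * Y"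
        using order_trans[OF kernel_pairing_le_op_norm[OF \<phi>f comb[of x] comb[of y]]
            mult_right_mono[OF mult_right_mono[OF \<phi>f_norm L2_norm_nonneg] L2_norm_nonneg]]
        unfolding comb_norm X_def[symmetric] Y_def[symmetric] .
      show "cmod (\<Sum>p\<in>A. \<Sum>q\<in>A. \<phi> (p, q) * a p q * x p * y q) \<le> C * M * X * Y + e'"
        using norm_triangle_sub[of "\<Sum>p\<in>A. \<Sum>q\<in>A. \<phi> (p, q) * a p q * x p * y q" "pairing (\<lambda>z. \<phi> z * f z) (comb x) (comb y)"]
          1 2 by (simp add: norm_minus_commute)
    qed
    then show "cmod (\<Sum>i\<in>A. \<Sum>j\<in>A. \<phi> (i, j) * a i j * x i * y j)
        \<le> C * M * vec_norm A x * vec_norm A y"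
      by (simp add: X_def Y_def)
  qed
qed

end

section \<open>The weak Haagerup constant of a product\<close>

lemma schur_bound_herz_schur:
  fixes \<mu> :: "'a::{topological_group_add, t2_space} measure"
  assumes \<mu>: "left_haar_measure \<mu>" and u: "continuous_on UNIV u"
  shows "schur_bound \<mu> (herz_schur_kernel u) C \<longleftrightarrow> herz_schur_bound u C"
proof -
  have \<phi>: "continuous_on UNIV (herz_schur_kernel u)"
    unfolding herz_schur_kernel_def split_beta
    by (rule continuous_on_compose2[OF u]) (auto intro!: continuous_intros)
  have eq: "(\<lambda>s t. herz_schur_kernel u (s, t)) = (\<lambda>s t. u (- t + s))"
    by (simp add: herz_schur_kernel_def)
  interpret compact_finite_measure \<mu> by (rule left_haar_measure_compact_finite[OF \<mu>])
  show ?thesis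
    using schur_bound_imp_finite_schur_bound[OF \<mu> \<phi>, of C] finite_schur_bound_imp_schur_bound[OF \<phi>, of C]
    unfolding herz_schur_bound_def eq by blast
qed

text \<open>
  Hence the infimum that defines the Herz-Schur norm is attained: the condition on \<open>D\<close> is a family of
  non-strict inequalities, which persist as \<open>D\<close> decreases to \<open>C\<close>.
\<close>

lemma herz_schur_bound_closed:
  fixes u :: "'a::group_add \<Rightarrow> complex"
  assumes "\<And>D. C < D \<Longrightarrow> herz_schur_bound u D" and C: "0 \<le> C"
  shows "herz_schur_bound u C"
  unfolding herz_schur_bound_def finite_schur_bound_def
proof (intro conjI allI impI C)
  fix A :: "'a set" and a M assume A: "finite A" and a: "mat_bound A A a M"
  show "mat_bound A A (\<lambda>s t. u (- t + s) * a s t) (C * M)"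
    unfolding mat_bound_def
  proof (intro conjI allI)
    show "0 \<le> C * M" using C mat_bound_nonneg[OF a] by simp
    fix x y :: "'a \<Rightarrow> complex"
    let ?Z = "sqrt (\<Sum>i\<in>A. (cmod (x i))\<^sup>2)" and ?W = "sqrt (\<Sum>j\<in>A. (cmod (y j))\<^sup>2)"
    let ?l = "cmod (\<Sum>i\<in>A. \<Sum>j\<in>A. u (- j + i) * a i j * x i * y j)"
    have "\<forall>\<^sub>F D in at_right C. ?l \<le> D * M * ?Z * ?W"
      using eventually_at_right_less[of C]
      by eventually_elim (rule mat_boundD[OF finite_schur_boundD[OF assms(1)[unfolded herz_schur_bound_def] A a]])
    moreover have "((\<lambda>D. D * M * ?Z * ?W) \<longlongrightarrow> C * M * ?Z * ?W) (at_right C)"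
      by (intro tendsto_intros)
    ultimately show "?l \<le> C * M * ?Z * ?W"
      by (intro tendsto_lowerbound) auto
  qed
qed

lemma herz_schur_norm_le_iff:
  assumes \<mu>: "left_haar_measure \<mu>" and u: "continuous_on UNIV u" and C: "0 \<le> C"
  shows "u \<in> herz_schur_multipliers \<mu> \<and> herz_schur_norm \<mu> u \<le> C \<longleftrightarrow> herz_schur_bound u C"
proof
  assume *: "u \<in> herz_schur_multipliers \<mu> \<and> herz_schur_norm \<mu> u \<le> C"
  have ne: "{C. herz_schur_bound u C} \<noteq> {}" and le: "Inf {C. herz_schur_bound u C} \<le> C"
    using * by (auto simp: herz_schur_multipliers_def herz_schur_norm_def schur_bound_herz_schur[OF \<mu> u])
  show "herz_schur_bound u C"
  proof (rule herz_schur_bound_closed[OF _ C])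
    fix D assume "C < D"
    then have "Inf {C. herz_schur_bound u C} < D" using le by simp
    then obtain C' where "herz_schur_bound u C'" "C' < D"
      using cInf_lessD[OF ne] by blast
    then show "herz_schur_bound u D" by (auto intro: herz_schur_bound_mono)
  qed
next
  assume *: "herz_schur_bound u C"
  have "Inf {C. herz_schur_bound u C} \<le> C"
    using * by (intro cInf_lower bdd_belowI[of _ 0]) (auto dest: herz_schur_bound_nonneg)
  then show "u \<in> herz_schur_multipliers \<mu> \<and> herz_schur_norm \<mu> u \<le> C"
    using * u by (auto simp: herz_schur_multipliers_def herz_schur_norm_def schur_bound_herz_schur[OF \<mu> u])
qed

text \<open>
  From admissible approximants to a net: the sets \<open>T (K, \<epsilon>)\<close> of approximants of precision \<open>\<epsilon>\<close> on \<open>K\<close> are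
  nonempty, and \<open>T (K \<union> L, min \<epsilon> \<delta>)\<close> is contained in both \<open>T (K, \<epsilon>)\<close> and \<open>T (L, \<delta>)\<close>, so they form
  the base of a proper filter.
\<close>

lemma haagerup_bound_iff_filter:
  fixes \<mu> :: "'a::{topological_group_add, t2_space} measure"
  assumes \<mu>: "left_haar_measure \<mu>" and C: "0 \<le> C"
  shows "(\<exists>F :: ('a \<Rightarrow> complex) filter. F \<noteq> bot \<and>
        (\<forall>\<^sub>F u in F. u \<in> herz_schur_multipliers \<mu> \<inter> C0_functions \<and> herz_schur_norm \<mu> u \<le> C) \<and>
        (\<forall>K. compact K \<longrightarrow> uniform_limit K (\<lambda>u. u) (\<lambda>_. 1) F)) \<longleftrightarrow> haagerup_bound TYPE('a) C"
    (is "?lhs \<longleftrightarrow> _")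
proof
  assume ?lhs
  then obtain F :: "('a \<Rightarrow> complex) filter" where F: "F \<noteq> bot"
    "\<forall>\<^sub>F u in F. u \<in> herz_schur_multipliers \<mu> \<inter> C0_functions \<and> herz_schur_norm \<mu> u \<le> C"
    "\<forall>K. compact K \<longrightarrow> uniform_limit K (\<lambda>u. u) (\<lambda>_. 1) F" by blast
  show "haagerup_bound TYPE('a) C"
    unfolding haagerup_bound_def
  proof (intro allI impI)
    fix K :: "'a set" and \<epsilon> :: real assume "compact K" "0 < \<epsilon>"
    then have "\<forall>\<^sub>F u in F. \<forall>x\<in>K. dist (u x) 1 < \<epsilon>"
      using F(3) by (auto simp: uniform_limit_iff)
    with F(2) have "\<forall>\<^sub>F u in F. u \<in> C0_functions \<and> herz_schur_bound u C \<and> (\<forall>x\<in>K. cmod (u x - 1) < \<epsilon>)"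
    proof eventually_elim
      case (elim u)
      then show ?case
        using herz_schur_norm_le_iff[OF \<mu> C0_continuous C, of u] by (auto simp: dist_norm)
    qed
    then show "\<exists>u :: 'a \<Rightarrow> complex. u \<in> C0_functions \<and> herz_schur_bound u C \<and> (\<forall>x\<in>K. cmod (u x - 1) < \<epsilon>)"
      by (rule eventually_happens'[OF F(1)])
  qed
next
  assume W: "haagerup_bound TYPE('a) C"
  define T where "T i = {u :: 'a \<Rightarrow> complex. u \<in> C0_functions \<and> herz_schur_bound u C \<and> (\<forall>x\<in>fst i. cmod (u x - 1) < snd i)}"
    for i :: "'a set \<times> real"
  define J where "J = {i :: 'a set \<times> real. compact (fst i) \<and> 0 < snd i}"
  define F where "F = (INF i\<in>J. principal (T i))"
  have J: "({}, 1) \<in> J" by (simp add: J_def)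
  have ev: "eventually P F \<longleftrightarrow> (\<exists>i\<in>J. \<forall>u\<in>T i. P u)" for P
    unfolding F_def
  proof (subst eventually_INF_base)
    show "J \<noteq> {}" using J by blast
    fix i j assume "i \<in> J" "j \<in> J"
    then show "\<exists>k\<in>J. principal (T k) \<le> inf (principal (T i)) (principal (T j))"
      by (intro bexI[of _ "(fst i \<union> fst j, min (snd i) (snd j))"]) (auto simp: J_def T_def)
  qed (simp add: eventually_principal)
  have "F \<noteq> bot"
    unfolding trivial_limit_def ev
  proof
    assume "\<exists>i\<in>J. \<forall>u\<in>T i. False"
    then obtain i where "i \<in> J" "T i = {}" by blast
    moreover have "compact (fst i)" "0 < snd i" using \<open>i \<in> J\<close> by (auto simp: J_def)
    ultimately show False
      using W unfolding haagerup_bound_def T_def by blast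
  qed
  moreover have "\<forall>\<^sub>F u in F. u \<in> herz_schur_multipliers \<mu> \<inter> C0_functions \<and> herz_schur_norm \<mu> u \<le> C"
    unfolding ev
  proof (intro bexI[OF _ J] ballI)
    fix u assume "u \<in> T ({}, 1)"
    then have "u \<in> C0_functions" "herz_schur_bound u C" by (auto simp: T_def)
    then show "u \<in> herz_schur_multipliers \<mu> \<inter> C0_functions \<and> herz_schur_norm \<mu> u \<le> C"
      using herz_schur_norm_le_iff[OF \<mu> C0_continuous C, of u] by auto
  qed
  moreover have "uniform_limit K (\<lambda>u. u) (\<lambda>_. 1) F" if "compact K" for K
    unfolding uniform_limit_iff ev
  proof (intro allI impI)
    fix e :: real assume "0 < e"
    then show "\<exists>i\<in>J. \<forall>u\<in>T i. \<forall>x\<in>K. dist (u x) 1 < e"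
      using that by (intro bexI[of _ "(K, e)"]) (auto simp: J_def T_def dist_norm)
  qed
  ultimately show ?lhs by blast
qed

lemma weak_haagerup_const_eq:
  fixes \<mu> :: "'a::{topological_group_add, t2_space} measure"
  assumes \<mu>: "left_haar_measure \<mu>"
  shows "weak_haagerup_const \<mu> = Inf {ennreal C | C. 0 < C \<and> haagerup_bound TYPE('a) C}"
proof -
  have "C > 0 \<and> (\<exists>F :: ('a \<Rightarrow> complex) filter. F \<noteq> bot \<and>
        (\<forall>\<^sub>F u in F. u \<in> herz_schur_multipliers \<mu> \<inter> C0_functions \<and> herz_schur_norm \<mu> u \<le> C) \<and>
        (\<forall>K. compact K \<longrightarrow> uniform_limit K (\<lambda>u. u) (\<lambda>_. 1) F)) \<longleftrightarrow> 0 < C \<and> haagerup_bound TYPE('a) C" for C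
    using haagerup_bound_iff_filter[OF \<mu>, of C] by auto
  then show ?thesis unfolding weak_haagerup_const_def by simp
qed

text \<open>
  Multipliers are bounded by their norm, and the approximants tend to 1 at the neutral element. In particular
  the weak Haagerup constant is never 0, which excludes products of the form \<open>0 * \<infinity>\<close>.
\<close>

lemma haagerup_bound_ge_1:
  assumes "haagerup_bound TYPE('a::{topological_group_add, t2_space}) C"
  shows "1 \<le> C"
proof (rule field_le_epsilon)
  fix e :: real assume e: "0 < e"
  have "compact {0 :: 'a}" by simp
  then obtain u :: "'a \<Rightarrow> complex" where u: "u \<in> C0_functions" "herz_schur_bound u C" "\<forall>x\<in>{0}. cmod (u x - 1) < e"
    by (rule haagerup_boundE[OF assms _ e])
  have "1 \<le> cmod (u 0) + cmod (u 0 - 1)"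
    using norm_triangle_sub[of 1 "u 0"] by (simp add: norm_minus_commute)
  then show "1 \<le> C + e" using u(3) herz_schur_bound_le[OF u(2), of 0] by simp
qed

lemma Inf_ennreal_image:
  fixes S :: "real set"
  assumes "S \<noteq> {}" "\<And>c. c \<in> S \<Longrightarrow> 0 \<le> c"
  shows "Inf (ennreal ` S) = ennreal (Inf S)"
proof (rule antisym)
  have bdd: "bdd_below S" using assms(2) by (rule bdd_belowI)
  show "ennreal (Inf S) \<le> Inf (ennreal ` S)"
    by (auto intro!: Inf_greatest ennreal_leI cInf_lower bdd)
  show "Inf (ennreal ` S) \<le> ennreal (Inf S)"
  proof (rule ennreal_le_epsilon)
    fix e :: real assume "0 < e"
    then have "Inf S < Inf S + e" by simp
    then obtain c where c: "c \<in> S" "c < Inf S + e" using cInf_lessD[OF assms(1)] by blast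
    have "0 \<le> Inf S" using assms by (intro cInf_greatest) auto
    have "Inf (ennreal ` S) \<le> ennreal c" using c(1) by (intro Inf_lower) auto
    also have "\<dots> \<le> ennreal (Inf S + e)" using c(2) by (intro ennreal_leI) simp
    also have "\<dots> = ennreal (Inf S) + ennreal e" using \<open>0 \<le> Inf S\<close> \<open>0 < e\<close> by (intro ennreal_plus) auto
    finally show "Inf (ennreal ` S) \<le> ennreal (Inf S) + ennreal e" .
  qed
qed

theorem theorem1p1:
  fixes \<mu>\<^sub>G :: "'g::{topological_group_add, t2_space} measure"
    and \<mu>\<^sub>H :: "'h::{topological_group_add, t2_space} measure"
    and \<mu>\<^sub>G\<^sub>H :: "('g \<times> 'h) measure"
  assumes "locally_compact_space (euclidean :: 'g topology)"
    and "locally_compact_space (euclidean :: 'h topology)"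
    and "left_haar_measure \<mu>\<^sub>G"
    and "left_haar_measure \<mu>\<^sub>H"
    and "left_haar_measure \<mu>\<^sub>G\<^sub>H"
  shows "weak_haagerup_const \<mu>\<^sub>G\<^sub>H = weak_haagerup_const \<mu>\<^sub>G * weak_haagerup_const \<mu>\<^sub>H"
proof -
  define S where "S = {C. 0 < C \<and> haagerup_bound TYPE('g) C}"
  define T where "T = {C. 0 < C \<and> haagerup_bound TYPE('h) C}"
  define R where "R = {C. 0 < C \<and> haagerup_bound TYPE('g \<times> 'h) C}"
  have const_eqs: "weak_haagerup_const \<mu>\<^sub>G = Inf (ennreal ` S)" "weak_haagerup_const \<mu>\<^sub>H = Inf (ennreal ` T)"
    "weak_haagerup_const \<mu>\<^sub>G\<^sub>H = Inf (ennreal ` R)"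
    unfolding S_def T_def R_def weak_haagerup_const_eq[OF assms(3)] weak_haagerup_const_eq[OF assms(4)]
      weak_haagerup_const_eq[OF assms(5)] by (simp_all add: image_Collect)
  have ge1: "1 \<le> c" if "c \<in> S \<or> c \<in> T \<or> c \<in> R" for c
    using that by (auto simp: S_def T_def R_def intro: haagerup_bound_ge_1)
  have prod: "c * d \<in> R" if "c \<in> S" "d \<in> T" for c d
    using that haagerup_bound_prod unfolding S_def T_def R_def by auto
  have factors: "E \<in> S" "E \<in> T" if "E \<in> R" for E
    using that haagerup_bound_factors unfolding S_def T_def R_def by auto
  show ?thesis
  proof (cases "S = {} \<or> T = {}")
    case True
    then have "R = {}" using factors by blast
    have "1 \<le> ennreal c" if "1 \<le> c" for c using ennreal_leI[OF that] by simp
    then have ge1': "1 \<le> Inf (ennreal ` S)" "1 \<le> Inf (ennreal ` T)"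
      using ge1 by (auto intro!: Inf_greatest)
    then have "Inf (ennreal ` S) \<noteq> 0" "Inf (ennreal ` T) \<noteq> 0" by auto
    with True show ?thesis
      unfolding const_eqs \<open>R = {}\<close> by (auto simp: ennreal_mult_top ennreal_top_mult)
  next
    case False
    then have ne: "S \<noteq> {}" "T \<noteq> {}" "R \<noteq> {}" using prod by auto
    have pos: "0 \<le> c" if "c \<in> S \<or> c \<in> T \<or> c \<in> R" for c using ge1[OF that] by simp
    have bdd: "bdd_below S" "bdd_below T" "bdd_below R" by (auto intro!: bdd_belowI[of _ 0] pos)
    have S1: "1 \<le> Inf S" and T1: "1 \<le> Inf T"
      using ne ge1 by (auto intro!: cInf_greatest)
    have "Inf R \<le> Inf S * Inf T"
    proof -
      have row: "Inf R / d \<le> Inf S" if d: "d \<in> T" for d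
      proof (rule cInf_greatest[OF ne(1)])
        fix c assume "c \<in> S"
        then have "Inf R \<le> c * d" using prod[OF _ d] bdd(3) by (intro cInf_lower) auto
        then show "Inf R / d \<le> c" using ge1[of d] d by (simp add: divide_le_eq)
      qed
      have "Inf R / Inf S \<le> d" if d: "d \<in> T" for d
      proof -
        have "0 < d" "0 < Inf S" using ge1[of d] d S1 by auto
        then show ?thesis using row[OF d] by (simp only: pos_divide_le_eq mult.commute)
      qed
      then have "Inf R / Inf S \<le> Inf T" by (intro cInf_greatest[OF ne(2)])
      then show ?thesis using S1 by (simp add: divide_le_eq mult.commute)
    qed
    moreover have "Inf S * Inf T \<le> Inf R"
    proof (rule cInf_greatest[OF ne(3)], rule field_le_mult_one_interval)
      fix E z :: real assume E: "E \<in> R" and z: "0 < z" "z < 1"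
      \<comment> \<open>Scaling both infima by \<open>sqrt z\<close> gives constants that are not admissible, whose product is \<open>z\<close> times the product.\<close>
      have below: "0 < sqrt z * Inf X \<and> sqrt z * Inf X \<notin> X" if "bdd_below X" "1 \<le> Inf X" for X
      proof
        show "0 < sqrt z * Inf X" using z that by simp
        have "sqrt z * Inf X < 1 * Inf X" using z that by (intro mult_strict_right_mono) auto
        then show "sqrt z * Inf X \<notin> X" using cInf_lower[OF _ that(1)] by fastforce
      qed
      have "(sqrt z * Inf S) * (sqrt z * Inf T) \<le> E"
        by (rule haagerup_bound_prod_ge[where 'g = 'g and 'h = 'h])
          (use E below[OF bdd(1) S1] below[OF bdd(2) T1] in \<open>auto simp: S_def T_def R_def\<close>)
      moreover have "(sqrt z * Inf S) * (sqrt z * Inf T) = (sqrt z * sqrt z) * (Inf S * Inf T)"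
        by (simp only: mult_ac)
      moreover have "sqrt z * sqrt z = z" using z by simp
      ultimately show "z * (Inf S * Inf T) \<le> E" by (simp only:)
    qed
    ultimately have "Inf R = Inf S * Inf T" by simp
    then show ?thesis
      unfolding const_eqs using ne pos S1 T1 by (simp add: Inf_ennreal_image ennreal_mult)
  qed
qed

end
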